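(* Assume that $a_0,a_1$ are bounded on $V\times V$, that $a_0(v,v)\ge 0$ for all $v\in V$ (no positive lower bound is assumed), that $a_1(v,v)\ge\beta|v|_V^2$ for all $v\in V$ with some $\beta>0$, and that $0<M_0=\nu([0,\infty))<\infty$. For $\varepsilon\in[0,1]$ let $(S_\varepsilon(t))_{t\ge0}$ be the contraction semigroup generated by $\mathcal A_\varepsilon$ on $\mathcal W$. Then, for every $X_0\in\mathcal W$ and every $T>0$, $$\sup_{0\le t\le T}\|S_\varepsilon(t)X_0-S_0(t)X_0\|_{\mathcal W}\to0\quad\text{as }\varepsilon\downarrow0.$$ More generally, suppose that $X_{0,\varepsilon}\to X_{0,0}$ in $\mathcal W$ and $f_\varepsilon\to f_0$ in $L^1(0,T;H)$ as $\varepsilon\downarrow0$, and for $\varepsilon\in[0,1]$ let $$X^\varepsilon(t)=S_\varepsilon(t)X_{0,\varepsilon}+\int_0^tS_\varepsilon(t-s)(f_\varepsilon(s),0)\,ds .$$ Then $X^\varepsilon\to X^0$ in $C([0,T];\mathcal W)$ as $\varepsilon\downarrow0$.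
   Context: Setting. $\Omega\subset\mathbb R^d$, $d\in\{1,2,3\}$, is a bounded Lipschitz domain; $H=L^2(\Omega)$, $V=H^1_0(\Omega)$ (real spaces), $|v|_V=\|\nabla v\|_{L^2(\Omega)}$, $\|v\|_V^2=\|v\|_H^2+|v|_V^2$; $H$ is identified with a subspace of $V'$. $A_0,A_1\in L^\infty(\Omega)^{d\times d}$ are symmetric matrix fields, $A_1$ pointwise positive semidefinite a.e., $a_i(w,v)=\int_\Omega A_i\nabla w\cdot\nabla v\,dx$, and $\mathsf A_i:V\to V'$ is given by $\langle\mathsf A_iw,v\rangle=a_i(w,v)$, $i=0,1$. $\nu$ is a non-zero non-negative Borel measure on $[0,\infty)$ (the Bernstein representing measure of the completely monotone kernel $k(t)=\int e^{-\lambda t}d\nu(\lambda)$). Spaces and operators. $\mathcal K$ is the Hilbert space of strongly $\nu$-measurable $\zeta:[0,\infty)\to V$ with $\|\zeta\|_{\mathcal K}^2=\int_{[0,\infty)}a_1(\zeta(\lambda),\zeta(\lambda))\,d\nu(\lambda)<\infty$; $\mathcal W=H\times\mathcal K$ with $\|(u,\zeta)\|_{\mathcal W}^2=\|u\|_H^2+\|\zeta\|_{\mathcal K}^2$. $J:\mathcal K\to V$, $J\zeta=\int\zeta\,d\nu$; $E:V\to\mathcal K$, $(Eu)(\lambda)=u$; $(\Lambda\zeta)(\lambda)=\lambda\zeta(\lambda)$. Perturbed family. $a_{\mathrm v}:V\times V\to\mathbb R$ is a bounded symmetric coercive bilinear form: $|a_{\mathrm v}(v,w)|\le C_{\mathrm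 v}\|v\|_V\|w\|_V$ and $a_{\mathrm v}(v,v)\ge\beta_{\mathrm v}|v|_V^2$ with $C_{\mathrm v},\beta_{\mathrm v}>0$; $\mathsf B:V\to V'$, $\langle\mathsf Bv,w\rangle=a_{\mathrm v}(v,w)$. For $\varepsilon\in[0,1]$, $\mathsf A_0^\varepsilon=\mathsf A_0+\varepsilon\mathsf B$, and $\mathcal A_\varepsilon(u,\zeta)=(-\mathsf A_0^\varepsilon u-\mathsf A_1J\zeta,\;Eu-\Lambda\zeta)$ with domain $D(\mathcal A_\varepsilon)=\{(u,\zeta)\in V\times\mathcal K:\ \mathsf A_0^\varepsilon u+\mathsf A_1J\zeta\in H,\ Eu-\Lambda\zeta\in\mathcal K\}$. Under the stated assumptions each $\mathcal A_\varepsilon$ is densely defined and $m$-dissipative, hence generates a $C_0$-semigroup of contractions on $\mathcal W$. *)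

theory Defs
  imports "HOL-Analysis.Analysis" "HOL-Library.Function_Algebras"
begin

section \<open>Pointwise scalar multiplication of functions\<close>

instantiation "fun" :: (type, real_vector) real_vector
begin

definition scaleR_fun_def: "c *\<^sub>R f = (\<lambda>x. c *\<^sub>R f x)"

instance
  by standard (simp_all add: scaleR_fun_def fun_eq_iff scaleR_add_right scaleR_add_left)

end

lemma scaleR_fun_apply [simp]: "(c *\<^sub>R f) x = c *\<^sub>R f x"
  by (simp add: scaleR_fun_def)


section \<open>Bochner integration and semigroups in seminormed spaces of representatives\<close>

text \<open>
  The spaces below depend on a domain, a measure and a bilinear form, so they are not types.
  Each of them is given by a carrier \<open>X\<close> in a real vector space of functions together with
  its norm \<open>N\<close>. Elements of \<open>X\<close> are representatives: \<open>x\<close> and \<open>y\<close> stand for the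
  same vector iff \<open>N (x - y) = 0\<close>.

  The next two definitions are those of strong measurability (almost everywhere limit of
  simple functions) and of \<^const>\<open>has_bochner_integral\<close>, with \<open>N\<close> in place of the norm of
  a type. The integrands below may be measurable only after a change on a null set, which does
  not affect the value of \<^const>\<open>nn_integral\<close>.
\<close>

definition strongly_measurable ::
  "'x::real_vector set \<Rightarrow> ('x \<Rightarrow> real) \<Rightarrow> 'a measure \<Rightarrow> ('a \<Rightarrow> 'x) \<Rightarrow> bool" where
  "strongly_measurable X N M f \<longleftrightarrow>
     (\<forall>t\<in>space M. f t \<in> X) \<and>
     (\<exists>s. (\<forall>n. simple_function M (s n) \<and> s n ` space M \<subseteq> X) \<and>
          (AE t in M. (\<lambda>n. N (s n t - f t)) \<longlonglongrightarrow> 0))"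

definition has_bochner_int ::
  "'x::real_vector set \<Rightarrow> ('x \<Rightarrow> real) \<Rightarrow> 'a measure \<Rightarrow> ('a \<Rightarrow> 'x) \<Rightarrow> 'x \<Rightarrow> bool" where
  "has_bochner_int X N M f y \<longleftrightarrow>
     strongly_measurable X N M f \<and> y \<in> X \<and>
     (\<exists>s. (\<forall>n. Bochner_Integration.simple_bochner_integrable M (s n) \<and> s n ` space M \<subseteq> X) \<and>
          (\<lambda>n. \<integral>\<^sup>+ t. ennreal (N (f t - s n t)) \<partial>M) \<longlonglongrightarrow> 0 \<and>
          (\<lambda>n. N (Bochner_Integration.simple_bochner_integral M (s n) - y)) \<longlonglongrightarrow> 0)"

definition bochner_int ::
  "'x::real_vector set \<Rightarrow> ('x \<Rightarrow> real) \<Rightarrow> 'a measure \<Rightarrow> ('a \<Rightarrow> 'x) \<Rightarrow> 'x" where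
  "bochner_int X N M f = (SOME y. has_bochner_int X N M f y)"

definition c0_contraction_semigroup ::
  "'x::real_vector set \<Rightarrow> ('x \<Rightarrow> real) \<Rightarrow> (real \<Rightarrow> 'x \<Rightarrow> 'x) \<Rightarrow> bool" where
  "c0_contraction_semigroup X N S \<longleftrightarrow>
     (\<forall>t\<ge>0. \<forall>x\<in>X. S t x \<in> X \<and> N (S t x) \<le> N x) \<and>
     (\<forall>t\<ge>0. \<forall>x\<in>X. \<forall>y\<in>X. \<forall>a b.
        N (S t (a *\<^sub>R x + b *\<^sub>R y) - (a *\<^sub>R S t x + b *\<^sub>R S t y)) = 0) \<and>
     (\<forall>x\<in>X. N (S 0 x - x) = 0) \<and>
     (\<forall>s\<ge>0. \<forall>t\<ge>0. \<forall>x\<in>X. N (S (s + t) x - S s (S t x)) = 0) \<and>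
     (\<forall>x\<in>X. ((\<lambda>t. N (S t x - x)) \<longlongrightarrow> 0) (at_right 0))"

definition has_generator ::
  "'x::real_vector set \<Rightarrow> ('x \<Rightarrow> real) \<Rightarrow> (real \<Rightarrow> 'x \<Rightarrow> 'x) \<Rightarrow> 'x set \<Rightarrow> ('x \<Rightarrow> 'x) \<Rightarrow> bool" where
  "has_generator X N S D A \<longleftrightarrow>
     (\<forall>x\<in>X. \<forall>y\<in>X.
        ((\<lambda>h. N ((1 / h) *\<^sub>R (S h x - x) - y)) \<longlongrightarrow> 0) (at_right 0) \<longleftrightarrow>
        x \<in> D \<and> N (A x - y) = 0)"

definition mild_solution ::
  "'x::real_vector set \<Rightarrow> ('x \<Rightarrow> real) \<Rightarrow> (real \<Rightarrow> 'x \<Rightarrow> 'x) \<Rightarrow> 'x \<Rightarrow> (real \<Rightarrow> 'x) \<Rightarrow> real \<Rightarrow> 'x" where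
  "mild_solution X N S x g t =
     S t x + bochner_int X N (lebesgue_on {0<..<t}) (\<lambda>s. S (t - s) (g s))"


section \<open>Bounded Lipschitz domains, \<open>L\<^sup>2\<close> and Sobolev spaces\<close>

text \<open>Near each boundary point, \<open>\<Omega>\<close> is the part of a ball lying above the graph of a
  Lipschitz function over the hyperplane orthogonal to some unit vector \<open>e\<close>.\<close>

definition bounded_lipschitz_domain :: "(real^'d) set \<Rightarrow> bool" where
  "bounded_lipschitz_domain \<Omega> \<longleftrightarrow>
     open \<Omega> \<and> connected \<Omega> \<and> \<Omega> \<noteq> {} \<and> bounded \<Omega> \<and>
     (\<forall>x\<in>frontier \<Omega>. \<exists>r>0. \<exists>e L. \<exists>g :: real^'d \<Rightarrow> real.
        norm e = 1 \<and> L-lipschitz_on {z. z \<bullet> e = 0} g \<and>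
        \<Omega> \<inter> ball x r = {y \<in> ball x r. g (y - (y \<bullet> e) *\<^sub>R e) < y \<bullet> e})"

definition partial :: "'d::finite \<Rightarrow> (real^'d \<Rightarrow> real) \<Rightarrow> real^'d \<Rightarrow> real" where
  "partial i f x = frechet_derivative f (at x) (axis i 1)"

primrec Ck :: "nat \<Rightarrow> (real^'d::finite \<Rightarrow> real) \<Rightarrow> bool" where
  "Ck 0 f = continuous_on UNIV f"
| "Ck (Suc k) f = ((\<forall>x. f differentiable at x) \<and> (\<forall>i. Ck k (partial i f)))"

definition test_functions :: "(real^'d) set \<Rightarrow> (real^'d \<Rightarrow> real) set" where
  "test_functions \<Omega> =
     {\<phi>. (\<forall>k. Ck k \<phi>) \<and> compact (closure {x. \<phi> x \<noteq> 0}) \<and> closure {x. \<phi> x \<noteq> 0} \<subseteq> \<Omega>}"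

definition L2 :: "(real^'d) set \<Rightarrow> (real^'d \<Rightarrow> 'b::euclidean_space) set" where
  "L2 \<Omega> = {f \<in> borel_measurable (lebesgue_on \<Omega>). integrable (lebesgue_on \<Omega>) (\<lambda>x. (norm (f x))\<^sup>2)}"

definition L2_norm :: "(real^'d) set \<Rightarrow> (real^'d \<Rightarrow> 'b::euclidean_space) \<Rightarrow> real" where
  "L2_norm \<Omega> f = sqrt (\<integral>x. (norm (f x))\<^sup>2 \<partial>lebesgue_on \<Omega>)"

definition weak_gradient :: "(real^'d) set \<Rightarrow> (real^'d \<Rightarrow> real) \<Rightarrow> (real^'d \<Rightarrow> real^'d) \<Rightarrow> bool" where
  "weak_gradient \<Omega> u g \<longleftrightarrow>
     (\<forall>\<phi>\<in>test_functions \<Omega>. \<forall>i.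
        (\<integral>x. u x * partial i \<phi> x \<partial>lebesgue_on \<Omega>) = - (\<integral>x. g x $ i * \<phi> x \<partial>lebesgue_on \<Omega>))"

definition H1 :: "(real^'d) set \<Rightarrow> (real^'d \<Rightarrow> real) set" where
  "H1 \<Omega> = {u \<in> L2 \<Omega>. \<exists>g\<in>L2 \<Omega>. weak_gradient \<Omega> u g}"

definition grad :: "(real^'d) set \<Rightarrow> (real^'d \<Rightarrow> real) \<Rightarrow> real^'d \<Rightarrow> real^'d" where
  "grad \<Omega> u = (SOME g. g \<in> L2 \<Omega> \<and> weak_gradient \<Omega> u g)"

definition V_seminorm :: "(real^'d) set \<Rightarrow> (real^'d \<Rightarrow> real) \<Rightarrow> real" where
  "V_seminorm \<Omega> v = L2_norm \<Omega> (grad \<Omega> v)"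

definition V_norm :: "(real^'d) set \<Rightarrow> (real^'d \<Rightarrow> real) \<Rightarrow> real" where
  "V_norm \<Omega> v = sqrt ((L2_norm \<Omega> v)\<^sup>2 + (V_seminorm \<Omega> v)\<^sup>2)"

text \<open>\<open>H\<^sup>1\<^sub>0(\<Omega>)\<close>: the closure of the test functions in \<open>H\<^sup>1(\<Omega>)\<close>.\<close>

definition V_space :: "(real^'d) set \<Rightarrow> (real^'d \<Rightarrow> real) set" where
  "V_space \<Omega> = {u \<in> H1 \<Omega>. \<exists>\<phi>. (\<forall>n. \<phi> n \<in> test_functions \<Omega>) \<and> (\<lambda>n. V_norm \<Omega> (\<phi> n - u)) \<longlonglongrightarrow> 0}"


section \<open>Coefficients and bilinear forms\<close>

definition Linf_symmetric_field :: "(real^'d) set \<Rightarrow> (real^'d \<Rightarrow> real^'d^'d) \<Rightarrow> bool" where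
  "Linf_symmetric_field \<Omega> A \<longleftrightarrow>
     A \<in> borel_measurable (lebesgue_on \<Omega>) \<and>
     (\<exists>C. AE x in lebesgue_on \<Omega>. norm (A x) \<le> C) \<and>
     (AE x in lebesgue_on \<Omega>. transpose (A x) = A x)"

definition psd_field :: "(real^'d) set \<Rightarrow> (real^'d \<Rightarrow> real^'d^'d) \<Rightarrow> bool" where
  "psd_field \<Omega> A \<longleftrightarrow> (AE x in lebesgue_on \<Omega>. \<forall>\<xi>. 0 \<le> (A x *v \<xi>) \<bullet> \<xi>)"

definition dirichlet_form ::
  "(real^'d) set \<Rightarrow> (real^'d \<Rightarrow> real^'d^'d) \<Rightarrow> (real^'d \<Rightarrow> real) \<Rightarrow> (real^'d \<Rightarrow> real) \<Rightarrow> real" where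
  "dirichlet_form \<Omega> A w v = (\<integral>x. (A x *v grad \<Omega> w x) \<bullet> grad \<Omega> v x \<partial>lebesgue_on \<Omega>)"

definition bounded_form_on_V ::
  "(real^'d) set \<Rightarrow> ((real^'d \<Rightarrow> real) \<Rightarrow> (real^'d \<Rightarrow> real) \<Rightarrow> real) \<Rightarrow> bool" where
  "bounded_form_on_V \<Omega> a \<longleftrightarrow>
     (\<exists>C>0. \<forall>v\<in>V_space \<Omega>. \<forall>w\<in>V_space \<Omega>. \<bar>a v w\<bar> \<le> C * V_norm \<Omega> v * V_norm \<Omega> w)"

definition coercive_form_on_V ::
  "(real^'d) set \<Rightarrow> ((real^'d \<Rightarrow> real) \<Rightarrow> (real^'d \<Rightarrow> real) \<Rightarrow> real) \<Rightarrow> bool" where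
  "coercive_form_on_V \<Omega> a \<longleftrightarrow>
     (\<exists>\<beta>>0. \<forall>v\<in>V_space \<Omega>. a v v \<ge> \<beta> * (V_seminorm \<Omega> v)\<^sup>2)"

definition symmetric_bilinear_on_V ::
  "(real^'d) set \<Rightarrow> ((real^'d \<Rightarrow> real) \<Rightarrow> (real^'d \<Rightarrow> real) \<Rightarrow> real) \<Rightarrow> bool" where
  "symmetric_bilinear_on_V \<Omega> a \<longleftrightarrow>
     (\<forall>u\<in>V_space \<Omega>. \<forall>v\<in>V_space \<Omega>. a u v = a v u) \<and>
     (\<forall>u\<in>V_space \<Omega>. \<forall>v\<in>V_space \<Omega>. \<forall>w\<in>V_space \<Omega>. \<forall>c d.
        a (c *\<^sub>R u + d *\<^sub>R v) w = c * a u w + d * a v w)"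


section \<open>History space and evolution operator\<close>

definition K_space ::
  "(real^'d) set \<Rightarrow> ((real^'d \<Rightarrow> real) \<Rightarrow> (real^'d \<Rightarrow> real) \<Rightarrow> real) \<Rightarrow> real measure
     \<Rightarrow> (real \<Rightarrow> real^'d \<Rightarrow> real) set" where
  "K_space \<Omega> a1 \<nu> =
     {\<zeta>. strongly_measurable (V_space \<Omega>) (V_norm \<Omega>) \<nu> \<zeta> \<and>
         (\<integral>\<^sup>+ l. ennreal (a1 (\<zeta> l) (\<zeta> l)) \<partial>\<nu>) < \<infinity>}"

definition K_norm ::
  "((real^'d \<Rightarrow> real) \<Rightarrow> (real^'d \<Rightarrow> real) \<Rightarrow> real) \<Rightarrow> real measure
     \<Rightarrow> (real \<Rightarrow> real^'d \<Rightarrow> real) \<Rightarrow> real" where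
  "K_norm a1 \<nu> \<zeta> = sqrt (enn2real (\<integral>\<^sup>+ l. ennreal (a1 (\<zeta> l) (\<zeta> l)) \<partial>\<nu>))"

definition W_space ::
  "(real^'d) set \<Rightarrow> ((real^'d \<Rightarrow> real) \<Rightarrow> (real^'d \<Rightarrow> real) \<Rightarrow> real) \<Rightarrow> real measure
     \<Rightarrow> ((real^'d \<Rightarrow> real) \<times> (real \<Rightarrow> real^'d \<Rightarrow> real)) set" where
  "W_space \<Omega> a1 \<nu> = L2 \<Omega> \<times> K_space \<Omega> a1 \<nu>"

definition W_norm ::
  "(real^'d) set \<Rightarrow> ((real^'d \<Rightarrow> real) \<Rightarrow> (real^'d \<Rightarrow> real) \<Rightarrow> real) \<Rightarrow> real measure
     \<Rightarrow> (real^'d \<Rightarrow> real) \<times> (real \<Rightarrow> real^'d \<Rightarrow> real) \<Rightarrow> real" where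
  "W_norm \<Omega> a1 \<nu> X = sqrt ((L2_norm \<Omega> (fst X))\<^sup>2 + (K_norm a1 \<nu> (snd X))\<^sup>2)"

definition J_op :: "(real^'d) set \<Rightarrow> real measure \<Rightarrow> (real \<Rightarrow> real^'d \<Rightarrow> real) \<Rightarrow> real^'d \<Rightarrow> real" where
  "J_op \<Omega> \<nu> \<zeta> = bochner_int (V_space \<Omega>) (V_norm \<Omega>) \<nu> \<zeta>"

definition E_op :: "(real^'d \<Rightarrow> real) \<Rightarrow> real \<Rightarrow> real^'d \<Rightarrow> real" where
  "E_op u = (\<lambda>l. u)"

definition Lambda_op :: "(real \<Rightarrow> real^'d \<Rightarrow> real) \<Rightarrow> real \<Rightarrow> real^'d \<Rightarrow> real" where
  "Lambda_op \<zeta> = (\<lambda>l. l *\<^sub>R \<zeta> l)"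

text \<open>A functional \<open>F\<close> on \<open>V\<close> belongs to \<open>H\<close> (as a subspace of \<open>V'\<close>) iff it is the
  \<open>L\<^sup>2\<close> pairing with some \<open>h\<close> in \<open>H\<close>; by density of \<open>V\<close> in \<open>H\<close>, \<open>h\<close> is unique
  up to a null set.\<close>

definition represents_in_H :: "(real^'d) set \<Rightarrow> ((real^'d \<Rightarrow> real) \<Rightarrow> real) \<Rightarrow> (real^'d \<Rightarrow> real) \<Rightarrow> bool" where
  "represents_in_H \<Omega> F h \<longleftrightarrow>
     h \<in> L2 \<Omega> \<and> (\<forall>v\<in>V_space \<Omega>. F v = (\<integral>x. h x * v x \<partial>lebesgue_on \<Omega>))"

text \<open>The functional \<open>A\<^sub>0 u + A\<^sub>1 J \<zeta>\<close> in \<open>V'\<close>, where \<open>a0\<close> and \<open>a1\<close> are the forms of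
  \<open>A\<^sub>0\<close> and \<open>A\<^sub>1\<close>.\<close>

definition stress_functional ::
  "(real^'d) set \<Rightarrow> ((real^'d \<Rightarrow> real) \<Rightarrow> (real^'d \<Rightarrow> real) \<Rightarrow> real)
     \<Rightarrow> ((real^'d \<Rightarrow> real) \<Rightarrow> (real^'d \<Rightarrow> real) \<Rightarrow> real) \<Rightarrow> real measure
     \<Rightarrow> (real^'d \<Rightarrow> real) \<times> (real \<Rightarrow> real^'d \<Rightarrow> real) \<Rightarrow> (real^'d \<Rightarrow> real) \<Rightarrow> real" where
  "stress_functional \<Omega> a0 a1 \<nu> X = (\<lambda>v. a0 (fst X) v + a1 (J_op \<Omega> \<nu> (snd X)) v)"

definition gen_domain ::
  "(real^'d) set \<Rightarrow> ((real^'d \<Rightarrow> real) \<Rightarrow> (real^'d \<Rightarrow> real) \<Rightarrow> real)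
     \<Rightarrow> ((real^'d \<Rightarrow> real) \<Rightarrow> (real^'d \<Rightarrow> real) \<Rightarrow> real) \<Rightarrow> real measure
     \<Rightarrow> ((real^'d \<Rightarrow> real) \<times> (real \<Rightarrow> real^'d \<Rightarrow> real)) set" where
  "gen_domain \<Omega> a0 a1 \<nu> =
     {(u, \<zeta>). u \<in> V_space \<Omega> \<and> \<zeta> \<in> K_space \<Omega> a1 \<nu> \<and>
        (\<exists>h. represents_in_H \<Omega> (stress_functional \<Omega> a0 a1 \<nu> (u, \<zeta>)) h) \<and>
        E_op u - Lambda_op \<zeta> \<in> K_space \<Omega> a1 \<nu>}"

definition gen_op ::
  "(real^'d) set \<Rightarrow> ((real^'d \<Rightarrow> real) \<Rightarrow> (real^'d \<Rightarrow> real) \<Rightarrow> real)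
     \<Rightarrow> ((real^'d \<Rightarrow> real) \<Rightarrow> (real^'d \<Rightarrow> real) \<Rightarrow> real) \<Rightarrow> real measure
     \<Rightarrow> (real^'d \<Rightarrow> real) \<times> (real \<Rightarrow> real^'d \<Rightarrow> real)
     \<Rightarrow> (real^'d \<Rightarrow> real) \<times> (real \<Rightarrow> real^'d \<Rightarrow> real)" where
  "gen_op \<Omega> a0 a1 \<nu> X =
     (- (SOME h. represents_in_H \<Omega> (stress_functional \<Omega> a0 a1 \<nu> X) h),
      E_op (fst X) - Lambda_op (snd X))"

text \<open>The form of \<open>A\<^sub>0 + \<epsilon> B\<close>.\<close>

definition perturbed_form ::
  "((real^'d \<Rightarrow> real) \<Rightarrow> (real^'d \<Rightarrow> real) \<Rightarrow> real)
     \<Rightarrow> ((real^'d \<Rightarrow> real) \<Rightarrow> (real^'d \<Rightarrow> real) \<Rightarrow> real) \<Rightarrow> real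
     \<Rightarrow> (real^'d \<Rightarrow> real) \<Rightarrow> (real^'d \<Rightarrow> real) \<Rightarrow> real" where
  "perturbed_form a0 av \<epsilon> w v = a0 w v + \<epsilon> * av w v"

definition L1_time :: "(real^'d) set \<Rightarrow> real \<Rightarrow> (real \<Rightarrow> real^'d \<Rightarrow> real) set" where
  "L1_time \<Omega> T =
     {f. strongly_measurable (L2 \<Omega>) (L2_norm \<Omega>) (lebesgue_on {0<..<T}) f \<and>
         (\<integral>\<^sup>+ s. ennreal (L2_norm \<Omega> (f s)) \<partial>lebesgue_on {0<..<T}) < \<infinity>}"

end

theory Submission
  imports Defs
begin

text \<open>
  The proof is an energy estimate. Let \<open>Z\<close> be in the domain of \<open>A\<^sub>\<epsilon>\<close> and \<open>Y = (p, \<xi>)\<close> in the domain of \<open>A\<^sub>0\<close>, and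
  let \<open>(w, \<eta>) = Z - Y\<close>. In \<open>(Z - Y, A\<^sub>\<epsilon> Z - A\<^sub>0 Y)\<^sub>W\<close> the coupling terms \<open>- a\<^sub>1(J \<eta>, w)\<close> and \<open>(\<eta>, E w)\<^sub>K\<close> cancel,
  and \<open>- a\<^sub>0(w, w)\<close> and \<open>- (\<eta>, \<Lambda> \<eta>)\<^sub>K\<close> are not positive. What is left is at most
  \<open>- \<epsilon> a\<^sub>v(w, w) - \<epsilon> a\<^sub>v(p, w) \<le> \<epsilon> C \<parallel>p\<parallel>\<^sub>V\<^sup>2\<close>: the coercivity of the perturbation absorbs the factor \<open>w\<close>, so the loss
  of the lower bound on \<open>a\<^sub>0\<close> is harmless (\<open>energy_defect\<close>). Moreover \<open>\<parallel>p\<parallel>\<^sub>V\<close> is controlled by the graph norm of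
  \<open>A\<^sub>0\<close>, because \<open>p = y(\<lambda>) + \<lambda> \<xi>(\<lambda>)\<close> with \<open>y = E p - \<Lambda> \<xi>\<close> in \<open>K\<close> can be averaged over a bounded interval of positive
  \<open>\<nu>\<close>-mass (\<open>first_component_bound\<close>), and the graph norm does not increase along \<open>S\<^sub>0\<close>. The derivative of
  \<open>\<parallel>S\<^sub>\<epsilon>(t) Z - S\<^sub>0(t) Y\<parallel>\<^sup>2\<close> is therefore \<open>O(\<epsilon>)\<close> (\<open>distance_growth\<close>). The operator \<open>A\<^sub>\<epsilon>\<close> is never applied to elements
  of the domain of \<open>A\<^sub>0\<close>, so the dependence of the domain on \<open>\<epsilon>\<close> does no harm. Since the domains are dense
  (\<open>D_dense\<close>) and all semigroups are contractive, convergence follows for every initial value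
  (\<open>strong_convergence\<close>). For the mild solutions the forcing is approximated in \<open>L\<^sup>1\<close> by a simple function, for
  which only finitely many orbits are involved (\<open>mild_convergence\<close>).

  This argument is carried out for an abstract family of contraction semigroups in a Hilbert space of
  representatives. Bochner integrals are studied through the real integrals that arise by applying bounded
  functionals, which reduces their norm estimates and translation properties to the scalar theory. It then
  remains to see that the concrete spaces are complete and that the concrete forms are bilinear. Linearity of the
  gradient, which is selected among all weak gradients, rests on the fundamental lemma of the calculus of
  variations (\<open>test_orthogonal_AE_0\<close>) and hence on a supply of test functions built from \<open>exp (- 1 / t)\<close>.
  Poincare's inequality (\<open>poincare\<close>) makes \<open>a\<^sub>1\<close> an inner product for the topology of \<open>V\<close>, so that \<open>K\<close> is an
  \<open>L\<^sup>2\<close> space with values in a Hilbert space and \<open>J\<close> is defined on all of it.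
\<close>

section \<open>Measurability modulo null sets\<close>

lemma (in complete_measure) borel_measurable_cong_AE:
  fixes f g :: "'a \<Rightarrow> real"
  assumes f: "f \<in> borel_measurable M" and eq: "AE x in M. f x = g x"
  shows "g \<in> borel_measurable M"
proof (rule measurableI)
  fix B :: "real set" assume B: "B \<in> sets borel"
  have B': "f -` B \<inter> space M \<in> sets M" using f B by (rule measurable_sets)
  have "AE x in M. x \<in> f -` B \<inter> space M \<longleftrightarrow> x \<in> g -` B \<inter> space M"
    using eq by eventually_elim auto
  then show "g -` B \<inter> space M \<in> sets M" using B' by (rule in_sets_AE) auto
qed auto

text \<open>The integrands below are limits of measurable functions almost everywhere only, so that they are measurable
  for the completed measure but in general not for the given one. Real integrals are therefore taken with respect
  to the completion; this does not change \<^const>\<open>nn_integral\<close>.\<close>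

lemma borel_measurable_completion_AE_limit:
  fixes f :: "nat \<Rightarrow> 'a \<Rightarrow> real"
  assumes f: "\<And>n. f n \<in> borel_measurable M"
    and lim: "AE x in M. (\<lambda>n. f n x) \<longlonglongrightarrow> g x"
  shows "g \<in> borel_measurable (completion M)"
proof (rule completion.borel_measurable_cong_AE)
  show "(\<lambda>x. lim (\<lambda>n. f n x)) \<in> borel_measurable (completion M)"
    using f by (intro measurable_completion borel_measurable_lim_metric) auto
  show "AE x in completion M. lim (\<lambda>n. f n x) = g x"
    unfolding AE_completion_iff using lim by eventually_elim (rule limI)
qed

lemma finite_measure_completion: "finite_measure M \<Longrightarrow> finite_measure (completion M)"
  by (intro finite_measureI) (simp add: finite_measure.emeasure_finite)

lemma AM_GM_weighted: "0 < c \<Longrightarrow> x \<le> c * x\<^sup>2 + 1 / c" for x c :: real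
proof -
  assume c: "0 < c"
  have "0 \<le> (c * x - 1/2)\<^sup>2" by simp
  then have "c * x \<le> c * (c * x\<^sup>2 + 1 / c)"
    using c by (simp add: power2_eq_square algebra_simps)
  then show ?thesis using c by (simp add: mult_le_cancel_left_pos)
qed

lemma AE_summable_of_nn_integral:
  fixes d :: "nat \<Rightarrow> 'a \<Rightarrow> real"
  assumes d: "\<And>n. d n \<in> borel_measurable (completion M)" and nonneg: "\<And>n x. x \<in> space M \<Longrightarrow> 0 \<le> d n x"
    and le: "\<And>n. (\<integral>\<^sup>+x. ennreal (d n x) \<partial>M) \<le> ennreal (b n)" and b: "summable b" "\<And>n. 0 \<le> b n"
  shows "AE x in M. summable (\<lambda>n. d n x)"
proof -
  have "(\<integral>\<^sup>+x. (\<Sum>n. ennreal (d n x)) \<partial>completion M) = (\<Sum>n. \<integral>\<^sup>+x. ennreal (d n x) \<partial>completion M)"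
    using d by (intro nn_integral_suminf) auto
  also have "\<dots> \<le> (\<Sum>n. ennreal (b n))"
    unfolding nn_integral_completion by (intro suminf_le le) auto
  also have "\<dots> < \<infinity>"
    using b by (subst suminf_ennreal2) auto
  finally have "AE x in completion M. (\<Sum>n. ennreal (d n x)) \<noteq> \<infinity>"
    using d by (intro nn_integral_noteq_infinite) auto
  then have "AE x in M. (\<Sum>n. ennreal (d n x)) \<noteq> \<infinity>" by (simp add: AE_completion_iff)
  then show ?thesis
  proof (rule AE_mp, intro AE_I2 impI)
    fix x assume "x \<in> space M" "(\<Sum>n. ennreal (d n x)) \<noteq> \<infinity>"
    then show "summable (\<lambda>n. d n x)" using nonneg
      by (intro summable_suminf_not_top) (auto simp: top_unique)
  qed
qed

text \<open>On a finite measure space the weighted inequality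
  \<open>x \<le> 2 ^ n * x\<^sup>2 + 2 ^ (-n)\<close> turns square-summability at a geometric rate into summability.\<close>

lemma AE_summable_of_rapid:
  fixes d :: "nat \<Rightarrow> 'a \<Rightarrow> real"
  assumes fin: "finite_measure M"
    and d: "\<And>n. d n \<in> borel_measurable (completion M)" and nonneg: "\<And>n x. x \<in> space M \<Longrightarrow> 0 \<le> d n x"
    and le: "\<And>n. (\<integral>\<^sup>+x. ennreal ((d n x)\<^sup>2) \<partial>M) \<le> ennreal (C * (1/4)^n)" and C: "0 \<le> C"
  shows "AE x in M. summable (\<lambda>n. d n x)"
proof -
  let ?M = "completion M"
  interpret finite_measure ?M by (rule finite_measure_completion[OF fin])
  let ?b = "\<lambda>n. (1/2::real)^n * (C + measure ?M (space ?M))"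
  have sb: "summable ?b"
    by (intro summable_mult2 summable_geometric) simp
  have bound: "(\<integral>\<^sup>+x. ennreal (d n x) \<partial>?M) \<le> ennreal (?b n)" for n
  proof -
    have "(\<integral>\<^sup>+x. ennreal (d n x) \<partial>?M) \<le> (\<integral>\<^sup>+x. ennreal (2^n) * ennreal ((d n x)\<^sup>2) + ennreal ((1/2)^n) \<partial>?M)"
    proof (rule nn_integral_mono)
      fix x
      have "d n x \<le> 2^n * (d n x)\<^sup>2 + (1/2)^n"
        using AM_GM_weighted[of "2^n" "d n x"] by (simp add: power_one_over)
      then show "ennreal (d n x) \<le> ennreal (2^n) * ennreal ((d n x)\<^sup>2) + ennreal ((1/2)^n)"
        by (simp flip: ennreal_mult ennreal_plus add: ennreal_leI)
    qed
    also have "\<dots> = ennreal (2^n) * (\<integral>\<^sup>+x. ennreal ((d n x)\<^sup>2) \<partial>?M) + ennreal ((1/2)^n) * emeasure ?M (space ?M)"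
      using d by (subst nn_integral_add) (auto simp: nn_integral_cmult)
    also have "\<dots> \<le> ennreal (2^n) * ennreal (C * (1/4)^n) + ennreal ((1/2)^n) * ennreal (measure ?M (space ?M))"
      unfolding nn_integral_completion
      by (intro add_mono mult_left_mono le) (auto simp: emeasure_eq_measure)
    also have "\<dots> = ennreal (2^n * (C * (1/4)^n) + (1/2)^n * measure ?M (space ?M))"
      using C by (simp flip: ennreal_mult ennreal_plus)
    also have "2^n * (C * (1/4)^n) + (1/2)^n * measure ?M (space ?M) = ?b n"
      by (simp add: algebra_simps flip: power_mult_distrib)
    finally show ?thesis .
  qed
  show ?thesis
    by (rule AE_summable_of_nn_integral[OF d nonneg bound[unfolded nn_integral_completion] sb]) (use C in auto)
qed

text \<open>Fatou's lemma. Since \<^const>\<open>nn_integral\<close> ignores null sets, the limit may fail to exist or be changed on such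
  a set.\<close>

lemma nn_integral_AE_limit_le:
  fixes f :: "nat \<Rightarrow> 'a \<Rightarrow> real"
  assumes f: "\<And>n. f n \<in> borel_measurable (completion M)"
    and lim: "AE x in M. (\<lambda>n. f n x) \<longlonglongrightarrow> g x"
    and le: "\<And>n. n \<ge> n0 \<Longrightarrow> (\<integral>\<^sup>+x. ennreal (f n x) \<partial>M) \<le> c"
  shows "(\<integral>\<^sup>+x. ennreal (g x) \<partial>M) \<le> c"
proof -
  have "(\<integral>\<^sup>+x. ennreal (g x) \<partial>M) = (\<integral>\<^sup>+x. liminf (\<lambda>n. ennreal (f n x)) \<partial>M)"
  proof (rule nn_integral_cong_AE)
    show "AE x in M. ennreal (g x) = liminf (\<lambda>n. ennreal (f n x))"
      using lim
      by eventually_elim (rule lim_imp_Liminf[symmetric], auto intro: tendsto_ennrealI)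
  qed
  also have "\<dots> = (\<integral>\<^sup>+x. liminf (\<lambda>n. ennreal (f n x)) \<partial>completion M)"
    by (simp add: nn_integral_completion)
  also have "\<dots> \<le> liminf (\<lambda>n. \<integral>\<^sup>+x. ennreal (f n x) \<partial>completion M)"
    using f by (intro nn_integral_liminf) auto
  also have "\<dots> \<le> c"
    unfolding nn_integral_completion
    by (rule Liminf_le) (use le in \<open>auto simp: eventually_sequentially\<close>)
  finally show ?thesis .
qed

lemma tendsto_zero_le:
  fixes f :: "'a \<Rightarrow> real"
  assumes "(g \<longlongrightarrow> c) F" "\<And>n. norm (f n) \<le> g n" "c = 0"
  shows "(f \<longlongrightarrow> 0) F"
  using assms by (intro Lim_null_comparison[of f g F]) auto

section \<open>Semi-inner product spaces of representatives\<close>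

text \<open>The carrier consists of representatives: a nonzero vector may have seminorm zero. The seminorm is a parameter of
  its own, prescribed on the carrier only, so that norms given by other formulas can be used.\<close>

locale semi_inner_space =
  fixes X :: "'x::real_vector set" and N :: "'x \<Rightarrow> real" and ip :: "'x \<Rightarrow> 'x \<Rightarrow> real"
  assumes zero_mem: "0 \<in> X"
    and lin_mem: "\<And>x y a b. x \<in> X \<Longrightarrow> y \<in> X \<Longrightarrow> a *\<^sub>R x + b *\<^sub>R y \<in> X"
    and ip_sym: "\<And>x y. x \<in> X \<Longrightarrow> y \<in> X \<Longrightarrow> ip x y = ip y x"
    and ip_lin: "\<And>x y z a b. x \<in> X \<Longrightarrow> y \<in> X \<Longrightarrow> z \<in> X \<Longrightarrow>
                   ip (a *\<^sub>R x + b *\<^sub>R y) z = a * ip x z + b * ip y z"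
    and ip_nonneg: "\<And>x. x \<in> X \<Longrightarrow> 0 \<le> ip x x"
    and N_eq: "\<And>x. x \<in> X \<Longrightarrow> N x = sqrt (ip x x)"
begin

lemma add_mem: "x \<in> X \<Longrightarrow> y \<in> X \<Longrightarrow> x + y \<in> X"
  using lin_mem[of x y 1 1] by simp

lemma diff_mem: "x \<in> X \<Longrightarrow> y \<in> X \<Longrightarrow> x - y \<in> X"
  using lin_mem[of x y 1 "-1"] by simp

lemma scale_mem: "x \<in> X \<Longrightarrow> a *\<^sub>R x \<in> X"
  using lin_mem[of x x a 0] by simp

lemmas mem = zero_mem add_mem diff_mem scale_mem

lemma sum_mem: "(\<And>i. i \<in> I \<Longrightarrow> f i \<in> X) \<Longrightarrow> (\<Sum>i\<in>I. f i) \<in> X"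
  by (induction I rule: infinite_finite_induct) (auto intro: mem)

lemma ip_add: "x \<in> X \<Longrightarrow> y \<in> X \<Longrightarrow> z \<in> X \<Longrightarrow> ip (x + y) z = ip x z + ip y z"
  using ip_lin[of x y z 1 1] by simp

lemma ip_diff: "x \<in> X \<Longrightarrow> y \<in> X \<Longrightarrow> z \<in> X \<Longrightarrow> ip (x - y) z = ip x z - ip y z"
  using ip_lin[of x y z 1 "-1"] by simp

lemma ip_scale: "x \<in> X \<Longrightarrow> z \<in> X \<Longrightarrow> ip (a *\<^sub>R x) z = a * ip x z"
  using ip_lin[of x x z a 0] by simp

lemma ip_add_right: "x \<in> X \<Longrightarrow> y \<in> X \<Longrightarrow> z \<in> X \<Longrightarrow> ip z (x + y) = ip z x + ip z y"
  by (metis add_mem ip_add ip_sym)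

lemma ip_diff_right: "x \<in> X \<Longrightarrow> y \<in> X \<Longrightarrow> z \<in> X \<Longrightarrow> ip z (x - y) = ip z x - ip z y"
  by (metis diff_mem ip_diff ip_sym)

lemma ip_scale_right: "x \<in> X \<Longrightarrow> z \<in> X \<Longrightarrow> ip z (a *\<^sub>R x) = a * ip z x"
  by (metis scale_mem ip_scale ip_sym)

lemma ip_zero: "z \<in> X \<Longrightarrow> ip 0 z = 0" "z \<in> X \<Longrightarrow> ip z 0 = 0"
  using ip_diff[of z z z] ip_diff_right[of z z z] by auto

lemma N_nonneg: "x \<in> X \<Longrightarrow> 0 \<le> N x"
  by (simp add: N_eq ip_nonneg)

lemma N_sq: "x \<in> X \<Longrightarrow> (N x)\<^sup>2 = ip x x"
  by (simp add: N_eq ip_nonneg)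

lemma N_zero: "N 0 = 0"
  by (simp add: N_eq zero_mem ip_zero)

text \<open>A vector of seminorm zero need not be zero, so the usual optimal multiple of \<open>y\<close> may be undefined; in that
  case the quadratic polynomial is affine and its nonnegativity forces \<open>ip x y = 0\<close>.\<close>

lemma cauchy_schwarz:
  assumes x: "x \<in> X" and y: "y \<in> X"
  shows "\<bar>ip x y\<bar> \<le> N x * N y"
proof -
  have pos: "0 \<le> ip x x + 2 * t * ip x y + t\<^sup>2 * ip y y" for t
  proof -
    have "0 \<le> ip (x + t *\<^sub>R y) (x + t *\<^sub>R y)" using x y by (intro ip_nonneg mem)
    also have "\<dots> = ip x x + 2 * t * ip x y + t\<^sup>2 * ip y y"
      using x y ip_sym[of y x]
      by (simp add: ip_add ip_add_right ip_scale ip_scale_right mem power2_eq_square algebra_simps)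
    finally show ?thesis .
  qed
  have "(ip x y)\<^sup>2 \<le> ip x x * ip y y"
  proof (cases "ip y y = 0")
    case True
    have "ip x y = 0"
    proof (rule ccontr)
      assume ne: "ip x y \<noteq> 0"
      have "0 \<le> ip x x + 2 * (- (ip x x + 1) / (2 * ip x y)) * ip x y"
        using pos[of "- (ip x x + 1) / (2 * ip x y)"] True by simp
      also have "\<dots> = -1" using ne by (simp add: field_simps)
      finally show False by simp
    qed
    then show ?thesis using True by simp
  next
    case False
    then have p: "0 < ip y y" using ip_nonneg[OF y] by simp
    have "0 \<le> ip x x + 2 * (- ip x y / ip y y) * ip x y + (- ip x y / ip y y)\<^sup>2 * ip y y"
      by (rule pos)
    also have "\<dots> = ip x x - (ip x y)\<^sup>2 / ip y y"
      using p by (simp add: field_simps power2_eq_square)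
    finally show ?thesis using p by (simp add: field_simps)
  qed
  also have "\<dots> = (N x * N y)\<^sup>2" using x y by (simp add: power_mult_distrib N_sq)
  finally have "\<bar>ip x y\<bar>\<^sup>2 \<le> (N x * N y)\<^sup>2" by simp
  then show ?thesis by (rule power2_le_imp_le) (simp add: x y N_nonneg)
qed

lemma N_scale: "x \<in> X \<Longrightarrow> N (a *\<^sub>R x) = \<bar>a\<bar> * N x"
proof -
  assume x: "x \<in> X"
  have "ip (a *\<^sub>R x) (a *\<^sub>R x) = a\<^sup>2 * ip x x"
    using x by (simp add: ip_scale ip_scale_right mem power2_eq_square)
  then show ?thesis using x by (simp add: N_eq mem real_sqrt_mult)
qed

lemma N_triangle: "x \<in> X \<Longrightarrow> y \<in> X \<Longrightarrow> N (x + y) \<le> N x + N y"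
proof -
  assume x: "x \<in> X" and y: "y \<in> X"
  have "(N (x + y))\<^sup>2 = ip x x + 2 * ip x y + ip y y"
    using x y ip_sym[of y x] by (simp add: N_sq mem ip_add ip_add_right)
  also have "\<dots> \<le> ip x x + 2 * (N x * N y) + ip y y"
    using cauchy_schwarz[OF x y] by linarith
  also have "\<dots> = (N x + N y)\<^sup>2"
    using x y by (simp add: power2_sum N_sq)
  finally show ?thesis
    by (rule power2_le_imp_le) (simp add: x y N_nonneg)
qed

lemma N_minus_commute: "x \<in> X \<Longrightarrow> y \<in> X \<Longrightarrow> N (x - y) = N (y - x)"
  using N_scale[of "y - x" "-1"] by (simp add: mem)

lemma N_diff_triangle: "x \<in> X \<Longrightarrow> y \<in> X \<Longrightarrow> z \<in> X \<Longrightarrow> N (x - z) \<le> N (x - y) + N (y - z)"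
  using N_triangle[of "x - y" "y - z"] by (simp add: mem)

lemma N_triangle_diff: "x \<in> X \<Longrightarrow> y \<in> X \<Longrightarrow> N (x - y) \<le> N x + N y"
  using N_diff_triangle[of x 0 y] N_minus_commute[of 0 y] by (simp add: mem)

lemma N_abs_diff_le: "x \<in> X \<Longrightarrow> y \<in> X \<Longrightarrow> \<bar>N x - N y\<bar> \<le> N (x - y)"
  using N_triangle[of "x - y" y] N_triangle[of "y - x" x] N_minus_commute[of x y]
  by (simp add: mem abs_le_iff)

lemma N_cong: "x \<in> X \<Longrightarrow> y \<in> X \<Longrightarrow> N (x - y) = 0 \<Longrightarrow> N x = N y"
  using N_abs_diff_le[of x y] by simp

lemma ip_cong: "x \<in> X \<Longrightarrow> y \<in> X \<Longrightarrow> z \<in> X \<Longrightarrow> N (x - y) = 0 \<Longrightarrow> ip x z = ip y z"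
  using cauchy_schwarz[of "x - y" z] by (simp add: mem ip_diff)

lemma ip_tendsto:
  assumes s: "\<And>n. s n \<in> X" "x \<in> X" and r: "\<And>n. r n \<in> X" "y \<in> X"
    and sx: "((\<lambda>n. N (s n - x)) \<longlongrightarrow> 0) F" and ry: "((\<lambda>n. N (r n - y)) \<longlongrightarrow> 0) F"
  shows "((\<lambda>n. ip (s n) (r n)) \<longlongrightarrow> ip x y) F"
proof -
  have le: "norm (ip (s n) (r n) - ip x y) \<le> N (s n - x) * N (r n - y) + N (s n - x) * N y + N x * N (r n - y)" for n
  proof -
    have "ip (s n) (r n) - ip x y = ip (s n - x) (r n - y) + ip (s n - x) y + ip x (r n - y)"
      using s r by (simp add: ip_diff ip_diff_right mem)
    then show ?thesis
      using cauchy_schwarz[of "s n - x" "r n - y"] cauchy_schwarz[of "s n - x" y] cauchy_schwarz[of x "r n - y"]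
        s r by (simp add: mem abs_le_iff)
  qed
  have "((\<lambda>n. N (s n - x) * N (r n - y) + N (s n - x) * N y + N x * N (r n - y)) \<longlongrightarrow> 0 * 0 + 0 * N y + N x * 0) F"
    by (intro tendsto_intros sx ry)
  then have "((\<lambda>n. ip (s n) (r n) - ip x y) \<longlongrightarrow> 0) F"
    using le by (rule tendsto_zero_le) auto
  then show ?thesis by (simp add: LIM_zero_iff)
qed

lemma N_tendsto:
  assumes s: "\<And>n. s n \<in> X" "x \<in> X" and sx: "((\<lambda>n. N (s n - x)) \<longlongrightarrow> 0) F"
  shows "((\<lambda>n. N (s n)) \<longlongrightarrow> N x) F"
  using tendsto_real_sqrt[OF ip_tendsto[OF s s sx sx]] by (simp add: N_eq s)

subsection \<open>Strong measurability\<close>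

lemma strongly_measurable_mem: "strongly_measurable X N M f \<Longrightarrow> t \<in> space M \<Longrightarrow> f t \<in> X"
  by (simp add: strongly_measurable_def)

lemma strongly_measurableI_lim:
  assumes "\<And>t. t \<in> space M \<Longrightarrow> f t \<in> X" "\<And>n. simple_function M (s n)"
    "\<And>n t. t \<in> space M \<Longrightarrow> s n t \<in> X" "AE t in M. (\<lambda>n. N (s n t - f t)) \<longlonglongrightarrow> 0"
  shows "strongly_measurable X N M f"
  unfolding strongly_measurable_def using assms by blast

lemma strongly_measurableE:
  assumes "strongly_measurable X N M f"
  obtains s where "\<And>n. simple_function M (s n)" "\<And>n t. t \<in> space M \<Longrightarrow> s n t \<in> X"
    "AE t in M. (\<lambda>n. N (s n t - f t)) \<longlonglongrightarrow> 0"
  using assms unfolding strongly_measurable_def by blast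

lemma strongly_measurable_simple:
  assumes "simple_function M f" "\<And>t. t \<in> space M \<Longrightarrow> f t \<in> X"
  shows "strongly_measurable X N M f"
  using assms by (intro strongly_measurableI_lim[where s="\<lambda>_. f"]) (auto simp: N_zero)

lemma strongly_measurable_const: "x \<in> X \<Longrightarrow> strongly_measurable X N M (\<lambda>_. x)"
  by (rule strongly_measurable_simple) auto

lemma strongly_measurable_lin:
  assumes f: "strongly_measurable X N M f" and g: "strongly_measurable X N M g"
  shows "strongly_measurable X N M (\<lambda>t. a *\<^sub>R f t + b *\<^sub>R g t)"
proof -
  obtain s where s: "\<And>n. simple_function M (s n)" "\<And>n t. t \<in> space M \<Longrightarrow> s n t \<in> X"
    "AE t in M. (\<lambda>n. N (s n t - f t)) \<longlonglongrightarrow> 0" by (rule strongly_measurableE[OF f]) (rule that)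
  obtain r where r: "\<And>n. simple_function M (r n)" "\<And>n t. t \<in> space M \<Longrightarrow> r n t \<in> X"
    "AE t in M. (\<lambda>n. N (r n t - g t)) \<longlonglongrightarrow> 0" by (rule strongly_measurableE[OF g]) (rule that)
  note m = strongly_measurable_mem[OF f] strongly_measurable_mem[OF g] s(2) r(2)
  show ?thesis
  proof (rule strongly_measurableI_lim[where s="\<lambda>n t. a *\<^sub>R s n t + b *\<^sub>R r n t"])
    show "simple_function M (\<lambda>t. a *\<^sub>R s n t + b *\<^sub>R r n t)" for n
      by (rule simple_function_compose2[OF s(1) r(1)])
    show "AE t in M. (\<lambda>n. N (a *\<^sub>R s n t + b *\<^sub>R r n t - (a *\<^sub>R f t + b *\<^sub>R g t))) \<longlonglongrightarrow> 0"
      using s(3) r(3) AE_space[of M]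
    proof eventually_elim
      case (elim t)
      have le: "norm (N (a *\<^sub>R s n t + b *\<^sub>R r n t - (a *\<^sub>R f t + b *\<^sub>R g t)))
          \<le> \<bar>a\<bar> * N (s n t - f t) + \<bar>b\<bar> * N (r n t - g t)" for n
      proof -
        have "a *\<^sub>R s n t + b *\<^sub>R r n t - (a *\<^sub>R f t + b *\<^sub>R g t)
            = a *\<^sub>R (s n t - f t) + b *\<^sub>R (r n t - g t)" by (simp add: algebra_simps)
        then show ?thesis
          using N_triangle[of "a *\<^sub>R (s n t - f t)" "b *\<^sub>R (r n t - g t)"]
          by (simp add: m elim mem N_scale N_nonneg)
      qed
      have "(\<lambda>n. \<bar>a\<bar> * N (s n t - f t) + \<bar>b\<bar> * N (r n t - g t)) \<longlonglongrightarrow> \<bar>a\<bar> * 0 + \<bar>b\<bar> * 0"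
        by (intro tendsto_intros elim)
      then show ?case
        using le by (rule tendsto_zero_le) auto
    qed
  qed (auto intro!: mem m)
qed

lemma strongly_measurable_diff:
  "strongly_measurable X N M f \<Longrightarrow> strongly_measurable X N M g \<Longrightarrow> strongly_measurable X N M (\<lambda>t. f t - g t)"
  using strongly_measurable_lin[of M f g 1 "-1"] by simp

lemma borel_measurable_ip:
  assumes f: "strongly_measurable X N M f" and g: "strongly_measurable X N M g"
  shows "(\<lambda>t. ip (f t) (g t)) \<in> borel_measurable (completion M)"
proof -
  obtain s where s: "\<And>n. simple_function M (s n)" "\<And>n t. t \<in> space M \<Longrightarrow> s n t \<in> X"
    "AE t in M. (\<lambda>n. N (s n t - f t)) \<longlonglongrightarrow> 0" by (rule strongly_measurableE[OF f]) (rule that)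
  obtain r where r: "\<And>n. simple_function M (r n)" "\<And>n t. t \<in> space M \<Longrightarrow> r n t \<in> X"
    "AE t in M. (\<lambda>n. N (r n t - g t)) \<longlonglongrightarrow> 0" by (rule strongly_measurableE[OF g]) (rule that)
  show ?thesis
  proof (rule borel_measurable_completion_AE_limit)
    show "(\<lambda>t. ip (s n t) (r n t)) \<in> borel_measurable M" for n
      by (intro borel_measurable_simple_function simple_function_compose2[OF s(1) r(1)])
    show "AE t in M. (\<lambda>n. ip (s n t) (r n t)) \<longlonglongrightarrow> ip (f t) (g t)"
      using s(3) r(3) AE_space[of M]
      by eventually_elim
         (auto intro!: ip_tendsto s r strongly_measurable_mem[OF f] strongly_measurable_mem[OF g])
  qed
qed

lemma borel_measurable_N:
  assumes f: "strongly_measurable X N M f"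
  shows "(\<lambda>t. N (f t)) \<in> borel_measurable (completion M)"
proof -
  have "(\<lambda>t. sqrt (ip (f t) (f t))) \<in> borel_measurable (completion M)"
    using borel_measurable_ip[OF f f] by measurable
  then show ?thesis
    by (rule measurable_cong[THEN iffD1, rotated])
       (simp add: N_eq strongly_measurable_mem[OF f])
qed

text \<open>Truncating the approximants at twice the norm of the limit makes the dominated convergence
  theorem applicable.\<close>

lemma simple_approx:
  assumes f: "strongly_measurable X N M f" and fin: "(\<integral>\<^sup>+t. ennreal (N (f t)) \<partial>M) < \<infinity>"
  obtains s where "\<And>n. simple_function M (s n)" "\<And>n t. t \<in> space M \<Longrightarrow> s n t \<in> X"
    "(\<lambda>n. \<integral>\<^sup>+t. ennreal (N (f t - s n t)) \<partial>M) \<longlonglongrightarrow> 0"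
proof -
  let ?M = "completion M"
  obtain s where s: "\<And>n. simple_function M (s n)" "\<And>n t. t \<in> space M \<Longrightarrow> s n t \<in> X"
    "AE t in M. (\<lambda>n. N (s n t - f t)) \<longlonglongrightarrow> 0" by (rule strongly_measurableE[OF f]) (rule that)
  obtain g where g: "g \<in> borel_measurable M" "AE t in M. N (f t) = g t"
    using completion_ex_borel_measurable_real[OF borel_measurable_N[OF f]] by blast
  define r where "r n t = (if N (s n t) \<le> 2 * g t then s n t else 0)" for n t
  have rm: "r n t \<in> X" if "t \<in> space M" for n t using s(2) that by (auto simp: r_def mem)
  have fm: "f t \<in> X" if "t \<in> space M" for t using strongly_measurable_mem[OF f] that .
  have rs: "simple_function M (r n)" for n
  proof -
    have Ns: "(\<lambda>t. N (s n t)) \<in> borel_measurable M"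
      by (intro borel_measurable_simple_function simple_function_compose1[OF s(1)])
    have "{t \<in> space M. N (s n t) \<le> 2 * g t} \<in> sets M"
      using Ns g(1) by measurable
    then show ?thesis unfolding r_def by (intro simple_function_If s) auto
  qed
  have mono: "AE t in M. N (f t - r n t) \<le> 3 * N (f t)" for n
    using g(2) AE_space[of M]
  proof eventually_elim
    case (elim t)
    have "N (r n t) \<le> 2 * N (f t)"
      using elim N_nonneg[OF fm[OF elim(2)]] by (auto simp: r_def N_zero)
    then show ?case using N_triangle_diff[OF fm rm, of t t n] elim by simp
  qed
  have lim: "AE t in M. (\<lambda>n. N (f t - r n t)) \<longlonglongrightarrow> 0"
    using g(2) s(3) AE_space[of M]
  proof eventually_elim
    case (elim t)
    note sm = s(2)[OF elim(3)] and f' = fm[OF elim(3)] and r' = rm[OF elim(3)]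
    show ?case
    proof (cases "N (f t) = 0")
      case True
      have "N (f t - r n t) = 0" for n
      proof -
        have "N (r n t) \<le> 0" using elim True by (auto simp: r_def N_zero)
        then show ?thesis using N_triangle_diff[OF f' r', of n] N_nonneg[OF diff_mem[OF f' r'], of n] True by simp
      qed
      then show ?thesis by simp
    next
      case False
      then have pos: "N (f t) > 0" using N_nonneg[OF f'] by simp
      have "(\<lambda>n. N (s n t)) \<longlonglongrightarrow> N (f t)" using N_tendsto[OF sm f' elim(2)] .
      then have "eventually (\<lambda>n. N (s n t) < 2 * N (f t)) sequentially"
        using pos by (intro order_tendstoD) auto
      then have "eventually (\<lambda>n. N (s n t - f t) = N (f t - r n t)) sequentially"
        by eventually_elim (use elim in \<open>auto simp: r_def N_minus_commute[OF f' sm]\<close>)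
      then show ?thesis using elim(2) by (rule Lim_transform_eventually[rotated])
    qed
  qed
  have "(\<lambda>n. \<integral>\<^sup>+t. ennreal (N (f t - r n t)) \<partial>?M) \<longlonglongrightarrow> (\<integral>\<^sup>+t. 0 \<partial>?M)"
  proof (rule nn_integral_dominated_convergence[where w="\<lambda>t. ennreal (3 * N (f t))"])
    show "(\<lambda>t. ennreal (N (f t - r n t))) \<in> borel_measurable ?M" for n
      using borel_measurable_N[OF strongly_measurable_diff[OF f strongly_measurable_simple[OF rs rm]]]
      by measurable
    show "(\<lambda>t. ennreal (3 * N (f t))) \<in> borel_measurable ?M"
      using borel_measurable_N[OF f] by measurable
    have "(\<integral>\<^sup>+t. ennreal (3 * N (f t)) \<partial>?M) = 3 * (\<integral>\<^sup>+t. ennreal (N (f t)) \<partial>?M)"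
    proof (subst nn_integral_cmult[symmetric])
      show "(\<lambda>t. ennreal (N (f t))) \<in> borel_measurable ?M" using borel_measurable_N[OF f] by measurable
      show "(\<integral>\<^sup>+t. ennreal (3 * N (f t)) \<partial>?M) = (\<integral>\<^sup>+t. 3 * ennreal (N (f t)) \<partial>?M)"
        by (rule nn_integral_cong) (simp add: ennreal_mult fm N_nonneg)
    qed
    also have "\<dots> < \<infinity>" using fin by (simp add: nn_integral_completion ennreal_mult_less_top)
    finally show "(\<integral>\<^sup>+t. ennreal (3 * N (f t)) \<partial>?M) < \<infinity>" .
    show "AE t in ?M. ennreal (N (f t - r n t)) \<le> ennreal (3 * N (f t))" for n
      unfolding AE_completion_iff using mono[of n] by eventually_elim (rule ennreal_leI)
    show "AE t in ?M. (\<lambda>n. ennreal (N (f t - r n t))) \<longlonglongrightarrow> 0"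
      unfolding AE_completion_iff using lim by eventually_elim (use tendsto_ennrealI in force)
  qed auto
  then show thesis using that[OF rs rm] by (simp add: nn_integral_completion)
qed

end

context semi_inner_space
begin

subsection \<open>The integral tested against bounded functionals\<close>

definition bounded_functional :: "('x \<Rightarrow> real) \<Rightarrow> bool" where
  "bounded_functional l \<longleftrightarrow>
     (\<forall>x\<in>X. \<forall>y\<in>X. \<forall>a b. l (a *\<^sub>R x + b *\<^sub>R y) = a * l x + b * l y) \<and>
     (\<exists>C\<ge>0. \<forall>x\<in>X. \<bar>l x\<bar> \<le> C * N x)"

lemma bounded_functional_ip: "w \<in> X \<Longrightarrow> bounded_functional (\<lambda>x. ip x w)"
  unfolding bounded_functional_def
  using cauchy_schwarz N_nonneg by (auto simp: ip_lin mult.commute intro!: exI[of _ "N w"])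

lemma functional_diff: "bounded_functional l \<Longrightarrow> x \<in> X \<Longrightarrow> y \<in> X \<Longrightarrow> l (x - y) = l x - l y"
  unfolding bounded_functional_def
  by (metis diff_conv_add_uminus mult_1 mult_minus1 scaleR_minus1_left scaleR_one)

lemma functional_add: "bounded_functional l \<Longrightarrow> x \<in> X \<Longrightarrow> y \<in> X \<Longrightarrow> l (x + y) = l x + l y"
  unfolding bounded_functional_def by (metis mult_1 scaleR_one)

lemma functional_scale: "bounded_functional l \<Longrightarrow> x \<in> X \<Longrightarrow> l (a *\<^sub>R x) = a * l x"
  unfolding bounded_functional_def by (metis add.right_neutral mult_zero_left scale_zero_left)

lemma functional_sum:
  assumes l: "bounded_functional l"
  shows "(\<And>i. i \<in> I \<Longrightarrow> f i \<in> X) \<Longrightarrow> l (\<Sum>i\<in>I. f i) = (\<Sum>i\<in>I. l (f i))"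
proof (induction I rule: infinite_finite_induct)
  case (insert i I)
  then show ?case by (simp add: functional_add[OF l] sum_mem)
qed (use functional_scale[OF l zero_mem, of 0] in auto)

lemma functional_bound:
  assumes "bounded_functional l"
  obtains C where "C \<ge> 0" "\<And>x. x \<in> X \<Longrightarrow> \<bar>l x\<bar> \<le> C * N x"
  using assms unfolding bounded_functional_def by blast

lemma functional_tendsto:
  assumes l: "bounded_functional l" and s: "\<And>n. s n \<in> X" "x \<in> X"
    and sx: "((\<lambda>n. N (s n - x)) \<longlongrightarrow> 0) F"
  shows "((\<lambda>n. l (s n)) \<longlongrightarrow> l x) F"
proof -
  obtain C where C: "\<And>x. x \<in> X \<Longrightarrow> \<bar>l x\<bar> \<le> C * N x" by (rule functional_bound[OF l]) (rule that)
  have le: "norm (l (s n) - l x) \<le> C * N (s n - x)" for n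
    using C[of "s n - x"] by (simp add: functional_diff[OF l] s mem)
  have "((\<lambda>n. C * N (s n - x)) \<longlongrightarrow> C * 0) F" by (intro tendsto_intros sx)
  then have "((\<lambda>n. l (s n) - l x) \<longlongrightarrow> 0) F"
    using le by (rule tendsto_zero_le) simp
  then show ?thesis by (simp add: LIM_zero_iff)
qed

lemma borel_measurable_functional:
  assumes l: "bounded_functional l" and f: "strongly_measurable X N M f"
  shows "(\<lambda>t. l (f t)) \<in> borel_measurable (completion M)"
proof -
  obtain s where s: "\<And>n. simple_function M (s n)" "\<And>n t. t \<in> space M \<Longrightarrow> s n t \<in> X"
    "AE t in M. (\<lambda>n. N (s n t - f t)) \<longlonglongrightarrow> 0" by (rule strongly_measurableE[OF f]) (rule that)
  show ?thesis
  proof (rule borel_measurable_completion_AE_limit)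
    show "(\<lambda>t. l (s n t)) \<in> borel_measurable M" for n
      by (intro borel_measurable_simple_function simple_function_compose1[OF s(1)])
    show "AE t in M. (\<lambda>n. l (s n t)) \<longlonglongrightarrow> l (f t)"
      using s(3) AE_space[of M]
      by eventually_elim (auto intro!: functional_tendsto l s strongly_measurable_mem[OF f])
  qed
qed

text \<open>The value of a Bochner integral is characterised by the real integrals of all bounded functionals of the
  integrand. In this form it combines well with limits, with translations and with changes of the domain of
  integration.\<close>

definition weak_int :: "'a measure \<Rightarrow> ('a \<Rightarrow> 'x) \<Rightarrow> 'x \<Rightarrow> bool" where
  "weak_int M g y \<longleftrightarrow> y \<in> X \<and> strongly_measurable X N M g \<and>
     (\<forall>l. bounded_functional l \<longrightarrow> has_bochner_integral (completion M) (\<lambda>t. l (g t)) (l y))"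

lemma weak_intD:
  assumes "weak_int M g y"
  shows "y \<in> X" "\<And>t. t \<in> space M \<Longrightarrow> g t \<in> X"
    "\<And>l. bounded_functional l \<Longrightarrow> has_bochner_integral (completion M) (\<lambda>t. l (g t)) (l y)"
    "strongly_measurable X N M g"
  using assms strongly_measurable_mem by (auto simp: weak_int_def)

lemma weak_int_diff:
  assumes g: "weak_int M g y" and h: "weak_int M h z"
  shows "weak_int M (\<lambda>t. g t - h t) (y - z)"
  unfolding weak_int_def
proof (intro conjI allI impI)
  fix l assume l: "bounded_functional l"
  have "has_bochner_integral (completion M) (\<lambda>t. l (g t) - l (h t)) (l y - l z)"
    by (intro has_bochner_integral_diff weak_intD(3)[OF g l] weak_intD(3)[OF h l])
  also have "l y - l z = l (y - z)"
    using weak_intD(1)[OF g] weak_intD(1)[OF h] by (simp add: functional_diff[OF l])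
  finally show "has_bochner_integral (completion M) (\<lambda>t. l (g t - h t)) (l (y - z))"
    by (subst has_bochner_integral_cong[OF refl _ refl])
       (auto simp: functional_diff[OF l] weak_intD(2)[OF g] weak_intD(2)[OF h])
qed (auto intro!: mem weak_intD(1)[OF g] weak_intD(1)[OF h]
       strongly_measurable_diff weak_intD(4)[OF g] weak_intD(4)[OF h])

text \<open>Testing with \<open>y\<close> itself and using the Cauchy--Schwarz inequality under the integral.\<close>

lemma weak_int_norm_le:
  assumes g: "weak_int M g y"
  shows "ennreal (N y) \<le> (\<integral>\<^sup>+t. ennreal (N (g t)) \<partial>M)"
proof (cases "N y = 0")
  case False
  have y: "y \<in> X" by (rule weak_intD[OF g])
  then have pos: "0 < N y" using False N_nonneg[OF y] by simp
  have int: "has_bochner_integral (completion M) (\<lambda>t. ip (g t) y) (ip y y)"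
    by (rule weak_intD(3)[OF g bounded_functional_ip[OF y]])
  have "ennreal (N y) * ennreal (N y) = ennreal (norm (ip y y))"
    using y pos by (simp flip: ennreal_mult add: N_sq[symmetric] power2_eq_square)
  also have "\<dots> = ennreal (norm (integral\<^sup>L (completion M) (\<lambda>t. ip (g t) y)))"
    using int by (simp add: has_bochner_integral_integral_eq)
  also have "\<dots> \<le> (\<integral>\<^sup>+t. ennreal (norm (ip (g t) y)) \<partial>completion M)"
    using int by (intro integral_norm_bound_ennreal) (auto simp: has_bochner_integral_iff)
  also have "\<dots> = (\<integral>\<^sup>+t. ennreal (norm (ip (g t) y)) \<partial>M)"
    by (rule nn_integral_completion)
  also have "\<dots> \<le> (\<integral>\<^sup>+t. ennreal (N y) * ennreal (N (g t)) \<partial>M)"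
    using cauchy_schwarz[OF weak_intD(2)[OF g] y] pos
    by (intro nn_integral_mono) (auto simp: mult.commute weak_intD(2)[OF g] N_nonneg simp flip: ennreal_mult intro!: ennreal_leI)
  also have "\<dots> = (\<integral>\<^sup>+t. ennreal (N y) * ennreal (N (g t)) \<partial>completion M)"
    by (simp add: nn_integral_completion)
  also have "\<dots> = ennreal (N y) * (\<integral>\<^sup>+t. ennreal (N (g t)) \<partial>completion M)"
    by (intro nn_integral_cmult measurable_compose[OF _ measurable_ennreal] borel_measurable_N weak_intD(4)[OF g])
  finally have "ennreal (N y) * ennreal (N y) \<le> ennreal (N y) * (\<integral>\<^sup>+t. ennreal (N (g t)) \<partial>M)"
    by (simp add: nn_integral_completion)
  then show ?thesis
    using pos by (subst (asm) ennreal_mult_le_mult_iff) auto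
qed simp

lemma weak_int_simple:
  assumes fin: "finite_measure M"
    and s: "simple_function M s" "\<And>t. t \<in> space M \<Longrightarrow> s t \<in> X"
  shows "weak_int M s (Bochner_Integration.simple_bochner_integral M s)"
proof -
  interpret finite_measure M by fact
  have sX: "y \<in> s ` space M \<Longrightarrow> y \<in> X" for y using s(2) by auto
  show ?thesis
    unfolding weak_int_def
  proof (intro conjI allI impI)
    show "Bochner_Integration.simple_bochner_integral M s \<in> X"
      unfolding simple_bochner_integral_def by (intro sum_mem scale_mem) (rule sX)
    show "strongly_measurable X N M s" by (rule strongly_measurable_simple[OF s])
    fix l assume l: "bounded_functional l"
    have si: "Bochner_Integration.simple_bochner_integrable M (\<lambda>t. l (s t))"
      by (rule simple_bochner_integrable.intros[OF simple_function_compose1[OF s(1)]]) simp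
    have "Bochner_Integration.simple_bochner_integral M (\<lambda>t. l (s t))
        = (\<Sum>y\<in>s ` space M. measure M {x \<in> space M. s x = y} *\<^sub>R l y)"
      by (rule simple_bochner_integral_partition[OF si s(1)]) auto
    also have "\<dots> = l (Bochner_Integration.simple_bochner_integral M s)"
      unfolding simple_bochner_integral_def
      by (subst functional_sum[OF l]) (auto intro!: scale_mem s(2) sum.cong simp: functional_scale[OF l] s(2))
    finally have "has_bochner_integral M (\<lambda>t. l (s t)) (l (Bochner_Integration.simple_bochner_integral M s))"
      using has_bochner_integral_simple_bochner_integrable[OF si] by simp
    then show "has_bochner_integral (completion M) (\<lambda>t. l (s t)) (l (Bochner_Integration.simple_bochner_integral M s))"
      by (auto simp: has_bochner_integral_iff integrable_completion integral_completion)
  qed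
qed

lemma simple_bochner_integrableD: "Bochner_Integration.simple_bochner_integrable M s \<Longrightarrow> simple_function M s"
  by (auto elim: simple_bochner_integrable.cases)

text \<open>The defining simple functions converge in \<open>L\<^sup>1\<close>, hence so do their images under a bounded functional.\<close>

lemma weak_int_has_bochner_int:
  assumes fin: "finite_measure M" and g: "has_bochner_int X N M g y"
  shows "weak_int M g y"
proof -
  obtain s where s: "\<And>n. Bochner_Integration.simple_bochner_integrable M (s n)" "\<And>n. s n ` space M \<subseteq> X"
    "(\<lambda>n. \<integral>\<^sup>+t. ennreal (N (g t - s n t)) \<partial>M) \<longlonglongrightarrow> 0"
    "(\<lambda>n. N (Bochner_Integration.simple_bochner_integral M (s n) - y)) \<longlonglongrightarrow> 0"
    using g unfolding has_bochner_int_def by (elim conjE exE) (rule that, auto)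
  have gm: "strongly_measurable X N M g" and y: "y \<in> X"
    using g by (auto simp: has_bochner_int_def)
  have sX: "t \<in> space M \<Longrightarrow> s n t \<in> X" for n t using s(2)[of n] by auto
  note gX = strongly_measurable_mem[OF gm]
  have ws: "weak_int M (s n) (Bochner_Integration.simple_bochner_integral M (s n))" for n
    by (intro weak_int_simple[OF fin] simple_bochner_integrableD s(1) sX)
  show ?thesis
    unfolding weak_int_def
  proof (intro conjI allI impI)
    fix l assume l: "bounded_functional l"
    let ?M = "completion M"
    obtain C where C: "C \<ge> 0" "\<And>x. x \<in> X \<Longrightarrow> \<bar>l x\<bar> \<le> C * N x" by (rule functional_bound[OF l]) (rule that)
    have gw: "(\<lambda>t. l (g t)) \<in> borel_measurable ?M"
      by (intro borel_measurable_functional gm l)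
    have lim: "(\<lambda>n. \<integral>\<^sup>+t. ennreal (norm (l (g t) - l (s n t))) \<partial>?M) \<longlonglongrightarrow> 0"
    proof (rule tendsto_sandwich[OF _ _ tendsto_const])
      show "eventually (\<lambda>n. (\<integral>\<^sup>+t. ennreal (norm (l (g t) - l (s n t))) \<partial>?M)
          \<le> ennreal C * (\<integral>\<^sup>+t. ennreal (N (g t - s n t)) \<partial>M)) sequentially"
      proof (rule always_eventually, rule allI)
        fix n
        have "(\<integral>\<^sup>+t. ennreal (norm (l (g t) - l (s n t))) \<partial>?M)
            \<le> (\<integral>\<^sup>+t. ennreal C * ennreal (N (g t - s n t)) \<partial>?M)"
        proof (rule nn_integral_mono)
          fix t assume "t \<in> space ?M"
          then have t: "t \<in> space M" by simp
          show "ennreal (norm (l (g t) - l (s n t))) \<le> ennreal C * ennreal (N (g t - s n t))"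
            using C(2)[OF diff_mem[OF gX[OF t] sX[OF t, of n]]] C(1)
            by (simp add: functional_diff[OF l] gX sX t N_nonneg mem flip: ennreal_mult)
        qed
        also have "\<dots> = ennreal C * (\<integral>\<^sup>+t. ennreal (N (g t - s n t)) \<partial>?M)"
          by (intro nn_integral_cmult measurable_compose[OF _ measurable_ennreal] borel_measurable_N
                strongly_measurable_diff gm weak_intD(4)[OF ws])
        finally show "(\<integral>\<^sup>+t. ennreal (norm (l (g t) - l (s n t))) \<partial>?M)
          \<le> ennreal C * (\<integral>\<^sup>+t. ennreal (N (g t - s n t)) \<partial>M)"
          by (simp add: nn_integral_completion)
      qed
      show "(\<lambda>n. ennreal C * (\<integral>\<^sup>+t. ennreal (N (g t - s n t)) \<partial>M)) \<longlonglongrightarrow> 0"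
        using ennreal_tendsto_cmult[OF _ s(3), of "ennreal C"] by simp
    qed auto
    have int: "integrable ?M (\<lambda>t. l (s n t))"
      "integral\<^sup>L ?M (\<lambda>t. l (s n t)) = l (Bochner_Integration.simple_bochner_integral M (s n))" for n
      using weak_intD(3)[OF ws l] by (auto simp: has_bochner_integral_iff)
    have ig: "integrable ?M (\<lambda>t. l (g t))"
    proof -
      have "eventually (\<lambda>n. (\<integral>\<^sup>+t. ennreal (norm (l (g t) - l (s n t))) \<partial>?M) < 1) sequentially"
        using lim by (rule order_tendstoD) simp
      then obtain n where "(\<integral>\<^sup>+t. ennreal (norm (l (g t) - l (s n t))) \<partial>?M) < 1"
        by (auto simp: eventually_sequentially)
      then have "integrable ?M (\<lambda>t. l (g t) - l (s n t))"
        using gw int(1)[of n] by (intro integrableI_bounded) (auto intro: order_less_trans)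
      from Bochner_Integration.integrable_add[OF this int(1)[of n]] show ?thesis by simp
    qed
    have "(\<lambda>n. integral\<^sup>L ?M (\<lambda>t. l (s n t))) \<longlonglongrightarrow> integral\<^sup>L ?M (\<lambda>t. l (g t))"
    proof (rule tendsto_L1_int[OF int(1) ig])
      show "(\<lambda>n. \<integral>\<^sup>+t. ennreal (norm (l (s n t) - l (g t))) \<partial>?M) \<longlonglongrightarrow> 0"
        using lim by (simp add: abs_minus_commute)
    qed
    moreover have "(\<lambda>n. l (Bochner_Integration.simple_bochner_integral M (s n))) \<longlonglongrightarrow> l y"
      by (rule functional_tendsto[OF l weak_intD(1)[OF ws] y s(4)])
    ultimately have "integral\<^sup>L ?M (\<lambda>t. l (g t)) = l y"
      unfolding int(2) by (rule LIMSEQ_unique)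
    with ig show "has_bochner_integral ?M (\<lambda>t. l (g t)) (l y)"
      by (simp add: has_bochner_integral_iff)
  qed (use y gm in auto)
qed

end

section \<open>Complete spaces and existence of the Bochner integral\<close>

text \<open>Every Cauchy sequence has a subsequence with steps of geometric size, so this is completeness in the usual
  sense.\<close>

locale semi_hilbert_space = semi_inner_space +
  assumes complete: "\<And>s. (\<And>n. s n \<in> X) \<Longrightarrow> (\<And>n::nat. N (s (Suc n) - s n) \<le> (1/2)^n) \<Longrightarrow>
                       \<exists>x\<in>X. (\<lambda>n. N (s n - x)) \<longlonglongrightarrow> 0"
begin

text \<open>The integrals of simple functions that approximate the integrand at a geometric rate in \<open>L\<^sup>1\<close> converge at a
  geometric rate themselves.\<close>

theorem bochner_int_exists:
  assumes fin: "finite_measure M"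
    and g: "strongly_measurable X N M g" and bound: "(\<integral>\<^sup>+t. ennreal (N (g t)) \<partial>M) < \<infinity>"
  shows "has_bochner_int X N M g (bochner_int X N M g)"
proof -
  interpret finite_measure M by fact
  obtain s where s: "\<And>n. simple_function M (s n)" "\<And>n t. t \<in> space M \<Longrightarrow> s n t \<in> X"
    "(\<lambda>n. \<integral>\<^sup>+t. ennreal (N (g t - s n t)) \<partial>M) \<longlonglongrightarrow> 0"
    by (rule simple_approx[OF g bound]) (rule that)
  have "\<exists>m. (\<integral>\<^sup>+t. ennreal (N (g t - s m t)) \<partial>M) < ennreal ((1/2)^(n+1))" for n
    using order_tendstoD(2)[OF s(3), of "ennreal ((1/2)^(n+1))"] by (auto simp: eventually_sequentially)
  then obtain m where m: "\<And>n. (\<integral>\<^sup>+t. ennreal (N (g t - s (m n) t)) \<partial>M) < ennreal ((1/2)^(n+1))"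
    by metis
  define r where "r n = s (m n)" for n
  have r: "\<And>n. simple_function M (r n)" "\<And>n t. t \<in> space M \<Longrightarrow> r n t \<in> X"
    "\<And>n. (\<integral>\<^sup>+t. ennreal (N (g t - r n t)) \<partial>M) \<le> ennreal ((1/2)^(n+1))"
    using s m by (auto simp: r_def less_imp_le)
  have wr: "weak_int M (r n) (Bochner_Integration.simple_bochner_integral M (r n))" for n
    by (intro weak_int_simple fin r)
  note gX = strongly_measurable_mem[OF g]
  have "N (Bochner_Integration.simple_bochner_integral M (r (Suc n)) - Bochner_Integration.simple_bochner_integral M (r n)) \<le> (1/2)^n" for n
  proof -
    have "ennreal (N (Bochner_Integration.simple_bochner_integral M (r (Suc n)) - Bochner_Integration.simple_bochner_integral M (r n)))
        \<le> (\<integral>\<^sup>+t. ennreal (N (r (Suc n) t - r n t)) \<partial>M)"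
      by (intro weak_int_norm_le weak_int_diff wr)
    also have "\<dots> \<le> (\<integral>\<^sup>+t. ennreal (N (g t - r (Suc n) t)) + ennreal (N (g t - r n t)) \<partial>M)"
    proof (rule nn_integral_mono)
      fix t assume t: "t \<in> space M"
      have "N (r (Suc n) t - r n t) \<le> N (g t - r (Suc n) t) + N (g t - r n t)"
        using N_diff_triangle[of "r (Suc n) t" "g t" "r n t"] N_minus_commute[of "r (Suc n) t" "g t"]
        by (simp add: gX[OF t] r(2)[OF t])
      then show "ennreal (N (r (Suc n) t - r n t)) \<le> ennreal (N (g t - r (Suc n) t)) + ennreal (N (g t - r n t))"
        by (simp add: N_nonneg mem gX[OF t] r(2)[OF t] flip: ennreal_plus)
    qed
    also have "\<dots> = (\<integral>\<^sup>+t. ennreal (N (g t - r (Suc n) t)) + ennreal (N (g t - r n t)) \<partial>completion M)"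
      by (simp add: nn_integral_completion)
    also have "\<dots> = (\<integral>\<^sup>+t. ennreal (N (g t - r (Suc n) t)) \<partial>completion M)
        + (\<integral>\<^sup>+t. ennreal (N (g t - r n t)) \<partial>completion M)"
      by (intro nn_integral_add measurable_compose[OF _ measurable_ennreal]
            borel_measurable_N strongly_measurable_diff g strongly_measurable_simple r)
    also have "\<dots> \<le> ennreal ((1/2)^(Suc n+1)) + ennreal ((1/2)^(n+1))"
      unfolding nn_integral_completion by (intro add_mono r)
    also have "\<dots> \<le> ennreal ((1/2)^n)"
      by (simp flip: ennreal_plus)
    finally show ?thesis by (simp add: ennreal_le_iff)
  qed
  then obtain y where y: "y \<in> X" "(\<lambda>n. N (Bochner_Integration.simple_bochner_integral M (r n) - y)) \<longlonglongrightarrow> 0"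
    using complete[of "\<lambda>n. Bochner_Integration.simple_bochner_integral M (r n)"] weak_intD(1)[OF wr] by blast
  have lim: "(\<lambda>n. \<integral>\<^sup>+t. ennreal (N (g t - r n t)) \<partial>M) \<longlonglongrightarrow> 0"
  proof (rule tendsto_sandwich[OF _ _ tendsto_const])
    have "(\<lambda>n. (1/2)^(n+1) :: real) \<longlonglongrightarrow> 0"
      by (intro LIMSEQ_ignore_initial_segment LIMSEQ_realpow_zero) auto
    then show "(\<lambda>n. ennreal ((1/2)^(n+1))) \<longlonglongrightarrow> 0"
      using tendsto_ennrealI[of "\<lambda>n. (1/2)^(n+1)" 0] by simp
  qed (use r(3) in auto)
  have "has_bochner_int X N M g y"
    unfolding has_bochner_int_def
  proof (intro conjI exI[of _ r] allI)
    show "Bochner_Integration.simple_bochner_integrable M (r n)" for n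
      by (rule simple_bochner_integrable.intros[OF r(1)]) simp
  qed (use g y lim r(2) in auto)
  then show ?thesis unfolding bochner_int_def by (rule someI)
qed

end

section \<open>Integrals over Lebesgue measurable sets\<close>

lemma complete_measure_lebesgue_on: "A \<in> sets lebesgue \<Longrightarrow> complete_measure (lebesgue_on A)"
proof
  fix B C assume A: "A \<in> sets lebesgue" and BC: "B \<subseteq> C" "C \<in> null_sets (lebesgue_on A)"
  then have C: "C \<subseteq> A" "C \<in> null_sets lebesgue" by (auto simp: null_sets_restrict_space)
  then have "B \<in> sets lebesgue" using BC(1) by (blast intro: completion.complete)
  then show "B \<in> sets (lebesgue_on A)"
    using A BC(1) C(1) by (subst sets_restrict_space_iff) auto
qed

lemma (in complete_measure) completion_eq: "completion M = M"
proof (rule measure_eqI)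
  show sets: "sets (completion M) = sets M"
    by (auto simp: sets_completion intro: complete)
  show "emeasure (completion M) A = emeasure M A" if "A \<in> sets (completion M)" for A
    using that by (simp add: sets)
qed

lemma completion_lebesgue_on: "A \<in> sets lebesgue \<Longrightarrow> completion (lebesgue_on A) = lebesgue_on A"
  by (rule complete_measure.completion_eq[OF complete_measure_lebesgue_on])

lemma finite_measure_lebesgue_on: "bounded A \<Longrightarrow> A \<in> sets lebesgue \<Longrightarrow> finite_measure (lebesgue_on A)"
  using fmeasurableD2[OF bounded_set_imp_lmeasurable[of A]]
  by (intro finite_measureI) (simp add: emeasure_restrict_space del: emeasure_completion)

lemma finite_measure_Ioo [simp]: "finite_measure (lebesgue_on {a<..<b::real})"
  by (intro finite_measure_lebesgue_on) auto

lemma nn_integral_Ioo_const: "a \<le> b \<Longrightarrow> 0 \<le> c \<Longrightarrow> (\<integral>\<^sup>+s. ennreal c \<partial>lebesgue_on {a<..<b::real}) = ennreal (c * (b - a))"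
  by (simp add: emeasure_restrict_space ennreal_mult)

lemma nn_integral_lebesgue_on_mono:
  fixes f :: "'a::euclidean_space \<Rightarrow> ennreal"
  assumes "A \<subseteq> B" "A \<in> sets lebesgue" "B \<in> sets lebesgue" "\<And>s. s \<in> A \<Longrightarrow> f s \<le> g s"
  shows "(\<integral>\<^sup>+s. f s \<partial>lebesgue_on A) \<le> (\<integral>\<^sup>+s. g s \<partial>lebesgue_on B)"
  using assms by (auto simp: nn_integral_restrict_space intro!: nn_integral_mono split: split_indicator)

lemma simple_function_lebesgue_on_subset:
  assumes "simple_function (lebesgue_on B) f" "A \<subseteq> B" "A \<in> sets lebesgue" "B \<in> sets lebesgue"
  shows "simple_function (lebesgue_on A) f"
  unfolding simple_function_def
proof (intro conjI ballI)
  show "finite (f ` space (lebesgue_on A))"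
    using finite_subset[OF image_mono[OF assms(2)] simple_functionD(1)[OF assms(1), simplified]] by simp
  fix x assume "x \<in> f ` space (lebesgue_on A)"
  have "f -` {x} \<inter> space (lebesgue_on B) \<in> sets (lebesgue_on B)" by (rule simple_functionD(2)[OF assms(1)])
  then have "f -` {x} \<inter> B \<in> sets lebesgue" using assms(4) by (simp add: sets_restrict_space_iff)
  then have "(f -` {x} \<inter> B) \<inter> A \<in> sets lebesgue" using assms(3) by blast
  also have "(f -` {x} \<inter> B) \<inter> A = f -` {x} \<inter> A" using assms(2) by auto
  finally show "f -` {x} \<inter> space (lebesgue_on A) \<in> sets (lebesgue_on A)"
    using assms(3) by (simp add: sets_restrict_space_iff)
qed

context semi_inner_space
begin

lemma minus_mem: "x \<in> X \<Longrightarrow> - x \<in> X"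
  using scale_mem[of x "-1"] by simp

lemma strongly_measurable_lebesgue_on_subset:
  assumes f: "strongly_measurable X N (lebesgue_on B) f" and AB: "A \<subseteq> B" "A \<in> sets lebesgue" "B \<in> sets lebesgue"
  shows "strongly_measurable X N (lebesgue_on A) f"
proof -
  obtain s where s: "\<And>n. simple_function (lebesgue_on B) (s n)" "\<And>n t. t \<in> space (lebesgue_on B) \<Longrightarrow> s n t \<in> X"
    "AE t in lebesgue_on B. (\<lambda>n. N (s n t - f t)) \<longlonglongrightarrow> 0" by (rule strongly_measurableE[OF f]) (rule that)
  show ?thesis
  proof (rule strongly_measurableI_lim[where s=s])
    show "AE t in lebesgue_on A. (\<lambda>n. N (s n t - f t)) \<longlonglongrightarrow> 0"
      using s(3) AB by (auto simp: AE_restrict_space_iff elim: AE_mp)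
    show "simple_function (lebesgue_on A) (s n)" for n
      by (rule simple_function_lebesgue_on_subset[OF s(1) AB])
  qed (use AB s(2) strongly_measurable_mem[OF f] in auto)
qed

lemma weak_int_lebesgue:
  assumes g: "weak_int (lebesgue_on A) g y" and A: "A \<in> sets lebesgue" and l: "bounded_functional l"
  shows "has_bochner_integral lebesgue (\<lambda>s. indicator A s *\<^sub>R l (g s)) (l y)"
  using weak_intD(3)[OF g l] A
  by (simp add: completion_lebesgue_on has_bochner_integral_restrict_space)

text \<open>The two integrals may extend over different sets; this is what makes mild solutions at different times
  comparable.\<close>

lemma weak_int_lebesgue_diff_le:
  assumes g: "weak_int (lebesgue_on A) g y" and h: "weak_int (lebesgue_on B) h z"
    and AB: "A \<in> sets lebesgue" "B \<in> sets lebesgue"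
    and b: "b \<in> borel_measurable lebesgue"
    and le: "\<And>s. N ((indicator A s :: real) *\<^sub>R g s - (indicator B s :: real) *\<^sub>R h s) \<le> b s"
  shows "ennreal (N (y - z)) \<le> (\<integral>\<^sup>+s. ennreal (b s) \<partial>lebesgue)"
proof (cases "N (y - z) = 0")
  case False
  define w where "w = y - z"
  have y: "y \<in> X" and z: "z \<in> X" using weak_intD(1)[OF g] weak_intD(1)[OF h] by auto
  have w: "w \<in> X" using y z by (simp add: w_def mem)
  have pos: "0 < N w" using False N_nonneg[OF w] by (simp add: w_def)
  let ?f = "\<lambda>s. indicator A s *\<^sub>R ip (g s) w - indicator B s *\<^sub>R ip (h s) w"
  have gX: "g s \<in> X" if "s \<in> A" for s using weak_intD(2)[OF g] that by simp
  have hX: "h s \<in> X" if "s \<in> B" for s using weak_intD(2)[OF h] that by simp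
  have int: "has_bochner_integral lebesgue ?f (ip y w - ip z w)"
    by (intro has_bochner_integral_diff weak_int_lebesgue[OF g AB(1) bounded_functional_ip[OF w]]
        weak_int_lebesgue[OF h AB(2) bounded_functional_ip[OF w]])
  have "ip y w - ip z w = ip w w" using y z w by (simp add: w_def ip_diff)
  then have "ennreal (N w) * ennreal (N w) = ennreal (norm (ip y w - ip z w))"
    using w pos by (simp flip: ennreal_mult add: N_sq[symmetric] power2_eq_square)
  also have "\<dots> = ennreal (norm (integral\<^sup>L lebesgue ?f))"
    using int by (simp add: has_bochner_integral_integral_eq)
  also have "\<dots> \<le> (\<integral>\<^sup>+s. ennreal (norm (?f s)) \<partial>lebesgue)"
    using int by (intro integral_norm_bound_ennreal) (auto simp: has_bochner_integral_iff)
  also have "\<dots> \<le> (\<integral>\<^sup>+s. ennreal (N w) * ennreal (b s) \<partial>lebesgue)"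
  proof (rule nn_integral_mono)
    fix s
    let ?d = "(indicator A s :: real) *\<^sub>R g s - (indicator B s :: real) *\<^sub>R h s"
    have d: "?d \<in> X" using gX hX by (auto split: split_indicator intro!: mem minus_mem)
    have "?f s = ip ?d w"
      using gX hX w ip_diff[of 0] by (auto split: split_indicator simp: ip_diff mem ip_zero)
    then have "norm (?f s) \<le> N ?d * N w" using cauchy_schwarz[OF d w] by simp
    also have "\<dots> \<le> b s * N w" using le[of s] pos by (intro mult_right_mono) auto
    finally show "ennreal (norm (?f s)) \<le> ennreal (N w) * ennreal (b s)"
      using pos order_trans[OF N_nonneg[OF d] le] by (simp add: mult.commute flip: ennreal_mult)
  qed
  also have "\<dots> = ennreal (N w) * (\<integral>\<^sup>+s. ennreal (b s) \<partial>lebesgue)"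
    using b by (intro nn_integral_cmult) auto
  finally show ?thesis
    using pos by (subst (asm) ennreal_mult_le_mult_iff) (auto simp: w_def)
qed simp

end

section \<open>Contraction semigroups\<close>

locale contraction_semigroup = semi_hilbert_space +
  fixes S :: "real \<Rightarrow> 'a \<Rightarrow> 'a" and D :: "'a set" and A :: "'a \<Rightarrow> 'a"
  assumes semigroup: "c0_contraction_semigroup X N S"
    and generator: "has_generator X N S D A"
    and D_sub: "D \<subseteq> X" and A_mem: "\<And>x. x \<in> D \<Longrightarrow> A x \<in> X"
begin

lemma S_mem: "0 \<le> t \<Longrightarrow> x \<in> X \<Longrightarrow> S t x \<in> X"
  and S_contr: "0 \<le> t \<Longrightarrow> x \<in> X \<Longrightarrow> N (S t x) \<le> N x"
  and S_lin: "0 \<le> t \<Longrightarrow> x \<in> X \<Longrightarrow> y \<in> X \<Longrightarrow> N (S t (a *\<^sub>R x + b *\<^sub>R y) - (a *\<^sub>R S t x + b *\<^sub>R S t y)) = 0"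
  and S_0: "x \<in> X \<Longrightarrow> N (S 0 x - x) = 0"
  and S_add: "0 \<le> s \<Longrightarrow> 0 \<le> t \<Longrightarrow> x \<in> X \<Longrightarrow> N (S (s + t) x - S s (S t x)) = 0"
  and S_cont0: "x \<in> X \<Longrightarrow> ((\<lambda>t. N (S t x - x)) \<longlongrightarrow> 0) (at_right 0)"
  using semigroup unfolding c0_contraction_semigroup_def by blast+

lemma D_mem: "x \<in> D \<Longrightarrow> x \<in> X" using D_sub by auto

lemma S_diff: "0 \<le> t \<Longrightarrow> x \<in> X \<Longrightarrow> y \<in> X \<Longrightarrow> N (S t (x - y) - (S t x - S t y)) = 0"
  using S_lin[of t x y 1 "-1"] by simp

lemma S_scale: "0 \<le> t \<Longrightarrow> x \<in> X \<Longrightarrow> N (S t (a *\<^sub>R x) - a *\<^sub>R S t x) = 0"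
  using S_lin[of t x x a 0] by simp

lemma S_diff_le: "0 \<le> t \<Longrightarrow> x \<in> X \<Longrightarrow> y \<in> X \<Longrightarrow> N (S t x - S t y) \<le> N (x - y)"
  using N_cong[OF _ _ S_diff[of t x y]] S_contr[of t "x - y"] by (simp add: S_mem mem)

text \<open>By contractivity the modulus of continuity of an orbit is largest at time zero.\<close>

lemma S_shift_le:
  assumes t: "0 \<le> t" and h: "0 \<le> h" and x: "x \<in> X"
  shows "N (S (t + h) x - S t x) \<le> N (S h x - x)"
  using N_diff_triangle[of "S (t + h) x" "S t (S h x)" "S t x"] S_add[OF t h x] S_diff_le[of t "S h x" x]
    assms by (simp add: S_mem)

lemma S_modulus: "0 \<le> s \<Longrightarrow> 0 \<le> t \<Longrightarrow> x \<in> X \<Longrightarrow> N (S s x - S t x) \<le> N (S \<bar>s - t\<bar> x - x)"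
  using S_shift_le[of t "s - t" x] S_shift_le[of s "t - s" x] N_minus_commute[of "S s x" "S t x"]
  by (cases "t \<le> s") (auto simp: S_mem abs_if)

lemma S_small_time:
  assumes x: "x \<in> X" and e: "0 < e"
  obtains d where "0 < d" "\<And>h. 0 \<le> h \<Longrightarrow> h < d \<Longrightarrow> N (S h x - x) < e"
proof -
  have "eventually (\<lambda>t. N (S t x - x) < e) (at_right 0)"
    using S_cont0[OF x] e by (rule order_tendstoD)
  then obtain d where d: "0 < d" "\<And>t. 0 < t \<Longrightarrow> t < d \<Longrightarrow> N (S t x - x) < e"
    by (auto simp: eventually_at_right_field)
  show thesis
  proof (rule that[OF d(1)])
    fix h :: real assume "0 \<le> h" "h < d"
    then show "N (S h x - x) < e" using d(2)[of h] S_0[OF x] e by (cases "h = 0") auto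
  qed
qed

lemma S_tendsto:
  assumes x: "x \<in> X" and t: "0 \<le> t" and s: "\<And>i. 0 \<le> s i" and lim: "(s \<longlongrightarrow> t) F"
  shows "((\<lambda>i. N (S (s i) x - S t x)) \<longlongrightarrow> 0) F"
proof (rule tendstoI)
  fix e :: real assume "0 < e"
  then obtain d where d: "0 < d" "\<And>h. 0 \<le> h \<Longrightarrow> h < d \<Longrightarrow> N (S h x - x) < e"
    by (rule S_small_time[OF x]) (rule that)
  have "eventually (\<lambda>i. dist (s i) t < d) F" using lim d(1) by (rule tendstoD)
  then show "eventually (\<lambda>i. dist (N (S (s i) x - S t x)) 0 < e) F"
  proof eventually_elim
    case (elim i)
    then have "N (S \<bar>s i - t\<bar> x - x) < e" by (intro d(2)) (auto simp: dist_real_def)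
    then show ?case
      using S_modulus[OF s[of i] t x] N_nonneg[of "S (s i) x - S t x"] by (simp add: S_mem s t x mem)
  qed
qed

lemma generator_limit:
  assumes "x \<in> D"
  shows "((\<lambda>h. N ((1 / h) *\<^sub>R (S h x - x) - A x)) \<longlongrightarrow> 0) (at_right 0)"
  using generator A_mem[OF assms] D_mem[OF assms] assms unfolding has_generator_def by (simp add: N_zero)

text \<open>\<open>S t\<close> commutes with difference quotients up to vectors of seminorm zero, and it is contractive.\<close>

lemma S_diff_quotient:
  assumes t: "0 \<le> t" and h: "0 < h" and x: "x \<in> X" and y: "y \<in> X"
  shows "N ((1 / h) *\<^sub>R (S h (S t x) - S t x) - S t y) \<le> N ((1 / h) *\<^sub>R (S h x - x) - y)"
    (is "N ?L \<le> N ?R")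
proof -
  have m: "S h x \<in> X" "S t x \<in> X" "S h (S t x) \<in> X" "S t (S h x) \<in> X" "S t y \<in> X" "S (h + t) x \<in> X"
    "(1 / h) *\<^sub>R (S h x - x) \<in> X" "S t ((1 / h) *\<^sub>R (S h x - x)) \<in> X" "S t (S h x - x) \<in> X"
    using assms by (auto intro!: S_mem mem)
  have z1: "N (S h (S t x) - S t (S h x)) = 0"
    using N_diff_triangle[of "S h (S t x)" "S (h + t) x" "S t (S h x)"] S_add[of h t x] S_add[of t h x]
      N_minus_commute[of "S (h + t) x" "S h (S t x)"] N_nonneg[of "S h (S t x) - S t (S h x)"] m assms
    by (simp add: add.commute mem)
  have z2: "N ((S h (S t x) - S t x) - S t (S h x - x)) = 0"
  proof -
    have "N ((S h (S t x) - S t x) - S t (S h x - x)) \<le> N ((S h (S t x) - S t x) - (S t (S h x) - S t x))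
        + N ((S t (S h x) - S t x) - S t (S h x - x))"
      by (intro N_diff_triangle mem m)
    also have "\<dots> = 0"
      using z1 S_diff[OF t m(1) x] N_minus_commute[of "S t (S h x - x)" "S t (S h x) - S t x"] m
      by (simp add: mem)
    finally show ?thesis using N_nonneg[of "(S h (S t x) - S t x) - S t (S h x - x)"] m by (simp add: mem)
  qed
  have z3: "N ((1/h) *\<^sub>R (S h (S t x) - S t x) - S t ((1/h) *\<^sub>R (S h x - x))) = 0"
  proof -
    have "N ((1/h) *\<^sub>R (S h (S t x) - S t x) - S t ((1/h) *\<^sub>R (S h x - x)))
       \<le> N ((1/h) *\<^sub>R (S h (S t x) - S t x) - (1/h) *\<^sub>R S t (S h x - x))
        + N ((1/h) *\<^sub>R S t (S h x - x) - S t ((1/h) *\<^sub>R (S h x - x)))"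
      by (intro N_diff_triangle mem m)
    also have "(1/h) *\<^sub>R (S h (S t x) - S t x) - (1/h) *\<^sub>R S t (S h x - x)
        = (1/h) *\<^sub>R ((S h (S t x) - S t x) - S t (S h x - x))" by (simp add: algebra_simps)
    also have "N \<dots> = 0" using z2 m by (simp add: N_scale mem)
    also have "N ((1/h) *\<^sub>R S t (S h x - x) - S t ((1/h) *\<^sub>R (S h x - x))) = 0"
      using S_scale[OF t, of "S h x - x" "1/h"] N_minus_commute[of "(1/h) *\<^sub>R S t (S h x - x)"] m x by (simp add: mem)
    finally show ?thesis
      using N_nonneg[of "(1/h) *\<^sub>R (S h (S t x) - S t x) - S t ((1/h) *\<^sub>R (S h x - x))"] m by (simp add: mem)
  qed
  have "N ?L \<le> N ((1/h) *\<^sub>R (S h (S t x) - S t x) - S t ((1/h) *\<^sub>R (S h x - x)))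
     + N (S t ((1/h) *\<^sub>R (S h x - x)) - S t y)"
    by (intro N_diff_triangle mem m)
  also have "\<dots> \<le> N ?R" using z3 S_diff_le[OF t m(7) y] by simp
  finally show ?thesis .
qed

lemma D_invariant:
  assumes x: "x \<in> D" and t: "0 \<le> t"
  shows "S t x \<in> D" "N (A (S t x) - S t (A x)) = 0"
proof -
  note xX = D_mem[OF x] and Ax = A_mem[OF x]
  have "((\<lambda>h. N ((1 / h) *\<^sub>R (S h (S t x) - S t x) - S t (A x))) \<longlongrightarrow> 0) (at_right 0)"
  proof (rule tendsto_sandwich[OF _ _ tendsto_const generator_limit[OF x]])
    show "eventually (\<lambda>h. N ((1 / h) *\<^sub>R (S h (S t x) - S t x) - S t (A x)) \<le> N ((1 / h) *\<^sub>R (S h x - x) - A x)) (at_right 0)"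
      using eventually_at_right_less[of "0::real"] by eventually_elim (intro S_diff_quotient t xX Ax)
    show "eventually (\<lambda>h. 0 \<le> N ((1 / h) *\<^sub>R (S h (S t x) - S t x) - S t (A x))) (at_right 0)"
      using eventually_at_right_less[of "0::real"]
      by eventually_elim (intro N_nonneg mem S_mem t xX Ax less_imp_le)
  qed
  then show "S t x \<in> D" "N (A (S t x) - S t (A x)) = 0"
    using generator S_mem[OF t xX] S_mem[OF t Ax] unfolding has_generator_def by blast+
qed

text \<open>Freezing the time argument at the points \<open>k / (n + 1)\<close> turns the integrand into simple functions.\<close>

lemma strongly_measurable_orbit:
  assumes g: "strongly_measurable X N M g"
    and tau: "\<tau> \<in> borel_measurable M" "\<And>s. s \<in> space M \<Longrightarrow> 0 \<le> \<tau> s" "\<And>s. s \<in> space M \<Longrightarrow> \<tau> s \<le> c"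
  shows "strongly_measurable X N M (\<lambda>s. S (\<tau> s) (g s))"
proof -
  obtain f where f: "\<And>n. simple_function M (f n)" "\<And>n t. t \<in> space M \<Longrightarrow> f n t \<in> X"
    "AE t in M. (\<lambda>n. N (f n t - g t)) \<longlonglongrightarrow> 0" by (rule strongly_measurableE[OF g]) (rule that)
  \<comment> \<open>\<open>\<tau> s\<close> rounded down to a multiple of \<open>1 / (n + 1)\<close>\<close>
  define d where "d n s = real_of_int \<lfloor>\<tau> s * real (Suc n)\<rfloor> / real (Suc n)" for n s
  have d: "0 \<le> d n s" "\<bar>d n s - \<tau> s\<bar> \<le> 1 / real (Suc n)" if "s \<in> space M" for n s
  proof -
    show "0 \<le> d n s" using tau(2)[OF that] by (simp add: d_def)
    have "\<tau> s * real (Suc n) - 1 \<le> \<lfloor>\<tau> s * real (Suc n)\<rfloor>" "\<lfloor>\<tau> s * real (Suc n)\<rfloor> \<le> \<tau> s * real (Suc n)"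
      by linarith+
    then have "\<bar>\<lfloor>\<tau> s * real (Suc n)\<rfloor> - \<tau> s * real (Suc n)\<bar> \<le> 1" by linarith
    moreover have "d n s - \<tau> s = (\<lfloor>\<tau> s * real (Suc n)\<rfloor> - \<tau> s * real (Suc n)) / real (Suc n)"
      by (simp add: d_def diff_divide_distrib)
    ultimately show "\<bar>d n s - \<tau> s\<bar> \<le> 1 / real (Suc n)"
      by (simp only: abs_divide abs_of_nat divide_right_mono of_nat_0_le_iff)
  qed
  have dsim: "simple_function M (d n)" for n
  proof (rule simple_function_borel_measurable)
    show "d n \<in> borel_measurable M" unfolding d_def using tau(1) by measurable
    have "d n ` space M \<subseteq> (\<lambda>k. real_of_int k / real (Suc n)) ` {0..\<lfloor>c * real (Suc n)\<rfloor>}"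
    proof
      fix y assume "y \<in> d n ` space M"
      then obtain s where s: "s \<in> space M" "y = d n s" by auto
      have "0 \<le> \<lfloor>\<tau> s * real (Suc n)\<rfloor>" "\<lfloor>\<tau> s * real (Suc n)\<rfloor> \<le> \<lfloor>c * real (Suc n)\<rfloor>"
        using tau(2,3)[OF s(1)] by (auto intro!: floor_mono mult_right_mono)
      then show "y \<in> (\<lambda>k. real_of_int k / real (Suc n)) ` {0..\<lfloor>c * real (Suc n)\<rfloor>}"
        unfolding s(2) d_def by auto
    qed
    then show "finite (d n ` space M)" by (rule finite_subset) auto
  qed
  show ?thesis
  proof (rule strongly_measurableI_lim[where s="\<lambda>n s. S (d n s) (f n s)"])
    show "S (\<tau> t) (g t) \<in> X" if "t \<in> space M" for t
      using that by (intro S_mem tau strongly_measurable_mem[OF g])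
    show "simple_function M (\<lambda>s. S (d n s) (f n s))" for n
      by (rule simple_function_compose2[OF dsim f(1)])
    show "S (d n t) (f n t) \<in> X" if "t \<in> space M" for n t
      using that by (intro S_mem d f)
    show "AE t in M. (\<lambda>n. N (S (d n t) (f n t) - S (\<tau> t) (g t))) \<longlonglongrightarrow> 0"
      using f(3) AE_space[of M]
    proof eventually_elim
      case (elim t)
      note t = elim(2)
      note gX = strongly_measurable_mem[OF g t]
      have "(\<lambda>n. d n t - \<tau> t) \<longlonglongrightarrow> 0"
        by (rule Lim_null_comparison[OF always_eventually LIMSEQ_inverse_real_of_nat])
           (use d(2)[OF t] in \<open>auto simp: inverse_eq_divide\<close>)
      then have "(\<lambda>n. d n t) \<longlonglongrightarrow> \<tau> t" by (simp add: LIM_zero_iff)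
      then have "(\<lambda>n. N (S (d n t) (g t) - S (\<tau> t) (g t))) \<longlonglongrightarrow> 0"
        by (intro S_tendsto gX tau t d)
      then have lim: "(\<lambda>n. N (f n t - g t) + N (S (d n t) (g t) - S (\<tau> t) (g t))) \<longlonglongrightarrow> 0 + 0"
        by (intro tendsto_add elim)
      have le: "norm (N (S (d n t) (f n t) - S (\<tau> t) (g t)))
          \<le> N (f n t - g t) + N (S (d n t) (g t) - S (\<tau> t) (g t))" for n
      proof -
        have m: "S (d n t) (f n t) \<in> X" "S (d n t) (g t) \<in> X" "S (\<tau> t) (g t) \<in> X"
          by (auto intro!: S_mem d f t gX tau)
        show ?thesis
          using N_diff_triangle[OF m] S_diff_le[OF d(1)[OF t] f(2)[OF t] gX, of n n] N_nonneg[OF diff_mem[OF m(1,3)]]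
          by simp
      qed
      show ?case using lim le by (rule tendsto_zero_le) simp
    qed
  qed
qed

subsection \<open>Density of the domain\<close>

lemma functional_cong:
  assumes l: "bounded_functional l" and "x \<in> X" "y \<in> X" "N (x - y) = 0"
  shows "l x = l y"
proof -
  obtain C where "\<And>x. x \<in> X \<Longrightarrow> \<bar>l x\<bar> \<le> C * N x" by (rule functional_bound[OF l]) (rule that)
  from this[of "x - y"] show ?thesis using assms by (simp add: functional_diff mem)
qed

lemma bounded_functional_S:
  assumes l: "bounded_functional l" and r: "0 \<le> r"
  shows "bounded_functional (\<lambda>x. l (S r x))"
proof -
  obtain C where C: "C \<ge> 0" "\<And>x. x \<in> X \<Longrightarrow> \<bar>l x\<bar> \<le> C * N x" by (rule functional_bound[OF l]) (rule that)
  show ?thesis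
    unfolding bounded_functional_def
  proof (intro conjI ballI allI exI[of _ C])
    fix x y a b assume x: "x \<in> X" and y: "y \<in> X"
    have "l (S r (a *\<^sub>R x + b *\<^sub>R y)) = l (a *\<^sub>R S r x + b *\<^sub>R S r y)"
      by (rule functional_cong[OF l]) (use x y r S_lin[OF r x y] in \<open>auto intro!: S_mem mem\<close>)
    then show "l (S r (a *\<^sub>R x + b *\<^sub>R y)) = a * l (S r x) + b * l (S r y)"
      using x y r by (simp add: functional_add[OF l] functional_scale[OF l] S_mem mem)
  next
    fix x assume x: "x \<in> X"
    have "\<bar>l (S r x)\<bar> \<le> C * N (S r x)" by (intro C S_mem r x)
    also have "\<dots> \<le> C * N x" by (intro mult_left_mono S_contr C r x)
    finally show "\<bar>l (S r x)\<bar> \<le> C * N x" .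
  qed (rule C)
qed

lemma continuous_functional_orbit:
  assumes l: "bounded_functional l" and x: "x \<in> X"
  shows "continuous_on UNIV (\<lambda>s. l (S \<bar>s\<bar> x))"
  unfolding continuous_on_def
  by (intro ballI functional_tendsto[OF l] S_tendsto S_mem x tendsto_rabs tendsto_ident_at) auto

definition orbit_integral :: "real \<Rightarrow> 'a \<Rightarrow> 'a" where
  "orbit_integral h x = bochner_int X N (lebesgue_on {0<..<h}) (\<lambda>s. S s x)"

lemma weak_int_orbit:
  assumes x: "x \<in> X"
  shows "weak_int (lebesgue_on {0<..<h}) (\<lambda>s. S s x) (orbit_integral h x)"
  unfolding orbit_integral_def
proof (rule weak_int_has_bochner_int[OF finite_measure_Ioo bochner_int_exists[OF finite_measure_Ioo]])
  show "strongly_measurable X N (lebesgue_on {0<..<h}) (\<lambda>s. S s x)"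
    by (rule strongly_measurable_orbit[where g="\<lambda>_. x" and c=h, OF strongly_measurable_const[OF x]])
       (auto intro!: measurable_restrict_space1 measurable_completion)
  have "(\<integral>\<^sup>+s. ennreal (N (S s x)) \<partial>lebesgue_on {0<..<h}) \<le> (\<integral>\<^sup>+s. ennreal (N x) \<partial>lebesgue_on {0<..<h})"
    by (intro nn_integral_mono ennreal_leI S_contr x) auto
  also have "\<dots> < \<infinity>"
    by (cases "0 \<le> h") (simp_all add: emeasure_restrict_space ennreal_mult_less_top)
  finally show "(\<integral>\<^sup>+s. ennreal (N (S s x)) \<partial>lebesgue_on {0<..<h}) < \<infinity>" .
qed

lemma functional_orbit_integral:
  assumes x: "x \<in> X" and l: "bounded_functional l"
  shows "l (orbit_integral h x) = integral {0..h} (\<lambda>s. l (S s x))"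
proof -
  have "has_bochner_integral lebesgue (\<lambda>s. indicator {0<..<h} s *\<^sub>R l (S s x)) (l (orbit_integral h x))"
    by (rule weak_int_lebesgue[OF weak_int_orbit[OF x] _ l]) auto
  then have "((\<lambda>s. indicator {0<..<h} s *\<^sub>R l (S s x)) has_integral l (orbit_integral h x)) UNIV"
    using has_integral_integral_lebesgue[of "\<lambda>s. indicator {0<..<h} s *\<^sub>R l (S s x)"]
    unfolding has_bochner_integral_iff by metis
  then have "((\<lambda>s. l (S s x)) has_integral l (orbit_integral h x)) {0<..<h}"
    by (subst has_integral_restrict_UNIV[symmetric], elim has_integral_eq[rotated]) (auto split: split_indicator)
  then show ?thesis by (simp add: has_integral_Icc_iff_Ioo[symmetric] integral_unique)
qed

lemma integral_near_const:
  fixes \<phi> :: "real \<Rightarrow> real"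
  assumes ab: "a \<le> b" and cont: "continuous_on {a..b} \<phi>" and le: "\<And>s. s \<in> {a..b} \<Longrightarrow> \<bar>\<phi> s - c\<bar> \<le> m"
  shows "\<bar>integral {a..b} \<phi> - (b - a) * c\<bar> \<le> (b - a) * m"
proof -
  have "integral {a..b} \<phi> - (b - a) * c = integral {a..b} (\<lambda>s. \<phi> s - c)"
    using ab by (subst integral_diff) (auto intro!: integrable_continuous_interval cont simp: measure_def)
  also have "norm \<dots> \<le> integral {a..b} (\<lambda>s. m)"
    by (rule integral_norm_bound_integral) (use le in \<open>auto intro!: integrable_continuous_interval continuous_intros cont\<close>)
  also have "\<dots> = (b - a) * m" using ab by simp
  finally show ?thesis by simp
qed

text \<open>The identity \<open>S r F - F = (\<integral>\<^bsub>[h, h + r]\<^esub> - \<integral>\<^bsub>[0, r]\<^esub>) S s x\<close> for \<open>F = \<integral>\<^bsub>[0, h]\<^esub> S s x\<close>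
  is read off from the real integrals obtained by applying a functional.\<close>

lemma orbit_integral_mem_D:
  assumes x: "x \<in> X" and h: "0 < h"
  shows "orbit_integral h x \<in> D"
proof -
  define F where "F = orbit_integral h x"
  have F: "F \<in> X" using weak_intD(1)[OF weak_int_orbit[OF x]] by (simp add: F_def)
  \<comment> \<open>the difference quotient of \<open>F\<close> minus its expected limit \<open>S h x - x\<close>\<close>
  define W where "W r = (1 / r) *\<^sub>R (S r F - F) - (S h x - x)" for r
  have W: "W r \<in> X" if "0 < r" for r using that h x F by (auto simp: W_def intro!: mem S_mem)
  have est: "N (W r) \<le> 2 * e" if r: "0 < r" "r \<le> h" and small: "\<And>s. 0 \<le> s \<Longrightarrow> s \<le> r \<Longrightarrow> N (S s x - x) \<le> e" for r e
  proof -
    define l where "l y = ip y (W r)" for y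
    have l: "bounded_functional l" unfolding l_def by (rule bounded_functional_ip[OF W[OF r(1)]])
    define \<phi> where "\<phi> s = l (S \<bar>s\<bar> x)" for s
    have cont: "continuous_on B \<phi>" for B
      using continuous_on_subset[OF continuous_functional_orbit[OF l x]] by (auto simp: \<phi>_def)
    have int: "\<phi> integrable_on {a..b}" for a b by (intro integrable_continuous_interval cont)
    have "l (S r F) = integral {0..h} (\<lambda>s. l (S r (S s x)))"
      unfolding F_def using r by (intro functional_orbit_integral[OF x] bounded_functional_S l) auto
    also have "\<dots> = integral {0..h} (\<phi> \<circ> (\<lambda>s. s + r))"
    proof (rule integral_cong)
      fix s assume "s \<in> {0..h}"
      then have s: "0 \<le> s" by simp
      have "N (S r (S s x) - S (r + s) x) = 0"
        using S_add[of r s x] N_minus_commute[of "S (r + s) x" "S r (S s x)"] r s x by (simp add: S_mem)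
      then have "l (S r (S s x)) = l (S (r + s) x)"
        using r s x by (intro functional_cong[OF l] S_mem) auto
      then show "l (S r (S s x)) = (\<phi> \<circ> (\<lambda>s. s + r)) s" using s r by (simp add: \<phi>_def add.commute)
    qed
    also have "\<dots> = integral {0 + r..h + r} \<phi>" by (rule integral_shift[OF cont])
    also have "\<dots> = integral {r..h} \<phi> + integral {h..h + r} \<phi>"
      using r by (subst Henstock_Kurzweil_Integration.integral_combine) (auto intro: int)
    finally have SF: "l (S r F) = integral {r..h} \<phi> + integral {h..h + r} \<phi>" .
    have "l F = integral {0..h} (\<lambda>s. l (S s x))"
      unfolding F_def by (rule functional_orbit_integral[OF x l])
    also have "\<dots> = integral {0..h} \<phi>" by (rule integral_cong) (simp add: \<phi>_def)
    also have "\<dots> = integral {0..r} \<phi> + integral {r..h} \<phi>"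
      using r by (subst Henstock_Kurzweil_Integration.integral_combine) (auto intro: int)
    finally have SF': "l (S r F) - l F = integral {h..h + r} \<phi> - integral {0..r} \<phi>" using SF by simp
    have osc: "\<bar>\<phi> s - l (S a x)\<bar> \<le> N (W r) * e" if "0 \<le> a" "a \<le> s" "s \<le> a + r" for a s
    proof -
      have m: "S s x \<in> X" "S a x \<in> X" using that x by (auto intro!: S_mem)
      have "\<bar>\<phi> s - l (S a x)\<bar> = \<bar>l (S s x - S a x)\<bar>"
        using that m by (simp add: \<phi>_def functional_diff[OF l])
      also have "\<dots> \<le> N (S s x - S a x) * N (W r)"
        unfolding l_def by (intro cauchy_schwarz mem m W r)
      also have "\<dots> \<le> e * N (W r)"
        using S_modulus[of s a x] small[of "\<bar>s - a\<bar>"] that x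
        by (intro mult_right_mono N_nonneg W r) auto
      finally show ?thesis by (simp add: mult.commute)
    qed
    have "\<bar>integral {h..h + r} \<phi> - (h + r - h) * l (S h x)\<bar> \<le> (h + r - h) * (N (W r) * e)"
      by (rule integral_near_const) (use r h osc[of h] cont in auto)
    moreover have "\<bar>integral {0..r} \<phi> - (r - 0) * l (S 0 x)\<bar> \<le> (r - 0) * (N (W r) * e)"
      by (rule integral_near_const) (use r osc[of 0] cont in auto)
    moreover have "l (S 0 x) = l x" by (rule functional_cong[OF l]) (use x S_0 in \<open>auto intro: S_mem\<close>)
    ultimately have "\<bar>(l (S r F) - l F) - r * (l (S h x) - l x)\<bar> \<le> r * (2 * (N (W r) * e))"
      unfolding SF' by (simp add: algebra_simps abs_le_iff)
    also have "(l (S r F) - l F) - r * (l (S h x) - l x) = r * l (W r)"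
    proof -
      have "l (W r) = (1 / r) * (l (S r F) - l F) - (l (S h x) - l x)"
        using r h x F by (simp add: W_def functional_diff[OF l] functional_scale[OF l] mem S_mem)
      then show ?thesis using r by (simp add: right_diff_distrib)
    qed
    finally have "r * \<bar>l (W r)\<bar> \<le> r * (2 * (N (W r) * e))" using r by (simp add: abs_mult)
    then have "N (W r) * N (W r) \<le> N (W r) * (2 * e)"
      using r N_sq[OF W[OF r(1)]] by (simp add: l_def power2_eq_square)
    moreover have "0 \<le> e" using small[of 0] N_nonneg[of "S 0 x - x"] r x by (simp add: S_mem mem)
    ultimately show ?thesis
      using N_nonneg[OF W[OF r(1)]] by (cases "N (W r) = 0") auto
  qed
  have "((\<lambda>r. N (W r)) \<longlongrightarrow> 0) (at_right 0)"
  proof (rule tendstoI)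
    fix e :: real assume e: "0 < e"
    then have "0 < e / 3" by simp
    then obtain d where d: "0 < d" "\<And>h. 0 \<le> h \<Longrightarrow> h < d \<Longrightarrow> N (S h x - x) < e / 3"
      by (rule S_small_time[OF x]) (rule that)
    show "eventually (\<lambda>r. dist (N (W r)) 0 < e) (at_right 0)"
      unfolding eventually_at_right_field
    proof (intro exI[of _ "min d h"] conjI allI impI)
      fix r assume r: "0 < r" "r < min d h"
      have "N (W r) \<le> 2 * (e / 3)" by (rule est) (use r d(2) in \<open>auto intro: less_imp_le\<close>)
      then show "dist (N (W r)) 0 < e" using e N_nonneg[OF W[OF r(1)]] by simp
    qed (use d h in auto)
  qed
  then show ?thesis
    using generator F diff_mem[OF S_mem[OF less_imp_le[OF h] x] x]
    unfolding has_generator_def W_def F_def by blast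
qed

text \<open>The averages of the orbit over short intervals lie in the domain and converge to the initial value.\<close>

theorem D_dense:
  assumes x: "x \<in> X" and e: "0 < e"
  obtains y where "y \<in> D" "N (y - x) < e"
proof -
  have "0 < e / 2" using e by simp
  then obtain d where d: "0 < d" "\<And>h. 0 \<le> h \<Longrightarrow> h < d \<Longrightarrow> N (S h x - x) < e / 2"
    by (rule S_small_time[OF x]) (rule that)
  define h where "h = d / 2"
  have h: "0 < h" "h < d" using d by (auto simp: h_def)
  \<comment> \<open>with this scaling the average is itself an orbit integral\<close>
  define z where "z = (1 / h) *\<^sub>R x"
  have z: "z \<in> X" using x by (simp add: z_def mem)
  define y where "y = orbit_integral h z"
  have yD: "y \<in> D" unfolding y_def by (rule orbit_integral_mem_D[OF z h(1)])
  then have y: "y \<in> X" by (rule D_mem)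
  define w where "w = y - x"
  have w: "w \<in> X" using x y by (simp add: w_def mem)
  define l where "l y = ip y w" for y
  have l: "bounded_functional l" unfolding l_def by (rule bounded_functional_ip[OF w])
  have ly: "l y = integral {0..h} (\<lambda>s. l (S \<bar>s\<bar> z))"
    unfolding y_def functional_orbit_integral[OF z l] by (rule integral_cong) simp
  have "\<bar>integral {0..h} (\<lambda>s. l (S \<bar>s\<bar> z)) - (h - 0) * l z\<bar> \<le> (h - 0) * ((1 / h) * (e / 2) * N w)"
  proof (rule integral_near_const)
    show "continuous_on {0..h} (\<lambda>s. l (S \<bar>s\<bar> z))"
      using continuous_on_subset[OF continuous_functional_orbit[OF l z]] by auto
    fix s assume s: "s \<in> {0..h}"
    have m: "S s x \<in> X" "S s z \<in> X" "(1/h) *\<^sub>R S s x \<in> X" using s x z by (auto intro!: S_mem mem)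
    have "N (S s z - z) \<le> N (S s z - (1/h) *\<^sub>R S s x) + N ((1/h) *\<^sub>R S s x - z)"
      by (intro N_diff_triangle m z)
    also have "N (S s z - (1/h) *\<^sub>R S s x) = 0" using S_scale[of s x "1/h"] s x by (simp add: z_def)
    also have "(1/h) *\<^sub>R S s x - z = (1/h) *\<^sub>R (S s x - x)" by (simp add: z_def algebra_simps)
    also have "N \<dots> = (1/h) * N (S s x - x)" using h x m by (simp add: N_scale mem)
    also have "\<dots> \<le> (1/h) * (e/2)" using d(2)[of s] s h by (intro mult_left_mono) auto
    finally have "N (S s z - z) \<le> (1/h) * (e/2)" by simp
    then have "N (S s z - z) * N w \<le> (1/h) * (e/2) * N w"
      by (intro mult_right_mono N_nonneg w)
    then show "\<bar>l (S \<bar>s\<bar> z) - l z\<bar> \<le> (1/h) * (e/2) * N w"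
      using cauchy_schwarz[OF diff_mem[OF m(2) z] w] s m z w by (simp add: l_def ip_diff)
  qed (use h in auto)
  then have "\<bar>l y - h * l z\<bar> \<le> e / 2 * N w" using h by (simp add: ly)
  moreover have "h * l z = l x" using h x by (simp add: z_def functional_scale[OF l])
  moreover have "l y - l x = (N w)\<^sup>2" using x y w by (simp add: l_def w_def ip_diff N_sq)
  ultimately have "N w * N w \<le> e / 2 * N w" by (simp add: power2_eq_square)
  then have "N w \<le> e / 2" using N_nonneg[OF w] e by (cases "N w = 0") auto
  then show thesis using that[OF yD] e by (simp add: w_def)
qed

subsection \<open>Mild solutions\<close>

definition convolution :: "(real \<Rightarrow> 'a) \<Rightarrow> real \<Rightarrow> 'a" where
  "convolution g t = bochner_int X N (lebesgue_on {0<..<t}) (\<lambda>s. S (t - s) (g s))"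

definition forcing :: "real \<Rightarrow> (real \<Rightarrow> 'a) \<Rightarrow> bool" where
  "forcing T g \<longleftrightarrow> strongly_measurable X N (lebesgue_on {0<..<T}) g \<and>
     (\<integral>\<^sup>+s. ennreal (N (g s)) \<partial>lebesgue_on {0<..<T}) < \<infinity>"

lemma forcing_mem: "forcing T g \<Longrightarrow> 0 < s \<Longrightarrow> s < T \<Longrightarrow> g s \<in> X"
  unfolding forcing_def using strongly_measurable_mem by fastforce

lemma weak_int_convolution:
  assumes g: "forcing T g" and t: "t \<le> T"
  shows "weak_int (lebesgue_on {0<..<t}) (\<lambda>s. S (t - s) (g s)) (convolution g t)"
  unfolding convolution_def
proof (rule weak_int_has_bochner_int[OF finite_measure_Ioo bochner_int_exists[OF finite_measure_Ioo]])
  have "strongly_measurable X N (lebesgue_on {0<..<t}) g"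
    by (rule strongly_measurable_lebesgue_on_subset[where B="{0<..<T}"]) (use g t in \<open>auto simp: forcing_def\<close>)
  then show "strongly_measurable X N (lebesgue_on {0<..<t}) (\<lambda>s. S (t - s) (g s))"
    by (rule strongly_measurable_orbit[where c=t])
       (auto intro!: borel_measurable_diff measurable_restrict_space1 measurable_completion)
  have "(\<integral>\<^sup>+s. ennreal (N (S (t - s) (g s))) \<partial>lebesgue_on {0<..<t})
      \<le> (\<integral>\<^sup>+s. ennreal (N (g s)) \<partial>lebesgue_on {0<..<T})"
    using t by (intro nn_integral_lebesgue_on_mono ennreal_leI S_contr) (auto intro!: forcing_mem[OF g])
  also have "\<dots> < \<infinity>" using g by (simp add: forcing_def)
  finally show "(\<integral>\<^sup>+s. ennreal (N (S (t - s) (g s))) \<partial>lebesgue_on {0<..<t}) < \<infinity>" .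
qed

lemma convolution_mem: "forcing T g \<Longrightarrow> t \<le> T \<Longrightarrow> convolution g t \<in> X"
  using weak_intD(1)[OF weak_int_convolution] .

lemma convolution_diff_le:
  assumes g: "forcing T g" and h: "forcing T h" and t: "t \<le> T"
  shows "ennreal (N (convolution g t - convolution h t)) \<le> (\<integral>\<^sup>+s. ennreal (N (g s - h s)) \<partial>lebesgue_on {0<..<T})"
proof -
  have "ennreal (N (convolution g t - convolution h t))
      \<le> (\<integral>\<^sup>+s. ennreal (N (S (t - s) (g s) - S (t - s) (h s))) \<partial>lebesgue_on {0<..<t})"
    by (intro weak_int_norm_le weak_int_diff weak_int_convolution[OF g t] weak_int_convolution[OF h t])
  also have "\<dots> \<le> (\<integral>\<^sup>+s. ennreal (N (g s - h s)) \<partial>lebesgue_on {0<..<T})"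
    using t by (intro nn_integral_lebesgue_on_mono ennreal_leI S_diff_le)
       (auto intro!: forcing_mem[OF g] forcing_mem[OF h])
  finally show ?thesis .
qed

lemma finite_family_small_time:
  assumes Y: "finite Y" "Y \<subseteq> X" and e: "0 < e"
  obtains d where "0 < d" "\<And>h y. 0 \<le> h \<Longrightarrow> h < d \<Longrightarrow> y \<in> Y \<Longrightarrow> N (S h y - y) < e"
proof -
  have "\<exists>d>0. \<forall>h y. 0 \<le> h \<longrightarrow> h < d \<longrightarrow> y \<in> Y \<longrightarrow> N (S h y - y) < e"
    using Y
  proof (induction Y)
    case (insert y Y)
    then obtain d where d: "d > 0" "\<forall>h y. 0 \<le> h \<longrightarrow> h < d \<longrightarrow> y \<in> Y \<longrightarrow> N (S h y - y) < e" by auto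
    have "y \<in> X" using insert by simp
    then obtain d' where d': "0 < d'" "\<And>h. 0 \<le> h \<Longrightarrow> h < d' \<Longrightarrow> N (S h y - y) < e"
      using e by (rule S_small_time) (rule that)
    show ?case using d d' by (intro exI[of _ "min d d'"]) auto
  qed (auto intro: exI[of _ 1])
  then show thesis using that by blast
qed

lemma forcing_simple:
  assumes s: "simple_function (lebesgue_on {0<..<T}) f" "\<And>t. t \<in> {0<..<T} \<Longrightarrow> f t \<in> X"
  obtains K where "forcing T f" "0 \<le> K" "\<And>t. t \<in> {0<..<T} \<Longrightarrow> N (f t) \<le> K"
proof -
  let ?K = "Max (insert 0 ((\<lambda>t. N (f t)) ` {0<..<T}))"
  have fin: "finite ((\<lambda>t. N (f t)) ` {0<..<T})"
    using simple_functionD(1)[OF simple_function_compose1[OF s(1), of N]] by simp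
  have K: "0 \<le> ?K" by (rule Max_ge) (use fin in auto)
  have K': "N (f t) \<le> ?K" if "t \<in> {0<..<T}" for t by (rule Max_ge) (use fin that in auto)
  have "(\<integral>\<^sup>+t. ennreal (N (f t)) \<partial>lebesgue_on {0<..<T}) \<le> (\<integral>\<^sup>+t. ennreal ?K \<partial>lebesgue_on {0<..<T})"
    by (intro nn_integral_mono ennreal_leI K') simp
  also have "\<dots> < \<infinity>"
    by (cases "0 \<le> T") (simp_all add: emeasure_restrict_space ennreal_mult_less_top)
  finally have "forcing T f"
    using strongly_measurable_simple[OF s(1)] s(2) by (simp add: forcing_def)
  then show thesis by (rule that[OF _ K K'])
qed

lemma forcing_approx:
  assumes g: "forcing T g" and e: "0 < e"
  obtains f where "simple_function (lebesgue_on {0<..<T}) f" "\<And>t. t \<in> {0<..<T} \<Longrightarrow> f t \<in> X" "forcing T f"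
    "(\<integral>\<^sup>+s. ennreal (N (g s - f s)) \<partial>lebesgue_on {0<..<T}) < ennreal e"
proof -
  obtain s where s: "\<And>n. simple_function (lebesgue_on {0<..<T}) (s n)"
    "\<And>n t. t \<in> space (lebesgue_on {0<..<T}) \<Longrightarrow> s n t \<in> X"
    "(\<lambda>n. \<integral>\<^sup>+t. ennreal (N (g t - s n t)) \<partial>lebesgue_on {0<..<T}) \<longlonglongrightarrow> 0"
    by (rule simple_approx[of "lebesgue_on {0<..<T}" g]) (use g that in \<open>auto simp: forcing_def\<close>)
  have "eventually (\<lambda>n. (\<integral>\<^sup>+t. ennreal (N (g t - s n t)) \<partial>lebesgue_on {0<..<T}) < ennreal e) sequentially"
    using s(3) e by (intro order_tendstoD) auto
  then obtain n where n: "(\<integral>\<^sup>+t. ennreal (N (g t - s n t)) \<partial>lebesgue_on {0<..<T}) < ennreal e"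
    by (auto simp: eventually_sequentially)
  have m: "\<And>t. t \<in> {0<..<T} \<Longrightarrow> s n t \<in> X" using s(2) by simp
  obtain K where "forcing T (s n)" by (rule forcing_simple[OF s(1) m]) (auto intro: that)
  then show thesis using that[OF s(1) m _ n] by blast
qed

text \<open>On \<open>{0<..<t}\<close> the two integrands differ by at most \<open>m\<close>, and on \<open>{t..<t'}\<close> only one of them is present.\<close>

lemma convolution_simple_modulus:
  assumes f: "forcing T f" and K: "0 \<le> K" "\<And>s. s \<in> {0<..<T} \<Longrightarrow> N (f s) \<le> K"
    and t: "0 \<le> t" "t \<le> t'" "t' \<le> T"
    and m: "0 \<le> m" "\<And>s. s \<in> {0<..<T} \<Longrightarrow> N (S (t' - t) (f s) - f s) \<le> m"
  shows "N (convolution f t' - convolution f t) \<le> T * m + (t' - t) * K"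
proof -
  let ?b = "\<lambda>s. indicator {0<..<t} s * m + indicator {t..<t'} s * K"
  have "ennreal (N (convolution f t' - convolution f t)) \<le> (\<integral>\<^sup>+s. ennreal (?b s) \<partial>lebesgue)"
  proof (rule weak_int_lebesgue_diff_le[OF weak_int_convolution[OF f t(3)] weak_int_convolution[OF f]])
    show "t \<le> T" using t by simp
    fix s :: real
    have fX: "f s \<in> X" if "s \<in> {0<..<t'}" using that t by (intro forcing_mem[OF f]) auto
    consider "s \<in> {0<..<t}" | "s \<in> {t..<t'}" "0 < s" | "s \<notin> {0<..<t'}" by fastforce
    then show "N ((indicator {0<..<t'} s :: real) *\<^sub>R S (t' - s) (f s) - (indicator {0<..<t} s :: real) *\<^sub>R S (t - s) (f s)) \<le> ?b s"
    proof cases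
      case 1
      then have "N (S (t' - s) (f s) - S (t - s) (f s)) \<le> N (S (t' - t) (f s) - f s)"
        using S_modulus[of "t' - s" "t - s" "f s"] fX t by simp
      also have "\<dots> \<le> m" using 1 t by (intro m) auto
      finally show ?thesis using 1 t by simp
    next
      case 2
      then have "N (S (t' - s) (f s)) \<le> N (f s)" using fX t by (intro S_contr) auto
      also have "\<dots> \<le> K" using 2 t by (intro K) auto
      finally show ?thesis using 2 t by simp
    next
      case 3
      then show ?thesis using t K m by (auto simp: N_zero split: split_indicator)
    qed
  qed (auto intro!: borel_measurable_add borel_measurable_times borel_measurable_indicator)
  also have "\<dots> = (\<integral>\<^sup>+s. ennreal m * indicator {0<..<t} s + ennreal K * indicator {t..<t'} s \<partial>lebesgue)"
    using m K by (intro nn_integral_cong) (auto split: split_indicator)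
  also have "\<dots> = ennreal m * emeasure lebesgue {0<..<t} + ennreal K * emeasure lebesgue {t..<t'}"
    by (subst nn_integral_add)
       (auto simp: nn_integral_cmult_indicator intro!: borel_measurable_times_ennreal borel_measurable_indicator)
  also have "\<dots> = ennreal (t * m + (t' - t) * K)"
    using t m K by (simp add: ennreal_mult ennreal_plus mult.commute)
  finally have "N (convolution f t' - convolution f t) \<le> t * m + (t' - t) * K"
    using t m K by (subst (asm) ennreal_le_iff) auto
  also have "\<dots> \<le> T * m + (t' - t) * K" using t m by (intro add_right_mono mult_right_mono) auto
  finally show ?thesis .
qed

text \<open>A forcing with finitely many values needs only finitely many orbits to be equicontinuous at time zero. The
  general case follows because the convolution depends on the forcing uniformly in time.\<close>

lemma convolution_continuous:
  assumes g: "forcing T g" and t: "t \<in> {0..T}"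
  shows "((\<lambda>s. N (convolution g s - convolution g t)) \<longlongrightarrow> 0) (at t within {0..T})"
proof (rule tendstoI)
  fix e :: real assume e: "0 < e"
  then have e4: "0 < e / 4" by simp
  obtain f where f: "simple_function (lebesgue_on {0<..<T}) f" "\<And>t. t \<in> {0<..<T} \<Longrightarrow> f t \<in> X" "forcing T f"
    "(\<integral>\<^sup>+s. ennreal (N (g s - f s)) \<partial>lebesgue_on {0<..<T}) < ennreal (e / 4)"
    by (rule forcing_approx[OF g e4]) (rule that)
  have near: "N (convolution g s - convolution f s) < e / 4" if "s \<le> T" for s
  proof -
    have "ennreal (N (convolution g s - convolution f s)) < ennreal (e / 4)"
      using convolution_diff_le[OF g f(3) that] f(4) by (rule order_le_less_trans)
    then show ?thesis using N_nonneg[OF diff_mem[OF convolution_mem[OF g that] convolution_mem[OF f(3) that]]]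
      by (simp add: ennreal_less_iff)
  qed
  obtain K where K: "0 \<le> K" "\<And>t. t \<in> {0<..<T} \<Longrightarrow> N (f t) \<le> K"
    by (rule forcing_simple[OF f(1,2)]) (auto intro: that)
  define m where "m = e / (8 * (\<bar>T\<bar> + 1))"
  have m: "0 < m" using e by (simp add: m_def)
  have "finite (f ` {0<..<T})" "f ` {0<..<T} \<subseteq> X"
    using simple_functionD(1)[OF f(1)] f(2) by auto
  then obtain d where d: "0 < d" "\<And>h y. 0 \<le> h \<Longrightarrow> h < d \<Longrightarrow> y \<in> f ` {0<..<T} \<Longrightarrow> N (S h y - y) < m"
    by (rule finite_family_small_time[OF _ _ m]) (rule that)
  define d' where "d' = min d (e / (8 * (K + 1)))"
  have d': "0 < d'" using d K e by (simp add: d'_def)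
  have step: "N (convolution f b - convolution f a) < e / 2"
    if ab: "0 \<le> a" "a \<le> b" "b \<le> T" "b - a < d'" for a b
  proof -
    have "N (convolution f b - convolution f a) \<le> T * m + (b - a) * K"
      by (rule convolution_simple_modulus[OF f(3) K])
         (use ab m d(2)[of "b - a"] in \<open>auto simp: d'_def intro: less_imp_le\<close>)
    also have "T * m \<le> e / 8"
    proof -
      have "T * m \<le> (\<bar>T\<bar> + 1) * m" using m by (intro mult_right_mono) auto
      also have "\<dots> = e / 8" using abs_ge_zero[of T] by (simp add: m_def divide_simps del: abs_ge_zero)
      finally show ?thesis .
    qed
    also have "(b - a) * K \<le> e / 8"
    proof -
      have "(b - a) * K \<le> (e / (8 * (K + 1))) * (K + 1)"
        using ab K e by (intro mult_mono) (auto simp: d'_def)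
      also have "\<dots> = e / 8" using K(1) by (simp add: divide_simps)
      finally show ?thesis .
    qed
    finally show ?thesis using e by simp
  qed
  have "eventually (\<lambda>s. s \<in> {0..T} \<and> dist s t < d') (at t within {0..T})"
    using d' by (auto simp: eventually_at intro!: exI[of _ d'])
  then show "eventually (\<lambda>s. dist (N (convolution g s - convolution g t)) 0 < e) (at t within {0..T})"
  proof eventually_elim
    case (elim s)
    then have s: "0 \<le> s" "s \<le> T" and tT: "0 \<le> t" "t \<le> T" using t by auto
    note mem' = convolution_mem[OF g s(2)] convolution_mem[OF g tT(2)] convolution_mem[OF f(3) s(2)] convolution_mem[OF f(3) tT(2)]
    have "N (convolution f s - convolution f t) < e / 2"
    proof (cases "s \<le> t")
      case True
      then show ?thesis using step[of s t] s tT elim N_minus_commute[OF mem'(3,4)] by (simp add: dist_real_def)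
    next
      case False
      then show ?thesis using step[of t s] s tT elim by (simp add: dist_real_def)
    qed
    moreover have "N (convolution g s - convolution g t) \<le> N (convolution g s - convolution f s) + N (convolution f s - convolution g t)"
      "N (convolution f s - convolution g t) \<le> N (convolution f s - convolution f t) + N (convolution f t - convolution g t)"
      by (intro N_diff_triangle mem')+
    ultimately show ?case
      using near[OF s(2)] near[OF tT(2)] N_minus_commute[OF mem'(4,2)] N_nonneg[OF diff_mem[OF mem'(1,2)]] by simp
  qed
qed

lemma mild_solution_eq: "mild_solution X N S x g t = S t x + convolution g t"
  by (simp add: mild_solution_def convolution_def)

theorem mild_solution_mem: "x \<in> X \<Longrightarrow> forcing T g \<Longrightarrow> t \<in> {0..T} \<Longrightarrow> mild_solution X N S x g t \<in> X"
  by (auto simp: mild_solution_eq intro!: mem S_mem convolution_mem)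

theorem mild_solution_continuous:
  assumes x: "x \<in> X" and g: "forcing T g" and t: "t \<in> {0..T}"
  shows "((\<lambda>s. N (mild_solution X N S x g s - mild_solution X N S x g t)) \<longlongrightarrow> 0) (at t within {0..T})"
proof -
  have "((\<lambda>s. N (S \<bar>s\<bar> x - S t x)) \<longlongrightarrow> 0) (at t within {0..T})"
    using t tendsto_rabs[OF tendsto_ident_at, of t "{0..T}"] by (intro S_tendsto x) auto
  then have lim: "((\<lambda>s. N (S \<bar>s\<bar> x - S t x) + N (convolution g s - convolution g t)) \<longlongrightarrow> 0 + 0) (at t within {0..T})"
    by (intro tendsto_add convolution_continuous[OF g t])
  have ev: "eventually (\<lambda>s. s \<in> {0..T}) (at t within {0..T})" by (simp add: eventually_at_topological) blast
  show ?thesis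
  proof (rule tendsto_sandwich[OF _ _ tendsto_const])
    show "eventually (\<lambda>s. 0 \<le> N (mild_solution X N S x g s - mild_solution X N S x g t)) (at t within {0..T})"
      using ev by eventually_elim (intro N_nonneg diff_mem mild_solution_mem[OF x g] t)
    show "eventually (\<lambda>s. N (mild_solution X N S x g s - mild_solution X N S x g t)
        \<le> N (S \<bar>s\<bar> x - S t x) + N (convolution g s - convolution g t)) (at t within {0..T})"
      using ev
    proof eventually_elim
      case (elim s)
      have "mild_solution X N S x g s - mild_solution X N S x g t
          = (S s x - S t x) + (convolution g s - convolution g t)" by (simp add: mild_solution_eq)
      then show ?case
        using N_triangle[of "S s x - S t x" "convolution g s - convolution g t"] elim t x
        by (simp add: mem S_mem convolution_mem[OF g])
    qed
  qed (use lim in simp)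
qed

end

section \<open>Convergence of a family of contraction semigroups\<close>

text \<open>The last time at which the asserted inequality holds cannot be smaller than \<open>T\<close>, since the hypothesis carries the
  inequality a little further.\<close>

lemma le_of_right_dini_le:
  fixes \<phi> :: "real \<Rightarrow> real"
  assumes T: "0 \<le> T" and cont: "continuous_on {0..T} \<phi>"
    and dini: "\<And>t. 0 \<le> t \<Longrightarrow> t < T \<Longrightarrow> eventually (\<lambda>h. \<phi> (t + h) \<le> \<phi> t + c * h) (at_right 0)"
  shows "\<phi> T \<le> \<phi> 0 + c * T"
proof -
  let ?B = "{t \<in> {0..T}. \<phi> t - c * t \<le> \<phi> 0}"
  have closed: "closed ?B"
    by (intro continuous_on_closed_Collect_le continuous_intros cont)
  have ne: "?B \<noteq> {}" "bdd_above ?B" using T by (auto intro!: exI[of _ 0] bdd_aboveI[of _ T])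
  define s where "s = Sup ?B"
  have s: "s \<in> ?B" unfolding s_def by (rule closed_contains_Sup[OF ne closed])
  have "s = T"
  proof (rule ccontr)
    assume "s \<noteq> T"
    then have "s < T" "0 \<le> s" using s by auto
    then obtain d where d: "0 < d" "\<And>h. 0 < h \<Longrightarrow> h < d \<Longrightarrow> \<phi> (s + h) \<le> \<phi> s + c * h"
      using dini[of s] by (auto simp: eventually_at_right_field)
    define h where "h = min (d / 2) (T - s)"
    have h: "0 < h" "h < d" "s + h \<le> T" using d \<open>s < T\<close> by (auto simp: h_def)
    have "\<phi> (s + h) - c * (s + h) \<le> \<phi> 0" using d(2)[OF h(1,2)] s by (simp add: algebra_simps)
    then have "s + h \<in> ?B" using h \<open>0 \<le> s\<close> by simp
    then have "s + h \<le> s" unfolding s_def by (rule cSup_upper[OF _ ne(2)])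
    then show False using h by simp
  qed
  then show ?thesis using s by simp
qed

lemma tendsto_SUP_ennreal_zero:
  assumes "\<And>e::real. 0 < e \<Longrightarrow> eventually (\<lambda>x. \<forall>t\<in>B. f x t \<le> e) F"
  shows "((\<lambda>x. SUP t\<in>B. ennreal (f x t)) \<longlongrightarrow> 0) F"
proof (rule order_tendstoI)
  fix a :: ennreal assume "0 < a"
  then obtain b where b: "0 < b" "b < a" using dense by blast
  then have "b < top" by (auto simp: top_unique less_top[symmetric] dest: less_le_trans)
  then obtain e where e: "b = ennreal e" "0 \<le> e" by (cases b) auto
  then have "0 < e" using b by simp
  show "eventually (\<lambda>x. (SUP t\<in>B. ennreal (f x t)) < a) F"
    using assms[OF \<open>0 < e\<close>]
  proof eventually_elim
    case (elim x)
    have "(SUP t\<in>B. ennreal (f x t)) \<le> b"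
      unfolding e(1) by (rule SUP_least) (use elim in \<open>auto intro: ennreal_leI\<close>)
    then show ?case using b(2) by simp
  qed
qed simp

lemma (in semi_inner_space) N_add_scale_sq:
  assumes w: "w \<in> X" and q: "q \<in> X"
  shows "(N (w + h *\<^sub>R q))\<^sup>2 = (N w)\<^sup>2 + h * (2 * ip w q + h * (N q)\<^sup>2)"
proof -
  have "(N (w + h *\<^sub>R q))\<^sup>2 = ip (w + h *\<^sub>R q) (w + h *\<^sub>R q)"
    using w q by (simp add: N_sq mem)
  also have "\<dots> = ip w w + h * ip w q + (h * ip w q + h * (h * ip q q))"
    using w q ip_sym[of q w] by (simp add: mem ip_add ip_add_right ip_scale ip_scale_right distrib_left)
  finally show ?thesis using w q by (simp add: N_sq algebra_simps)
qed

text \<open>The hypothesis \<open>defect\<close> bounds, in weak form, the failure of \<open>Z - Y\<close> to be dissipated when \<open>Z\<close> follows the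
  perturbed and \<open>Y\<close> the unperturbed evolution. It compares elements of different domains.\<close>

locale contraction_semigroup_family = semi_hilbert_space +
  fixes S :: "real \<Rightarrow> real \<Rightarrow> 'a \<Rightarrow> 'a" and D :: "real \<Rightarrow> 'a set" and A :: "real \<Rightarrow> 'a \<Rightarrow> 'a"
  assumes semigroups: "\<And>\<epsilon>. \<epsilon> \<in> {0..1} \<Longrightarrow> contraction_semigroup X N ip (S \<epsilon>) (D \<epsilon>) (A \<epsilon>)"
    and defect: "\<And>R. \<exists>C\<ge>0. \<forall>\<epsilon>\<in>{0<..1}. \<forall>Z\<in>D \<epsilon>. \<forall>Y\<in>D 0. N Y \<le> R \<longrightarrow> N (A 0 Y) \<le> R \<longrightarrow>
                   ip (Z - Y) (A \<epsilon> Z - A 0 Y) \<le> \<epsilon> * C"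
begin

lemma sg: "0 < \<epsilon> \<Longrightarrow> \<epsilon> \<le> 1 \<Longrightarrow> contraction_semigroup X N ip (S \<epsilon>) (D \<epsilon>) (A \<epsilon>)"
  by (rule semigroups) auto

sublocale S0: contraction_semigroup X N ip "S 0" "D 0" "A 0"
  by (rule semigroups) auto

text \<open>Both orbits stay in their domains, where they have right derivatives. The right derivative of the squared
  distance is twice the left-hand side of the defect inequality, which stays available with the same \<open>R\<close> because
  the graph norm does not increase along \<open>S 0\<close>.\<close>

lemma distance_growth:
  assumes eps: "0 < \<epsilon>" "\<epsilon> \<le> 1" and Z: "Z \<in> D \<epsilon>" and Y: "Y \<in> D 0" and T: "0 \<le> T"
    and C: "\<And>U P. U \<in> D \<epsilon> \<Longrightarrow> P \<in> D 0 \<Longrightarrow> N P \<le> R \<Longrightarrow> N (A 0 P) \<le> R \<Longrightarrow> ip (U - P) (A \<epsilon> U - A 0 P) \<le> c"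
    and R: "N Y \<le> R" "N (A 0 Y) \<le> R"
  shows "(N (S \<epsilon> T Z - S 0 T Y))\<^sup>2 \<le> (N (Z - Y))\<^sup>2 + 2 * c * T"
proof -
  interpret Se: contraction_semigroup X N ip "S \<epsilon>" "D \<epsilon>" "A \<epsilon>" by (rule sg[OF eps])
  note ZX = Se.D_mem[OF Z] and YX = S0.D_mem[OF Y]
  \<comment> \<open>the absolute values keep the times admissible in limits along neighbourhood filters of the real line\<close>
  define \<phi> where "\<phi> t = (N (S \<epsilon> \<bar>t\<bar> Z - S 0 \<bar>t\<bar> Y))\<^sup>2" for t
  have mS: "S \<epsilon> \<bar>t\<bar> Z \<in> X" "S 0 \<bar>t\<bar> Y \<in> X" for t by (auto intro!: Se.S_mem S0.S_mem ZX YX)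
  have cont: "continuous_on {0..T} \<phi>"
    unfolding continuous_on_def \<phi>_def
  proof (intro ballI tendsto_power N_tendsto diff_mem mS)
    fix t
    let ?F = "at t within {0..T}"
    have "((\<lambda>s. N (S \<epsilon> \<bar>s\<bar> Z - S \<epsilon> \<bar>t\<bar> Z) + N (S 0 \<bar>s\<bar> Y - S 0 \<bar>t\<bar> Y)) \<longlongrightarrow> 0 + 0) ?F"
      by (intro tendsto_add Se.S_tendsto S0.S_tendsto ZX YX tendsto_rabs tendsto_ident_at) auto
    moreover have "norm (N ((S \<epsilon> \<bar>s\<bar> Z - S 0 \<bar>s\<bar> Y) - (S \<epsilon> \<bar>t\<bar> Z - S 0 \<bar>t\<bar> Y)))
        \<le> N (S \<epsilon> \<bar>s\<bar> Z - S \<epsilon> \<bar>t\<bar> Z) + N (S 0 \<bar>s\<bar> Y - S 0 \<bar>t\<bar> Y)" for s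
    proof -
      have eq: "(S \<epsilon> \<bar>s\<bar> Z - S 0 \<bar>s\<bar> Y) - (S \<epsilon> \<bar>t\<bar> Z - S 0 \<bar>t\<bar> Y)
          = (S \<epsilon> \<bar>s\<bar> Z - S \<epsilon> \<bar>t\<bar> Z) - (S 0 \<bar>s\<bar> Y - S 0 \<bar>t\<bar> Y)" by simp
      show ?thesis
        unfolding eq using N_triangle_diff[of "S \<epsilon> \<bar>s\<bar> Z - S \<epsilon> \<bar>t\<bar> Z" "S 0 \<bar>s\<bar> Y - S 0 \<bar>t\<bar> Y"] mS
        by (simp add: mem N_nonneg)
    qed
    ultimately show "((\<lambda>s. N ((S \<epsilon> \<bar>s\<bar> Z - S 0 \<bar>s\<bar> Y) - (S \<epsilon> \<bar>t\<bar> Z - S 0 \<bar>t\<bar> Y))) \<longlongrightarrow> 0) ?F"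
      by (rule tendsto_zero_le) simp
  qed
  have dini: "eventually (\<lambda>h. \<phi> (t + h) \<le> \<phi> t + (2 * c + \<eta>) * h) (at_right 0)" if t: "0 \<le> t" and \<eta>: "0 < \<eta>" for t \<eta>
  proof -
    define U where "U = S \<epsilon> t Z"
    define P where "P = S 0 t Y"
    have UD: "U \<in> D \<epsilon>" unfolding U_def by (rule Se.D_invariant[OF Z t])
    have PD: "P \<in> D 0" unfolding P_def by (rule S0.D_invariant[OF Y t])
    have UX: "U \<in> X" and PX: "P \<in> X" using Se.D_mem[OF UD] S0.D_mem[OF PD] .
    note AU = Se.A_mem[OF UD] and AP = S0.A_mem[OF PD]
    have "N P \<le> R" using S0.S_contr[OF t YX] R by (simp add: P_def)
    moreover have "N (A 0 P) \<le> R"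
      using N_cong[OF AP S0.S_mem[OF t S0.A_mem[OF Y]]] S0.D_invariant(2)[OF Y t] S0.S_contr[OF t S0.A_mem[OF Y]] R
      by (simp add: P_def)
    ultimately have neg: "ip (U - P) (A \<epsilon> U - A 0 P) \<le> c" by (rule C[OF UD PD])
    define q where "q h = (1 / h) *\<^sub>R (S \<epsilon> \<bar>h\<bar> U - U) - (1 / h) *\<^sub>R (S 0 \<bar>h\<bar> P - P)" for h
    have qX: "q h \<in> X" for h
      by (auto simp: q_def intro!: mem Se.S_mem S0.S_mem UX PX)
    have pos: "eventually (\<lambda>h::real. 0 < h) (at_right 0)" by (rule eventually_at_right_less)
    have "((\<lambda>h. N (q h - (A \<epsilon> U - A 0 P))) \<longlongrightarrow> 0) (at_right 0)"
    proof (rule tendsto_sandwich[OF _ _ tendsto_const])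
      show "((\<lambda>h. N ((1 / h) *\<^sub>R (S \<epsilon> h U - U) - A \<epsilon> U) + N ((1 / h) *\<^sub>R (S 0 h P - P) - A 0 P)) \<longlongrightarrow> 0) (at_right 0)"
        using tendsto_add[OF Se.generator_limit[OF UD] S0.generator_limit[OF PD]] by simp
      show "eventually (\<lambda>h. N (q h - (A \<epsilon> U - A 0 P)) \<le> N ((1 / h) *\<^sub>R (S \<epsilon> h U - U) - A \<epsilon> U) + N ((1 / h) *\<^sub>R (S 0 h P - P) - A 0 P)) (at_right 0)"
        using pos
      proof eventually_elim
        case (elim h)
        have eq: "q h - (A \<epsilon> U - A 0 P) = ((1 / h) *\<^sub>R (S \<epsilon> h U - U) - A \<epsilon> U) - ((1 / h) *\<^sub>R (S 0 h P - P) - A 0 P)"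
          using elim by (simp add: q_def)
        show ?case
          unfolding eq using N_triangle_diff[of "(1 / h) *\<^sub>R (S \<epsilon> h U - U) - A \<epsilon> U" "(1 / h) *\<^sub>R (S 0 h P - P) - A 0 P"]
            elim AU AP UX PX by (simp add: mem Se.S_mem S0.S_mem)
      qed
    qed (auto intro!: always_eventually N_nonneg mem qX AU AP)
    then have "((\<lambda>h. ip (U - P) (q h)) \<longlongrightarrow> ip (U - P) (A \<epsilon> U - A 0 P)) (at_right 0)"
      "((\<lambda>h. N (q h)) \<longlongrightarrow> N (A \<epsilon> U - A 0 P)) (at_right 0)"
      using qX AU AP UX PX by (auto intro!: ip_tendsto N_tendsto mem simp: N_zero)
    then have "((\<lambda>h. 2 * ip (U - P) (q h) + h * (N (q h))\<^sup>2) \<longlongrightarrow>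
        2 * ip (U - P) (A \<epsilon> U - A 0 P) + 0 * (N (A \<epsilon> U - A 0 P))\<^sup>2) (at_right 0)"
      by (intro tendsto_intros)
    moreover have "2 * ip (U - P) (A \<epsilon> U - A 0 P) + 0 * (N (A \<epsilon> U - A 0 P))\<^sup>2 < 2 * c + \<eta>"
      using neg \<eta> by simp
    ultimately have "eventually (\<lambda>h. 2 * ip (U - P) (q h) + h * (N (q h))\<^sup>2 < 2 * c + \<eta>) (at_right 0)"
      by (rule order_tendstoD)
    then show ?thesis using pos
    proof eventually_elim
      case (elim h)
      then have h: "0 < h" by simp
      have m: "S \<epsilon> h U \<in> X" "S 0 h P \<in> X" "S \<epsilon> (h + t) Z \<in> X" "S 0 (h + t) Y \<in> X"
        using h t UX PX ZX YX by (auto intro!: Se.S_mem S0.S_mem)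
      have "N ((S \<epsilon> (h + t) Z - S 0 (h + t) Y) - (S \<epsilon> h U - S 0 h P)) = 0"
      proof -
        have eq: "(S \<epsilon> (h + t) Z - S 0 (h + t) Y) - (S \<epsilon> h U - S 0 h P)
          = (S \<epsilon> (h + t) Z - S \<epsilon> h U) - (S 0 (h + t) Y - S 0 h P)" by simp
        show ?thesis
          unfolding eq using N_triangle_diff[of "S \<epsilon> (h + t) Z - S \<epsilon> h U" "S 0 (h + t) Y - S 0 h P"]
            Se.S_add[of h t Z] S0.S_add[of h t Y] h t ZX YX m
            N_nonneg[of "(S \<epsilon> (h + t) Z - S \<epsilon> h U) - (S 0 (h + t) Y - S 0 h P)"]
          by (simp add: U_def P_def mem)
      qed
      then have "N (S \<epsilon> (h + t) Z - S 0 (h + t) Y) = N (S \<epsilon> h U - S 0 h P)"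
        by (intro N_cong mem m)
      moreover have "S \<epsilon> h U - S 0 h P = (U - P) + h *\<^sub>R q h"
        using h by (simp add: q_def scaleR_diff_right)
      ultimately have "\<phi> (t + h) = (N ((U - P) + h *\<^sub>R q h))\<^sup>2"
        using h t by (simp add: \<phi>_def add.commute)
      also have "\<dots> = \<phi> t + h * (2 * ip (U - P) (q h) + h * (N (q h))\<^sup>2)"
        using t by (simp add: N_add_scale_sq[OF diff_mem[OF UX PX] qX] \<phi>_def flip: U_def P_def)
      also have "\<dots> \<le> \<phi> t + h * (2 * c + \<eta>)" using elim by (intro add_left_mono mult_left_mono) auto
      finally show ?case by (simp add: mult.commute)
    qed
  qed
  have "\<phi> T \<le> \<phi> 0 + 2 * c * T"
  proof (rule field_le_epsilon)
    fix e :: real assume e: "0 < e"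
    define \<eta> where "\<eta> = e / (T + 1)"
    have \<eta>: "0 < \<eta>" "\<eta> * T \<le> e" using e T by (auto simp: \<eta>_def field_simps)
    have "\<phi> T \<le> \<phi> 0 + (2 * c + \<eta>) * T"
      by (rule le_of_right_dini_le[OF T cont]) (rule dini[OF _ \<eta>(1)])
    then show "\<phi> T \<le> \<phi> 0 + 2 * c * T + e" using \<eta> by (simp add: algebra_simps)
  qed
  moreover have "\<phi> 0 = (N (Z - Y))\<^sup>2"
  proof -
    have "N ((S \<epsilon> 0 Z - S 0 0 Y) - (Z - Y)) = 0"
    proof -
      have eq: "(S \<epsilon> 0 Z - S 0 0 Y) - (Z - Y) = (S \<epsilon> 0 Z - Z) - (S 0 0 Y - Y)" by simp
      show ?thesis
        unfolding eq using N_triangle_diff[of "S \<epsilon> 0 Z - Z" "S 0 0 Y - Y"] Se.S_0[OF ZX] S0.S_0[OF YX] mS[of 0] ZX YX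
          N_nonneg[of "(S \<epsilon> 0 Z - Z) - (S 0 0 Y - Y)"] by (simp add: mem)
    qed
    then have "N (S \<epsilon> 0 Z - S 0 0 Y) = N (Z - Y)"
      using mS[of 0] ZX YX by (intro N_cong mem) auto
    then show ?thesis by (simp add: \<phi>_def)
  qed
  ultimately show ?thesis using T by (simp add: \<phi>_def)
qed

text \<open>The initial value is approximated separately in \<open>D 0\<close> and, for each \<open>\<epsilon>\<close>, in \<open>D \<epsilon>\<close>. The constant in the
  growth estimate depends only on the former, which is chosen first.\<close>

theorem strong_convergence:
  assumes x: "x \<in> X" and T: "0 \<le> T" and e: "0 < e"
  shows "eventually (\<lambda>\<epsilon>. \<forall>t\<in>{0..T}. N (S \<epsilon> t x - S 0 t x) \<le> e) (at_right 0)"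
proof -
  have e8: "0 < e / 8" using e by simp
  obtain Y where Y: "Y \<in> D 0" "N (Y - x) < e / 8" by (rule S0.D_dense[OF x e8])
  note YX = S0.D_mem[OF Y(1)]
  define R where "R = max (N Y) (N (A 0 Y))"
  obtain C where C: "0 \<le> C" "\<And>\<epsilon> Z P. \<epsilon> \<in> {0<..1} \<Longrightarrow> Z \<in> D \<epsilon> \<Longrightarrow> P \<in> D 0 \<Longrightarrow> N P \<le> R \<Longrightarrow> N (A 0 P) \<le> R \<Longrightarrow>
      ip (Z - P) (A \<epsilon> Z - A 0 P) \<le> \<epsilon> * C"
    using defect[of R] by blast
  \<comment> \<open>for \<open>\<epsilon> < d\<close> the growth term \<open>2 \<epsilon> C T\<close> is at most \<open>(e / 4)\<^sup>2\<close>\<close>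
  define d where "d = min 1 ((e / 4)\<^sup>2 / (2 * C * T + 1))"
  have d: "0 < d" using e C(1) T by (auto simp: d_def intro!: divide_pos_pos add_nonneg_pos mult_nonneg_nonneg)
  have "N (S \<epsilon> t x - S 0 t x) \<le> e" if eps: "0 < \<epsilon>" "\<epsilon> < d" and t: "t \<in> {0..T}" for \<epsilon> t
  proof -
    have eps1: "\<epsilon> \<le> 1" using eps by (simp add: d_def)
    interpret Se: contraction_semigroup X N ip "S \<epsilon>" "D \<epsilon>" "A \<epsilon>" by (rule sg[OF eps(1) eps1])
    obtain Z where Z: "Z \<in> D \<epsilon>" "N (Z - x) < e / 8" by (rule Se.D_dense[OF x e8])
    note ZX = Se.D_mem[OF Z(1)]
    have t0: "0 \<le> t" using t by simp
    have ZY: "N (Z - Y) \<le> e / 4"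
      using N_diff_triangle[OF ZX x YX] Z(2) Y(2) N_minus_commute[OF x YX] by simp
    have "(N (S \<epsilon> t Z - S 0 t Y))\<^sup>2 \<le> (N (Z - Y))\<^sup>2 + 2 * (\<epsilon> * C) * t"
      by (rule distance_growth[OF eps(1) eps1 Z(1) Y(1) t0, where R=R])
         (use C eps eps1 in \<open>auto simp: R_def\<close>)
    also have "\<dots> \<le> (e / 4)\<^sup>2 + (e / 4)\<^sup>2"
    proof (rule add_mono)
      show "(N (Z - Y))\<^sup>2 \<le> (e / 4)\<^sup>2" using ZY N_nonneg[OF diff_mem[OF ZX YX]] by (rule power_mono)
      have "2 * (\<epsilon> * C) * t \<le> 2 * (\<epsilon> * C) * T" using eps C t by (intro mult_left_mono) auto
      also have "\<dots> \<le> \<epsilon> * (2 * C * T + 1)" using eps by (simp add: algebra_simps)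
      also have "\<dots> \<le> ((e / 4)\<^sup>2 / (2 * C * T + 1)) * (2 * C * T + 1)"
        using eps C T by (intro mult_right_mono) (auto simp: d_def)
      also have "\<dots> = (e / 4)\<^sup>2"
        using C T by (simp add: add_nonneg_eq_0_iff)
      finally show "2 * (\<epsilon> * C) * t \<le> (e / 4)\<^sup>2" .
    qed
    also have "\<dots> \<le> (e / 2)\<^sup>2" by (simp add: power2_eq_square)
    finally have mid: "N (S \<epsilon> t Z - S 0 t Y) \<le> e / 2" by (rule power2_le_imp_le) (use e in simp)
    have m: "S \<epsilon> t x \<in> X" "S \<epsilon> t Z \<in> X" "S 0 t Y \<in> X" "S 0 t x \<in> X"
      using t0 x ZX YX by (auto intro!: Se.S_mem S0.S_mem)
    have "N (S \<epsilon> t x - S 0 t x) \<le> N (S \<epsilon> t x - S \<epsilon> t Z) + N (S \<epsilon> t Z - S 0 t x)"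
      "N (S \<epsilon> t Z - S 0 t x) \<le> N (S \<epsilon> t Z - S 0 t Y) + N (S 0 t Y - S 0 t x)"
      by (intro N_diff_triangle m)+
    moreover have "N (S \<epsilon> t x - S \<epsilon> t Z) \<le> e / 8"
      using Se.S_diff_le[OF t0 x ZX] N_minus_commute[OF x ZX] Z(2) by simp
    moreover have "N (S 0 t Y - S 0 t x) \<le> e / 8" using S0.S_diff_le[OF t0 YX x] Y(2) by simp
    ultimately show ?thesis using mid e by simp
  qed
  then show ?thesis using d by (auto simp: eventually_at_right_field intro!: exI[of _ d])
qed

text \<open>Once the forcing of the limit problem is replaced by a simple function, the two convolutions differ by an
  integral of differences of orbits of finitely many vectors, which tend to zero uniformly on \<open>[0, T]\<close>.\<close>

theorem mild_convergence:
  assumes x: "\<And>\<epsilon>. \<epsilon> \<in> {0..1} \<Longrightarrow> x \<epsilon> \<in> X" "((\<lambda>\<epsilon>. N (x \<epsilon> - x 0)) \<longlongrightarrow> 0) (at_right 0)"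
    and g: "\<And>\<epsilon>. \<epsilon> \<in> {0..1} \<Longrightarrow> S0.forcing T (g \<epsilon>)"
    and lim: "((\<lambda>\<epsilon>. \<integral>\<^sup>+s. ennreal (N (g \<epsilon> s - g 0 s)) \<partial>lebesgue_on {0<..<T}) \<longlongrightarrow> 0) (at_right 0)"
    and T: "0 \<le> T" and e: "0 < e"
  shows "eventually (\<lambda>\<epsilon>. \<forall>t\<in>{0..T}. N (mild_solution X N (S \<epsilon>) (x \<epsilon>) (g \<epsilon>) t - mild_solution X N (S 0) (x 0) (g 0) t) \<le> e) (at_right 0)"
proof -
  have x0: "x 0 \<in> X" and g0: "S0.forcing T (g 0)" using x g by auto
  have e8: "0 < e / 8" using e by simp
  obtain f where f: "simple_function (lebesgue_on {0<..<T}) f" "\<And>t. t \<in> {0<..<T} \<Longrightarrow> f t \<in> X" "S0.forcing T f"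
    "(\<integral>\<^sup>+s. ennreal (N (g 0 s - f s)) \<partial>lebesgue_on {0<..<T}) < ennreal (e / 8)"
    by (rule S0.forcing_approx[OF g0 e8]) (rule that)
  define m where "m = e / (8 * (T + 1))"
  have m: "0 < m" "m * T \<le> e / 8" using e T by (auto simp: m_def field_simps)
  have fin: "finite (f ` {0<..<T})" using simple_functionD(1)[OF f(1)] by simp
  have "eventually (\<lambda>\<epsilon>. \<forall>y\<in>f ` {0<..<T}. \<forall>t\<in>{0..T}. N (S \<epsilon> t y - S 0 t y) \<le> m) (at_right 0)"
    using fin f(2) by (auto simp only: eventually_ball_finite_distrib intro!: strong_convergence T m)
  moreover have "eventually (\<lambda>\<epsilon>. \<forall>t\<in>{0..T}. N (S \<epsilon> t (x 0) - S 0 t (x 0)) \<le> e / 8) (at_right 0)"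
    by (rule strong_convergence[OF x0 T e8])
  moreover have "eventually (\<lambda>\<epsilon>. N (x \<epsilon> - x 0) < e / 8) (at_right 0)"
    using x(2) e8 by (rule order_tendstoD)
  moreover have "eventually (\<lambda>\<epsilon>. (\<integral>\<^sup>+s. ennreal (N (g \<epsilon> s - g 0 s)) \<partial>lebesgue_on {0<..<T}) < ennreal (e / 8)) (at_right 0)"
    using lim e8 by (intro order_tendstoD) auto
  moreover have "eventually (\<lambda>\<epsilon>::real. 0 < \<epsilon> \<and> \<epsilon> < 1) (at_right 0)"
    by (auto simp: eventually_at_right_field intro!: exI[of _ 1])
  ultimately show ?thesis
  proof eventually_elim
    case (elim \<epsilon>)
    then have eps: "0 < \<epsilon>" "\<epsilon> \<le> 1" and epsI: "\<epsilon> \<in> {0..1}" by auto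
    interpret Se: contraction_semigroup X N ip "S \<epsilon>" "D \<epsilon>" "A \<epsilon>" by (rule sg[OF eps])
    note xe = x(1)[OF epsI] and ge = g[OF epsI]
    show ?case
    proof
      fix t assume t: "t \<in> {0..T}"
      then have t0: "0 \<le> t" and tT: "t \<le> T" by auto
      note mc = Se.convolution_mem[OF ge tT] Se.convolution_mem[OF f(3) tT] S0.convolution_mem[OF f(3) tT] S0.convolution_mem[OF g0 tT]
      have gf: "(\<integral>\<^sup>+s. ennreal (N (g \<epsilon> s - f s)) \<partial>lebesgue_on {0<..<T}) \<le> ennreal (e / 4)"
      proof -
        let ?M = "lebesgue_on {0<..<T}"
        have sm: "strongly_measurable X N ?M (g \<epsilon>)" "strongly_measurable X N ?M (g 0)" "strongly_measurable X N ?M f"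
          using ge g0 f(3) by (auto simp: S0.forcing_def)
        have "(\<integral>\<^sup>+s. ennreal (N (g \<epsilon> s - f s)) \<partial>?M)
            \<le> (\<integral>\<^sup>+s. ennreal (N (g \<epsilon> s - g 0 s)) + ennreal (N (g 0 s - f s)) \<partial>?M)"
        proof (rule nn_integral_mono)
          fix s assume "s \<in> space ?M"
          then have "g \<epsilon> s \<in> X" "g 0 s \<in> X" "f s \<in> X" by (auto intro!: strongly_measurable_mem[OF sm(1)] strongly_measurable_mem[OF sm(2)] f(2))
          then show "ennreal (N (g \<epsilon> s - f s)) \<le> ennreal (N (g \<epsilon> s - g 0 s)) + ennreal (N (g 0 s - f s))"
            by (simp add: N_nonneg mem N_diff_triangle flip: ennreal_plus)
        qed
        also have "\<dots> = (\<integral>\<^sup>+s. ennreal (N (g \<epsilon> s - g 0 s)) + ennreal (N (g 0 s - f s)) \<partial>completion ?M)"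
          by (simp only: nn_integral_completion)
        also have "\<dots> = (\<integral>\<^sup>+s. ennreal (N (g \<epsilon> s - g 0 s)) \<partial>completion ?M) + (\<integral>\<^sup>+s. ennreal (N (g 0 s - f s)) \<partial>completion ?M)"
          by (intro nn_integral_add measurable_compose[OF _ measurable_ennreal] borel_measurable_N strongly_measurable_diff sm)
        also have "\<dots> \<le> ennreal (e / 8) + ennreal (e / 8)"
          unfolding nn_integral_completion using elim f(4) by (intro add_mono less_imp_le) auto
        also have "\<dots> = ennreal (e / 4)" using e by (simp flip: ennreal_plus)
        finally show ?thesis .
      qed
      have 1: "N (Se.convolution (g \<epsilon>) t - Se.convolution f t) \<le> e / 4"
        using order_trans[OF Se.convolution_diff_le[OF ge f(3) tT] gf] e by (simp add: ennreal_le_iff)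
      have "ennreal (N (Se.convolution f t - S0.convolution f t))
          \<le> (\<integral>\<^sup>+s. ennreal (N (S \<epsilon> (t - s) (f s) - S 0 (t - s) (f s))) \<partial>lebesgue_on {0<..<t})"
        by (intro weak_int_norm_le weak_int_diff Se.weak_int_convolution[OF f(3) tT] S0.weak_int_convolution[OF f(3) tT])
      also have "\<dots> \<le> (\<integral>\<^sup>+s. ennreal m \<partial>lebesgue_on {0<..<T})"
        using tT elim by (intro nn_integral_lebesgue_on_mono ennreal_leI) auto
      also have "\<dots> = ennreal (m * T)" using T m by (subst nn_integral_Ioo_const) auto
      finally have 2: "N (Se.convolution f t - S0.convolution f t) \<le> e / 8"
        using m T by (subst (asm) ennreal_le_iff) auto
      have 3: "N (S0.convolution f t - S0.convolution (g 0) t) \<le> e / 8"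
      proof -
        have "ennreal (N (S0.convolution (g 0) t - S0.convolution f t)) \<le> ennreal (e / 8)"
          using S0.convolution_diff_le[OF g0 f(3) tT] f(4) by (intro less_imp_le) (rule order_le_less_trans)
        then show ?thesis using e N_minus_commute[OF mc(4,3)] by (simp add: ennreal_le_iff)
      qed
      have conv: "N (Se.convolution (g \<epsilon>) t - S0.convolution (g 0) t) \<le> e / 2"
        using 1 2 3 N_diff_triangle[OF mc(1,2,4)] N_diff_triangle[OF mc(2,3,4)] by simp
      have ms: "S \<epsilon> t (x \<epsilon>) \<in> X" "S \<epsilon> t (x 0) \<in> X" "S 0 t (x 0) \<in> X"
        using t0 xe x0 by (auto intro!: Se.S_mem S0.S_mem)
      have orb: "N (S \<epsilon> t (x \<epsilon>) - S 0 t (x 0)) \<le> e / 4"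
        using N_diff_triangle[OF ms] Se.S_diff_le[OF t0 xe x0] elim t by force
      have eq: "mild_solution X N (S \<epsilon>) (x \<epsilon>) (g \<epsilon>) t - mild_solution X N (S 0) (x 0) (g 0) t
          = (S \<epsilon> t (x \<epsilon>) - S 0 t (x 0)) + (Se.convolution (g \<epsilon>) t - S0.convolution (g 0) t)"
        by (simp add: Se.mild_solution_eq S0.mild_solution_eq)
      show "N (mild_solution X N (S \<epsilon>) (x \<epsilon>) (g \<epsilon>) t - mild_solution X N (S 0) (x 0) (g 0) t) \<le> e"
        unfolding eq using N_triangle[of "S \<epsilon> t (x \<epsilon>) - S 0 t (x 0)" "Se.convolution (g \<epsilon>) t - S0.convolution (g 0) t"] orb conv e ms mc
        by (simp add: mem)
    qed
  qed
qed

end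

section \<open>The space \<open>L\<^sup>2\<close>\<close>

lemma (in semi_inner_space) rapid_dist:
  assumes s: "\<And>n. s n \<in> X" "\<And>n. N (s (Suc n) - s n) \<le> (1/2)^n"
  shows "N (s (n + k) - s n) \<le> 2 * (1/2)^n"
proof -
  have "N (s (n + k) - s n) \<le> 2 * (1/2)^n - 2 * (1/2)^(n + k)"
  proof (induction k)
    case (Suc k)
    have "N (s (n + Suc k) - s n) \<le> N (s (Suc (n + k)) - s (n + k)) + N (s (n + k) - s n)"
      using N_diff_triangle[of "s (Suc (n + k))" "s (n + k)" "s n"] s(1) by simp
    also have "\<dots> \<le> (1/2)^(n + k) + (2 * (1/2)^n - 2 * (1/2)^(n + k))"
      using Suc s(2)[of "n + k"] by linarith
    finally show ?case by simp
  qed (simp add: N_zero)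
  also have "\<dots> \<le> 2 * (1/2)^n" by simp
  finally show ?thesis .
qed

lemma convergent_of_summable_norm:
  fixes s :: "nat \<Rightarrow> 'b::banach"
  assumes "summable (\<lambda>n. norm (s (Suc n) - s n))"
  shows "convergent s"
proof -
  have "summable (\<lambda>n. s (Suc n) - s n)" by (rule summable_norm_cancel[OF assms])
  then have "(\<lambda>n. \<Sum>k<n. s (Suc k) - s k) \<longlonglongrightarrow> (\<Sum>k. s (Suc k) - s k)" by (rule summable_LIMSEQ)
  then have "(\<lambda>n. (s n - s 0) + s 0) \<longlonglongrightarrow> (\<Sum>k. s (Suc k) - s k) + s 0"
    unfolding sum_lessThan_telescope by (intro tendsto_add tendsto_const)
  then show ?thesis by (auto simp: convergent_def)
qed

definition L2_inner :: "(real^'d) set \<Rightarrow> (real^'d \<Rightarrow> 'b::euclidean_space) \<Rightarrow> (real^'d \<Rightarrow> 'b) \<Rightarrow> real" where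
  "L2_inner \<Omega> f g = (\<integral>x. f x \<bullet> g x \<partial>lebesgue_on \<Omega>)"

lemma L2D: "f \<in> L2 \<Omega> \<Longrightarrow> f \<in> borel_measurable (lebesgue_on \<Omega>)"
  "f \<in> L2 \<Omega> \<Longrightarrow> integrable (lebesgue_on \<Omega>) (\<lambda>x. (norm (f x))\<^sup>2)"
  by (auto simp: L2_def)

lemma integrable_L2_inner:
  fixes f g :: "real^'d \<Rightarrow> 'b::euclidean_space"
  assumes f: "f \<in> L2 \<Omega>" and g: "g \<in> L2 \<Omega>"
  shows "integrable (lebesgue_on \<Omega>) (\<lambda>x. f x \<bullet> g x)"
proof (rule Bochner_Integration.integrable_bound)
  show "integrable (lebesgue_on \<Omega>) (\<lambda>x. (norm (f x))\<^sup>2 + (norm (g x))\<^sup>2)"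
    using L2D(2)[OF f] L2D(2)[OF g] by simp
  show "(\<lambda>x. f x \<bullet> g x) \<in> borel_measurable (lebesgue_on \<Omega>)"
    using L2D(1)[OF f] L2D(1)[OF g] by measurable
  have "norm (f x \<bullet> g x) \<le> norm ((norm (f x))\<^sup>2 + (norm (g x))\<^sup>2)" for x
  proof -
    have "\<bar>f x \<bullet> g x\<bar> \<le> norm (f x) * norm (g x)" by (rule Cauchy_Schwarz_ineq2)
    also have "\<dots> \<le> (norm (f x))\<^sup>2 + (norm (g x))\<^sup>2"
      using sum_squares_bound[of "norm (f x)" "norm (g x)"]
        mult_nonneg_nonneg[OF norm_ge_zero[of "f x"] norm_ge_zero[of "g x"]]
      unfolding mult.assoc by linarith
    finally show ?thesis by simp
  qed
  then show "AE x in lebesgue_on \<Omega>. norm (f x \<bullet> g x) \<le> norm ((norm (f x))\<^sup>2 + (norm (g x))\<^sup>2)" by simp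
qed

lemma semi_inner_space_L2:
  "semi_inner_space (L2 \<Omega> :: (real^'d \<Rightarrow> 'b::euclidean_space) set) (L2_norm \<Omega>) (L2_inner \<Omega>)"
proof
  show "(0 :: real^'d \<Rightarrow> 'b) \<in> L2 \<Omega>" by (simp add: L2_def zero_fun_def)
  show "a *\<^sub>R f + b *\<^sub>R g \<in> L2 \<Omega>" if f: "f \<in> L2 \<Omega>" and g: "g \<in> L2 \<Omega>" for f g :: "real^'d \<Rightarrow> 'b" and a b
  proof -
    have eq: "(norm ((a *\<^sub>R f + b *\<^sub>R g) x))\<^sup>2 = a\<^sup>2 * (norm (f x))\<^sup>2 + 2 * a * b * (f x \<bullet> g x) + b\<^sup>2 * (norm (g x))\<^sup>2" for x
      unfolding power2_norm_eq_inner
      by (simp add: inner_add_left inner_add_right inner_commute[of "g x" "f x"] power2_eq_square algebra_simps)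
    have "integrable (lebesgue_on \<Omega>) (\<lambda>x. (norm ((a *\<^sub>R f + b *\<^sub>R g) x))\<^sup>2)"
      unfolding eq using L2D(2)[OF f] L2D(2)[OF g] integrable_L2_inner[OF f g] by simp
    moreover have "a *\<^sub>R f + b *\<^sub>R g \<in> borel_measurable (lebesgue_on \<Omega>)"
      using L2D(1)[OF f] L2D(1)[OF g] by (simp add: plus_fun_def scaleR_fun_def)
    ultimately show ?thesis by (simp add: L2_def)
  qed
  show "L2_inner \<Omega> f g = L2_inner \<Omega> g f" for f g :: "real^'d \<Rightarrow> 'b"
    by (simp add: L2_inner_def inner_commute)
  show "L2_inner \<Omega> (a *\<^sub>R f + b *\<^sub>R g) h = a * L2_inner \<Omega> f h + b * L2_inner \<Omega> g h"
    if "f \<in> L2 \<Omega>" "g \<in> L2 \<Omega>" "h \<in> L2 \<Omega>" for f g h :: "real^'d \<Rightarrow> 'b" and a b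
    using integrable_L2_inner[OF that(1,3)] integrable_L2_inner[OF that(2,3)]
    by (simp add: L2_inner_def inner_add_left)
  show "0 \<le> L2_inner \<Omega> f f" for f :: "real^'d \<Rightarrow> 'b" by (simp add: L2_inner_def)
  show "L2_norm \<Omega> f = sqrt (L2_inner \<Omega> f f)" for f :: "real^'d \<Rightarrow> 'b"
    by (simp add: L2_norm_def L2_inner_def power2_norm_eq_inner)
qed

lemma nn_integral_L2:
  assumes "f \<in> L2 \<Omega>"
  shows "(\<integral>\<^sup>+x. ennreal ((norm (f x))\<^sup>2) \<partial>lebesgue_on \<Omega>) = ennreal ((L2_norm \<Omega> f)\<^sup>2)"
  using L2D(2)[OF assms] by (subst nn_integral_eq_integral) (auto simp: L2_norm_def)

lemma L2I_nn_integral: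
  assumes "f \<in> borel_measurable (lebesgue_on \<Omega>)"
    "(\<integral>\<^sup>+x. ennreal ((norm (f x))\<^sup>2) \<partial>lebesgue_on \<Omega>) \<le> ennreal (c\<^sup>2)" "0 \<le> c"
  shows "f \<in> L2 \<Omega>" "L2_norm \<Omega> f \<le> c"
proof -
  have "integrable (lebesgue_on \<Omega>) (\<lambda>x. (norm (f x))\<^sup>2)"
    using assms by (intro integrableI_bounded) (auto intro: le_less_trans)
  then show f: "f \<in> L2 \<Omega>" using assms by (simp add: L2_def)
  have "(L2_norm \<Omega> f)\<^sup>2 \<le> c\<^sup>2" using assms(2) unfolding nn_integral_L2[OF f] by (simp add: ennreal_le_iff)
  then show "L2_norm \<Omega> f \<le> c" using assms(3) by (rule power2_le_imp_le)
qed

text \<open>Riesz--Fischer: a sequence converging at a geometric rate converges almost everywhere, and Fatou's lemma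
  turns the pointwise limit into a limit in norm.\<close>

lemma semi_hilbert_space_L2:
  assumes \<Omega>: "bounded \<Omega>" "\<Omega> \<in> sets lebesgue"
  shows "semi_hilbert_space (L2 \<Omega> :: (real^'d \<Rightarrow> 'b::euclidean_space) set) (L2_norm \<Omega>) (L2_inner \<Omega>)"
proof -
  interpret semi_inner_space "L2 \<Omega> :: (real^'d \<Rightarrow> 'b) set" "L2_norm \<Omega>" "L2_inner \<Omega>" by (rule semi_inner_space_L2)
  let ?M = "lebesgue_on \<Omega>"
  show ?thesis
  proof
    fix s :: "nat \<Rightarrow> real^'d \<Rightarrow> 'b"
    assume s: "\<And>n. s n \<in> L2 \<Omega>" "\<And>n. L2_norm \<Omega> (s (Suc n) - s n) \<le> (1/2)^n"
    have sq: "(\<integral>\<^sup>+x. ennreal ((norm (s (n + k) x - s n x))\<^sup>2) \<partial>?M) \<le> ennreal ((2 * (1/2)^n)\<^sup>2)" for n k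
    proof -
      have "(\<integral>\<^sup>+x. ennreal ((norm (s (n + k) x - s n x))\<^sup>2) \<partial>?M) = ennreal ((L2_norm \<Omega> (s (n + k) - s n))\<^sup>2)"
        using nn_integral_L2[OF diff_mem[OF s(1) s(1)]] by simp
      also have "\<dots> \<le> ennreal ((2 * (1/2)^n)\<^sup>2)"
        by (intro ennreal_leI power_mono rapid_dist s N_nonneg mem)
      finally show ?thesis .
    qed
    have "AE x in ?M. summable (\<lambda>n. norm (s (Suc n) x - s n x))"
    proof (rule AE_summable_of_rapid[OF finite_measure_lebesgue_on[OF \<Omega>], where C=4])
      fix n
      show "(\<lambda>x. norm (s (Suc n) x - s n x)) \<in> borel_measurable (completion ?M)"
        using L2D(1)[OF s(1)] by (intro measurable_completion) measurable
      show "(\<integral>\<^sup>+x. ennreal ((norm (s (Suc n) x - s n x))\<^sup>2) \<partial>?M) \<le> ennreal (4 * (1/4)^n)"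
        using sq[of n 1] by (simp add: power_mult_distrib power2_eq_square flip: power_mult_distrib)
    qed auto
    then have lim: "AE x in ?M. (\<lambda>n. s n x) \<longlonglongrightarrow> lim (\<lambda>n. s n x)"
      by eventually_elim (intro convergent_of_summable_norm convergent_LIMSEQ_iff[THEN iffD1])
    define f where "f x = lim (\<lambda>n. s n x)" for x
    have fm: "f \<in> borel_measurable ?M"
      unfolding f_def by (intro borel_measurable_lim_metric L2D s)
    have est: "f - s n \<in> L2 \<Omega>" "L2_norm \<Omega> (f - s n) \<le> 2 * (1/2)^n" for n
    proof -
      have "(\<integral>\<^sup>+x. ennreal ((norm (f x - s n x))\<^sup>2) \<partial>?M) \<le> ennreal ((2 * (1/2)^n)\<^sup>2)"
      proof (rule nn_integral_AE_limit_le)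
        show "(\<lambda>x. (norm (s (n + k) x - s n x))\<^sup>2) \<in> borel_measurable (completion ?M)" for k
          using L2D(1)[OF s(1)] by (intro measurable_completion) measurable
        show "AE x in ?M. (\<lambda>k. (norm (s (n + k) x - s n x))\<^sup>2) \<longlonglongrightarrow> (norm (f x - s n x))\<^sup>2"
          using lim
        proof eventually_elim
          case (elim x)
          then have "(\<lambda>k. s (k + n) x) \<longlonglongrightarrow> f x" unfolding f_def by (rule LIMSEQ_ignore_initial_segment)
          then show ?case by (intro tendsto_intros) (simp add: add.commute)
        qed
      qed (rule sq)
      moreover have "f - s n \<in> borel_measurable ?M"
        using fm L2D(1)[OF s(1)] by (simp add: fun_diff_def)
      ultimately show "f - s n \<in> L2 \<Omega>" "L2_norm \<Omega> (f - s n) \<le> 2 * (1/2)^n"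
        using L2I_nn_integral[of "f - s n" \<Omega> "2 * (1/2)^n"] by auto
    qed
    have f: "f \<in> L2 \<Omega>" using add_mem[OF est(1)[of 0] s(1)[of 0]] by simp
    have "(\<lambda>n. L2_norm \<Omega> (s n - f)) \<longlonglongrightarrow> 0"
    proof (rule tendsto_zero_le)
      show "(\<lambda>n. 2 * (1/2)^n :: real) \<longlonglongrightarrow> 2 * 0" by (intro tendsto_intros LIMSEQ_realpow_zero) auto
      show "norm (L2_norm \<Omega> (s n - f)) \<le> 2 * (1/2)^n" for n
        using est(2)[of n] N_minus_commute[OF f s(1)[of n]] N_nonneg[OF diff_mem[OF s(1)[of n] f]] by simp
    qed simp
    with f show "\<exists>x\<in>L2 \<Omega>. (\<lambda>n. L2_norm \<Omega> (s n - x)) \<longlonglongrightarrow> 0" by blast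
  qed
qed

section \<open>Test functions\<close>

text \<open>\<open>exp (- 1 / t) / t ^ k\<close>, extended by zero. The derivative of such a function is a combination of two functions of
  the same kind, also at \<open>t = 0\<close>, so all of them are smooth.\<close>

definition flat :: "nat \<Rightarrow> real \<Rightarrow> real" where
  "flat k t = (if 0 < t then exp (- (1 / t)) / t ^ k else 0)"

lemma flat_tendsto_0: "((\<lambda>t. flat k t) \<longlongrightarrow> 0) (at_right 0)"
proof -
  have "((\<lambda>t. (inverse t) ^ k / exp (inverse t)) \<longlongrightarrow> (0::real)) (at_right 0)"
    by (rule filterlim_compose[OF tendsto_power_div_exp_0 filterlim_inverse_at_top_right])
  moreover have "eventually (\<lambda>t. (inverse t) ^ k / exp (inverse t) = flat k t) (at_right 0)"
    using eventually_at_right_less[of "0::real"]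
    by eventually_elim (simp add: flat_def exp_minus field_simps)
  ultimately show ?thesis by (rule Lim_transform_eventually)
qed

lemma flat_has_derivative:
  "(flat k has_real_derivative (flat (k + 2) t - real k * flat (k + 1) t)) (at t)"
proof -
  consider "t > 0" | "t < 0" | "t = 0" by linarith
  then show ?thesis
  proof cases
    case 1
    have "((\<lambda>t. exp (- (1 / t)) / t ^ k) has_real_derivative (flat (k + 2) t - real k * flat (k + 1) t)) (at t)"
      using 1
      by (cases k) (auto intro!: derivative_eq_intros simp: flat_def field_simps power2_eq_square,
          metis power_minus_mult mult.commute One_nat_def neq0_conv)
    moreover have "eventually (\<lambda>s. exp (- (1 / s)) / s ^ k = flat k s) (nhds t)"
      using eventually_nhds_in_open[of "{0<..}" t] 1 by (auto simp: flat_def elim: eventually_mono)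
    ultimately show ?thesis by (subst DERIV_cong_ev[OF refl _ refl, symmetric])
  next
    case 2
    have "((\<lambda>t. 0) has_real_derivative (flat (k + 2) t - real k * flat (k + 1) t)) (at t)"
      using 2 by (simp add: flat_def)
    moreover have "eventually (\<lambda>s. 0 = flat k s) (nhds t)"
      using eventually_nhds_in_open[of "{..<0}" t] 2 by (auto simp: flat_def elim: eventually_mono)
    ultimately show ?thesis by (subst DERIV_cong_ev[OF refl _ refl, symmetric])
  next
    case 3
    have "((\<lambda>h. flat (k + 1) h) \<longlongrightarrow> 0) (at 0)"
    proof (rule filterlim_split_at)
      show "((\<lambda>h. flat (k + 1) h) \<longlongrightarrow> 0) (at_left 0)"
        by (rule Lim_transform_eventually[OF tendsto_const])
           (auto simp: flat_def eventually_at_left_field intro!: exI[of _ "-1"])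
    qed (rule flat_tendsto_0)
    moreover have "eventually (\<lambda>h. flat (k + 1) h = (flat k (0 + h) - flat k 0) / h) (at 0)"
      by (auto simp: eventually_at flat_def intro!: exI[of _ 1])
    ultimately have "((\<lambda>h. (flat k (0 + h) - flat k 0) / h) \<longlongrightarrow> 0) (at 0)"
      by (rule Lim_transform_eventually)
    then have "(flat k has_real_derivative 0) (at 0)" by (simp add: DERIV_def)
    then show ?thesis using 3 by (simp add: flat_def)
  qed
qed

text \<open>The algebra generated by flat functions of one coordinate is closed under partial derivatives. This gives
  smoothness of all its elements at once, without formulas for higher derivatives.\<close>

inductive_set flat_algebra :: "(real^'d::finite \<Rightarrow> real) set" where
  coord: "(\<lambda>x. flat k (a + b * x $ i)) \<in> flat_algebra"
| const: "(\<lambda>x. c) \<in> flat_algebra"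
| add: "f \<in> flat_algebra \<Longrightarrow> g \<in> flat_algebra \<Longrightarrow> (\<lambda>x. f x + g x) \<in> flat_algebra"
| mult: "f \<in> flat_algebra \<Longrightarrow> g \<in> flat_algebra \<Longrightarrow> (\<lambda>x. f x * g x) \<in> flat_algebra"

lemma partial_eq: "(f has_derivative f') (at x) \<Longrightarrow> partial i f x = f' (axis i 1)"
  unfolding partial_def using frechet_derivative_at by metis

lemma partial_add:
  assumes "f differentiable at x" "g differentiable at x"
  shows "partial i (\<lambda>x. f x + g x) x = partial i f x + partial i g x"
proof -
  note d = assms[unfolded frechet_derivative_works]
  from partial_eq[OF has_derivative_add[OF d]] show ?thesis by (simp add: partial_def)
qed

lemma partial_mult:
  assumes "f differentiable at x" "g differentiable at x"
  shows "partial i (\<lambda>x. f x * g x) x = f x * partial i g x + partial i f x * g x"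
proof -
  note d = assms[unfolded frechet_derivative_works]
  from partial_eq[OF has_derivative_mult[OF d]] show ?thesis by (simp add: partial_def)
qed

lemma partial_const: "partial i (\<lambda>x. c) x = 0"
  by (rule partial_eq[where f'="\<lambda>_. 0"]) simp

lemma coord_has_derivative:
  "((\<lambda>x::real^'d::finite. flat k (a + b * x $ i)) has_derivative
     (\<lambda>h. (flat (k + 2) (a + b * x $ i) - real k * flat (k + 1) (a + b * x $ i)) * (b * h $ i))) (at x)"
proof -
  have "((\<lambda>x::real^'d. a + b * x $ i) has_derivative (\<lambda>h. b * h $ i)) (at x)"
    by (auto intro!: derivative_eq_intros bounded_linear.has_derivative[OF bounded_linear_vec_nth])
  from has_derivative_compose[OF this flat_has_derivative[unfolded has_field_derivative_def, of k]]
  show ?thesis by (simp add: mult.commute mult.left_commute)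
qed

lemma flat_algebra_closed:
  fixes f :: "real^'d::finite \<Rightarrow> real"
  assumes "f \<in> flat_algebra"
  shows "(\<forall>x. f differentiable at x) \<and> (\<forall>j. partial j f \<in> flat_algebra)"
  using assms
proof induction
  case (coord k a b i)
  have d: "(\<lambda>x. flat k (a + b * x $ i)) differentiable at x" for x :: "real^'d"
    using coord_has_derivative by (rule differentiableI)
  have p: "partial j (\<lambda>x. flat k (a + b * x $ i)) = (\<lambda>x. (flat (k + 2) (a + b * x $ i)
      + (- real k) * flat (k + 1) (a + b * x $ i)) * (b * (if i = j then 1 else 0)))" for j
    by (rule ext) (subst partial_eq[OF coord_has_derivative], simp add: axis_def)
  show ?case
    unfolding p by (intro conjI allI d flat_algebra.intros)
next
  case (const c)
  then show ?case by (auto simp: partial_const[abs_def] intro: flat_algebra.intros)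
next
  case (add f g)
  then have "partial j (\<lambda>x. f x + g x) = (\<lambda>x. partial j f x + partial j g x)" for j
    by (auto simp: partial_add)
  with add show ?case by (auto intro: flat_algebra.intros)
next
  case (mult f g)
  then have "partial j (\<lambda>x. f x * g x) = (\<lambda>x. f x * partial j g x + partial j f x * g x)" for j
    by (auto simp: partial_mult)
  with mult show ?case by (auto intro!: flat_algebra.intros)
qed

lemma flat_algebra_Ck: "f \<in> flat_algebra \<Longrightarrow> Ck k f"
proof (induction k arbitrary: f)
  case 0
  then show ?case
    using flat_algebra_closed[OF 0] by (auto intro!: differentiable_imp_continuous_on simp: differentiable_on_def)
next
  case (Suc k)
  then show ?case using flat_algebra_closed[OF Suc.prems] by auto
qed

lemma flat_algebra_prod: "finite I \<Longrightarrow> (\<And>i. i \<in> I \<Longrightarrow> f i \<in> flat_algebra) \<Longrightarrow> (\<lambda>x. \<Prod>i\<in>I. f i x) \<in> flat_algebra"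
  by (induction I rule: finite_induct) (auto intro: flat_algebra.intros)

text \<open>The constants \<open>- 1\<close> keep the support at least at distance \<open>1 / (n + 1)\<close> from the boundary of the box; they do not affect the
  limit \<open>n \<rightarrow> \<infinity>\<close>, which is the indicator of the open box.\<close>

definition box_bump :: "nat \<Rightarrow> real^'d::finite \<Rightarrow> real^'d \<Rightarrow> real^'d \<Rightarrow> real" where
  "box_bump n a b x = (\<Prod>i\<in>UNIV. flat 0 ((- real (Suc n) * a $ i - 1) + real (Suc n) * x $ i)
                               * flat 0 ((real (Suc n) * b $ i - 1) + (- real (Suc n)) * x $ i))"

lemma box_bump_algebra: "box_bump n a b \<in> flat_algebra"
  unfolding box_bump_def by (intro flat_algebra_prod flat_algebra.intros) auto

lemma flat_0_bounds: "0 \<le> flat 0 t" "flat 0 t \<le> 1"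
  by (auto simp: flat_def)

lemma flat_0_eq_0_iff: "flat 0 t = 0 \<longleftrightarrow> t \<le> 0"
  by (simp add: flat_def)

lemma box_bump_bounds: "0 \<le> box_bump n a b x" "box_bump n a b x \<le> 1"
  unfolding box_bump_def
  by (auto intro!: prod_nonneg prod_le_1 mult_le_one flat_0_bounds mult_nonneg_nonneg)

lemma box_bump_support:
  assumes "box_bump n a b x \<noteq> 0"
  shows "x \<in> cbox (a + (1 / real (Suc n)) *\<^sub>R 1) (b - (1 / real (Suc n)) *\<^sub>R 1)"
  unfolding mem_box_cart
proof
  fix i
  have "flat 0 ((- real (Suc n) * a $ i - 1) + real (Suc n) * x $ i) \<noteq> 0"
    "flat 0 ((real (Suc n) * b $ i - 1) + (- real (Suc n)) * x $ i) \<noteq> 0"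
    using assms unfolding box_bump_def by (auto simp del: of_nat_Suc)
  then have "real (Suc n) * a $ i + 1 \<le> real (Suc n) * x $ i" "real (Suc n) * x $ i \<le> real (Suc n) * b $ i - 1"
    unfolding flat_0_eq_0_iff by linarith+
  then show "(a + (1 / real (Suc n)) *\<^sub>R 1) $ i \<le> x $ i \<and> x $ i \<le> (b - (1 / real (Suc n)) *\<^sub>R 1) $ i"
    by (simp add: field_simps del: of_nat_Suc)
qed

lemma cbox_shrink_subset_box: "cbox (a + (1 / real (Suc n)) *\<^sub>R 1) (b - (1 / real (Suc n)) *\<^sub>R 1) \<subseteq> box a (b :: real^'d::finite)"
proof
  fix x assume "x \<in> cbox (a + (1 / real (Suc n)) *\<^sub>R 1) (b - (1 / real (Suc n)) *\<^sub>R 1)"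
  then have h: "a $ i + 1 / real (Suc n) \<le> x $ i" "x $ i \<le> b $ i - 1 / real (Suc n)" for i
    by (auto simp: mem_box_cart)
  have "0 < 1 / real (Suc n)" by simp
  then show "x \<in> box a b" unfolding mem_box_cart using h by (metis add_less_cancel_left add.right_neutral diff_gt_0_iff_gt less_le_trans le_less_trans diff_less_eq less_add_same_cancel1)
qed

lemma flat_0_tendsto_1: "(flat 0 \<longlongrightarrow> 1) at_top"
proof -
  have "((\<lambda>t::real. exp (- inverse t)) \<longlongrightarrow> exp (- 0)) at_top"
    by (intro tendsto_intros tendsto_inverse_0_at_top filterlim_ident)
  moreover have "eventually (\<lambda>t::real. exp (- inverse t) = flat 0 t) at_top"
    using eventually_gt_at_top[of "0::real"] by eventually_elim (simp add: flat_def inverse_eq_divide)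
  ultimately have "(flat 0 \<longlongrightarrow> exp (- 0)) at_top" by (rule Lim_transform_eventually)
  then show ?thesis by simp
qed

lemma box_bump_tendsto:
  assumes x: "x \<in> box a b"
  shows "(\<lambda>n. box_bump n a b x) \<longlonglongrightarrow> 1"
proof -
  have at_top: "filterlim (\<lambda>n. real (Suc n) * c - 1) at_top sequentially" if "0 < c" for c
  proof -
    have "filterlim (\<lambda>n. c * real (Suc n)) at_top sequentially"
      by (intro filterlim_tendsto_pos_mult_at_top[OF tendsto_const that]
            filterlim_compose[OF filterlim_real_sequentially filterlim_Suc])
    then have "filterlim (\<lambda>n. (-1) + c * real (Suc n)) at_top sequentially"
      by (intro filterlim_tendsto_add_at_top[OF tendsto_const])
    then show ?thesis by (simp add: mult.commute)
  qed
  have "(\<lambda>n. box_bump n a b x) \<longlonglongrightarrow> (\<Prod>i\<in>(UNIV::'a set). 1 * 1)"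
    unfolding box_bump_def
  proof (intro tendsto_prod tendsto_mult)
    fix i
    have c: "0 < x $ i - a $ i" "0 < b $ i - x $ i" using x by (auto simp: mem_box_cart)
    have e: "(- real (Suc n) * a $ i - 1) + real (Suc n) * x $ i = real (Suc n) * (x $ i - a $ i) - 1"
      "(real (Suc n) * b $ i - 1) + (- real (Suc n)) * x $ i = real (Suc n) * (b $ i - x $ i) - 1" for n
      by (simp_all add: algebra_simps)
    show "(\<lambda>n. flat 0 ((- real (Suc n) * a $ i - 1) + real (Suc n) * x $ i)) \<longlonglongrightarrow> 1"
      "(\<lambda>n. flat 0 ((real (Suc n) * b $ i - 1) + (- real (Suc n)) * x $ i)) \<longlonglongrightarrow> 1"
      unfolding e by (rule filterlim_compose[OF flat_0_tendsto_1 at_top], rule c)+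
  qed
  then show ?thesis by simp
qed

text \<open>The indicator of an open set is a bounded limit of test functions: cover the open set by
  countably many boxes and combine the bumps of the first \<open>n\<close> of them.\<close>

lemma test_functions_approx_indicator:
  fixes U :: "(real^'d::finite) set"
  assumes U: "open U"
  obtains u where "\<And>n. u n \<in> test_functions U" "\<And>n x. 0 \<le> u n x" "\<And>n x. u n x \<le> 1"
    "\<And>x. (\<lambda>n. u n x) \<longlonglongrightarrow> indicator U x"
proof -
  obtain \<D> where D: "countable \<D>" "\<D> \<subseteq> Pow U" "\<And>B. B \<in> \<D> \<Longrightarrow> \<exists>a b. B = box a b" "\<Union>\<D> = U"
    by (rule open_countable_Union_open_box[OF U]) (rule that)
  \<comment> \<open>the empty set is added to make the family nonempty, hence enumerable\<close>
  define \<D>' where "\<D>' = insert {} \<D>"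
  have D': "countable \<D>'" "\<D>' \<noteq> {}" using D(1) by (auto simp: \<D>'_def)
  have "\<not> (\<forall>i. 0 < x $ i \<and> x $ i < 0)" for x :: "real^'d" by (meson less_asym)
  then have empty: "{} = box (0::real^'d) 0" by (auto simp: set_eq_iff mem_box_cart)
  have "\<exists>a b. from_nat_into \<D>' k = box a b" for k
    using from_nat_into[OF D'(2), of k] D(3) empty unfolding \<D>'_def by (metis insertE)
  then obtain a b where ab: "\<And>k. from_nat_into \<D>' k = box (a k) (b k)" by metis
  have sub: "box (a k) (b k) \<subseteq> U" for k
    using from_nat_into[OF D'(2), of k] D(2) unfolding ab by (auto simp: \<D>'_def)
  have cover: "\<exists>k. x \<in> box (a k) (b k)" if xU: "x \<in> U" for x
  proof -
    obtain B where "B \<in> \<D>" "x \<in> B" using xU D(4) by blast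
    moreover have "\<exists>k. from_nat_into \<D>' k = B"
      using from_nat_into_surj[OF D'(1), of B] \<open>B \<in> \<D>\<close> by (auto simp: \<D>'_def)
    ultimately show ?thesis unfolding ab by blast
  qed
  define u where "u n x = 1 + (-1) * (\<Prod>k\<in>{..<n}. 1 + (-1) * box_bump n (a k) (b k) x)" for n x
  have fac: "0 \<le> 1 + (-1) * box_bump n (a k) (b k) x" "1 + (-1) * box_bump n (a k) (b k) x \<le> 1" for n k x
    using box_bump_bounds[of n "a k" "b k" x] by auto
  have P: "0 \<le> (\<Prod>k\<in>{..<n}. 1 + (-1) * box_bump n (a k) (b k) x)" "(\<Prod>k\<in>{..<n}. 1 + (-1) * box_bump n (a k) (b k) x) \<le> 1" for n x
    using fac by (auto intro!: prod_nonneg prod_le_1)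
  show thesis
  proof
    show "0 \<le> u n x" "u n x \<le> 1" for n x using P[of n x] by (auto simp: u_def)
    show "u n \<in> test_functions U" for n
    proof -
      let ?K = "\<Union>k\<in>{..<n}. cbox (a k + (1 / real (Suc n)) *\<^sub>R 1) (b k - (1 / real (Suc n)) *\<^sub>R 1)"
      have "u n \<in> flat_algebra"
        unfolding u_def[abs_def] by (intro flat_algebra.intros flat_algebra_prod box_bump_algebra) auto
      moreover have supp: "{x. u n x \<noteq> 0} \<subseteq> ?K"
      proof
        fix x assume x: "x \<in> {x. u n x \<noteq> 0}"
        have "\<exists>k\<in>{..<n}. box_bump n (a k) (b k) x \<noteq> 0"
        proof (rule ccontr)
          assume "\<not> ?thesis"
          then have "u n x = 0" by (simp add: u_def)
          then show False using x by simp
        qed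
        then show "x \<in> ?K" using box_bump_support by blast
      qed
      moreover have K: "compact ?K" by (intro compact_UN) auto
      moreover have "?K \<subseteq> U" using cbox_shrink_subset_box sub by (meson UN_least order_trans)
      moreover have "closure {x. u n x \<noteq> 0} \<subseteq> ?K"
        using supp compact_imp_closed[OF K] by (rule closure_minimal)
      moreover have "compact (closure {x. u n x \<noteq> 0})"
        using bounded_subset[OF compact_imp_bounded[OF K] supp] by (simp add: compact_closure)
      ultimately show ?thesis by (auto simp: test_functions_def flat_algebra_Ck)
    qed
    show "(\<lambda>n. u n x) \<longlonglongrightarrow> indicator U x" for x
    proof (cases "x \<in> U")
      case False
      then have "box_bump n (a k) (b k) x = 0" for n k
        using box_bump_support cbox_shrink_subset_box sub by blast
      then show ?thesis using False by (simp add: u_def)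
    next
      case True
      then obtain k where k: "x \<in> box (a k) (b k)" using cover by auto
      have l: "(\<lambda>n. 1 - box_bump n (a k) (b k) x) \<longlonglongrightarrow> 1 - 1" by (intro tendsto_intros box_bump_tendsto k)
      have ev: "eventually (\<lambda>n. (\<Prod>k\<in>{..<n}. 1 + (-1) * box_bump n (a k) (b k) x) \<le> 1 - box_bump n (a k) (b k) x) sequentially"
        using eventually_gt_at_top[of k]
      proof eventually_elim
        case (elim n)
        have "(\<Prod>k\<in>{..<n}. 1 + (-1) * box_bump n (a k) (b k) x) =
          (1 + (-1) * box_bump n (a k) (b k) x) * (\<Prod>k\<in>{..<n} - {k}. 1 + (-1) * box_bump n (a k) (b k) x)"
          using elim by (subst prod.remove[of _ k]) auto
        also have "\<dots> \<le> (1 + (-1) * box_bump n (a k) (b k) x) * 1"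
          by (intro mult_left_mono prod_le_1 conjI fac)
        finally show ?case by simp
      qed
      have "(\<lambda>n. \<Prod>k\<in>{..<n}. 1 + (-1) * box_bump n (a k) (b k) x) \<longlonglongrightarrow> 0"
        by (rule tendsto_sandwich[OF always_eventually[OF allI[OF P(1)]] ev tendsto_const l[simplified]])
      then have "(\<lambda>n. 1 + (-1) * (\<Prod>k\<in>{..<n}. 1 + (-1) * box_bump n (a k) (b k) x)) \<longlonglongrightarrow> 1 + (-1) * 0"
        by (intro tendsto_intros)
      then show ?thesis using True by (simp add: u_def)
    qed
  qed
qed

section \<open>Integration against test functions\<close>

lemma test_functionsD:
  assumes "\<phi> \<in> test_functions \<Omega>"
  shows "Ck k \<phi>" "compact (closure {x. \<phi> x \<noteq> 0})" "closure {x. \<phi> x \<noteq> 0} \<subseteq> \<Omega>"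
    "continuous_on UNIV \<phi>" "\<phi> differentiable at x" "x \<notin> \<Omega> \<Longrightarrow> \<phi> x = 0"
proof -
  show *: "Ck k \<phi>" "compact (closure {x. \<phi> x \<noteq> 0})" "closure {x. \<phi> x \<noteq> 0} \<subseteq> \<Omega>" for k
    using assms by (auto simp: test_functions_def)
  show "continuous_on UNIV \<phi>" using *(1)[of 0] by simp
  show "\<phi> differentiable at x" using *(1)[of "Suc 0"] by simp
  show "\<phi> x = 0" if "x \<notin> \<Omega>" using *(3) closure_subset[of "{x. \<phi> x \<noteq> 0}"] that by auto
qed

lemma partial_test_functions:
  assumes \<phi>: "\<phi> \<in> test_functions \<Omega>"
  shows "partial i \<phi> \<in> test_functions \<Omega>"
proof -
  have Ck: "Ck k (partial i \<phi>)" for k using test_functionsD(1)[OF \<phi>, of "Suc k"] by simp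
  have "{x. partial i \<phi> x \<noteq> 0} \<subseteq> closure {x. \<phi> x \<noteq> 0}"
  proof
    fix x assume x: "x \<in> {x. partial i \<phi> x \<noteq> 0}"
    show "x \<in> closure {x. \<phi> x \<noteq> 0}"
    proof (rule ccontr)
      assume "x \<notin> closure {x. \<phi> x \<noteq> 0}"
      then have o: "open (- closure {x. \<phi> x \<noteq> 0})" "x \<in> - closure {x. \<phi> x \<noteq> 0}" by auto
      have z: "\<phi> y = 0" if "y \<in> - closure {x. \<phi> x \<noteq> 0}" for y
        using that closure_subset[of "{x. \<phi> x \<noteq> 0}"] by auto
      have "(\<phi> has_derivative (\<lambda>_. 0)) (at x)"
        by (rule has_derivative_transform_within_open[OF has_derivative_const[of 0] o]) (rule z[symmetric])
      from partial_eq[OF this] x show False by simp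
    qed
  qed
  then have sub: "closure {x. partial i \<phi> x \<noteq> 0} \<subseteq> closure {x. \<phi> x \<noteq> 0}"
    by (intro closure_minimal) auto
  have "compact (closure {x. partial i \<phi> x \<noteq> 0})"
    using bounded_subset[OF compact_imp_bounded[OF test_functionsD(2)[OF \<phi>]] sub]
    by (simp add: compact_eq_bounded_closed)
  then show ?thesis using Ck sub test_functionsD(3)[OF \<phi>] by (auto simp: test_functions_def)
qed

lemma test_functions_mono: "U \<subseteq> \<Omega> \<Longrightarrow> test_functions U \<subseteq> test_functions \<Omega>"
  by (auto simp: test_functions_def)

lemma Ck_lin: "Ck k f \<Longrightarrow> Ck k g \<Longrightarrow> Ck k (\<lambda>x. a * f x + b * g x)"
proof (induction k arbitrary: f g)
  case 0
  then show ?case by (auto intro!: continuous_intros)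
next
  case (Suc k)
  have "partial i (\<lambda>x. a * f x + b * g x) = (\<lambda>x. a * partial i f x + b * partial i g x)" for i
  proof
    fix x
    have "(f has_derivative frechet_derivative f (at x)) (at x)" "(g has_derivative frechet_derivative g (at x)) (at x)"
      using Suc.prems by (auto simp: frechet_derivative_works)
    then have "((\<lambda>x. a * f x + b * g x) has_derivative
        (\<lambda>h. a * frechet_derivative f (at x) h + b * frechet_derivative g (at x) h)) (at x)"
      by (auto intro!: derivative_eq_intros)
    from partial_eq[OF this] show "partial i (\<lambda>x. a * f x + b * g x) x = a * partial i f x + b * partial i g x"
      by (simp add: partial_def)
  qed
  moreover have "(\<lambda>x. a * f x + b * g x) differentiable at x" for x
    using Suc.prems by (intro differentiable_add differentiable_mult differentiable_const) auto
  ultimately show ?case using Suc by auto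
qed

lemma test_functions_lin:
  assumes \<phi>: "\<phi> \<in> test_functions \<Omega>" and \<psi>: "\<psi> \<in> test_functions \<Omega>"
  shows "a *\<^sub>R \<phi> + b *\<^sub>R \<psi> \<in> test_functions \<Omega>"
proof -
  let ?f = "\<lambda>x. a * \<phi> x + b * \<psi> x"
  let ?K = "closure {x. \<phi> x \<noteq> 0} \<union> closure {x. \<psi> x \<noteq> 0}"
  have K: "compact ?K" using test_functionsD(2)[OF \<phi>] test_functionsD(2)[OF \<psi>] by auto
  have sub: "{x. ?f x \<noteq> 0} \<subseteq> ?K"
  proof
    fix x assume "x \<in> {x. ?f x \<noteq> 0}"
    then have "\<phi> x \<noteq> 0 \<or> \<psi> x \<noteq> 0" by auto
    then show "x \<in> ?K"
      using closure_subset[of "{x. \<phi> x \<noteq> 0}"] closure_subset[of "{x. \<psi> x \<noteq> 0}"] by blast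
  qed
  have cl: "closure {x. ?f x \<noteq> 0} \<subseteq> ?K" using sub compact_imp_closed[OF K] by (rule closure_minimal)
  have "compact (closure {x. ?f x \<noteq> 0})"
    using bounded_subset[OF compact_imp_bounded[OF K] sub] by (simp add: compact_closure)
  moreover have "?K \<subseteq> \<Omega>" using test_functionsD(3)[OF \<phi>] test_functionsD(3)[OF \<psi>] by auto
  ultimately have "?f \<in> test_functions \<Omega>"
    using cl test_functionsD(1)[OF \<phi>] test_functionsD(1)[OF \<psi>] by (auto simp: test_functions_def Ck_lin)
  moreover have "a *\<^sub>R \<phi> + b *\<^sub>R \<psi> = ?f" by (auto simp: fun_eq_iff)
  ultimately show ?thesis by simp
qed

lemma bounded_test_function:
  assumes \<phi>: "\<phi> \<in> test_functions \<Omega>"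
  obtains B where "\<And>x. \<bar>\<phi> x\<bar> \<le> B"
proof -
  have "compact (\<phi> ` closure {x. \<phi> x \<noteq> 0})"
    using test_functionsD(2,4)[OF \<phi>] by (intro compact_continuous_image) (auto intro: continuous_on_subset)
  then obtain B where B: "0 < B" "\<And>x. x \<in> closure {x. \<phi> x \<noteq> 0} \<Longrightarrow> \<bar>\<phi> x\<bar> \<le> B"
    by (auto dest!: compact_imp_bounded simp: bounded_pos)
  have "\<bar>\<phi> x\<bar> \<le> B" for x
    using B closure_subset[of "{x. \<phi> x \<noteq> 0}"] by (cases "\<phi> x = 0") auto
  then show thesis by (rule that)
qed

lemma line_derivative:
  fixes f :: "real^'d::finite \<Rightarrow> real"
  assumes "\<And>x. f differentiable at x"
  shows "((\<lambda>s. f (x + s *\<^sub>R axis i 1)) has_real_derivative partial i f (x + s *\<^sub>R axis i 1)) (at s)"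
proof -
  let ?D = "frechet_derivative f (at (x + s *\<^sub>R axis i 1))"
  have D: "(f has_derivative ?D) (at (x + s *\<^sub>R axis i 1))"
    using assms by (simp add: frechet_derivative_works)
  have "((\<lambda>s. x + s *\<^sub>R axis i 1) has_derivative (\<lambda>h. h *\<^sub>R axis i 1)) (at s)"
    by (auto intro!: derivative_eq_intros)
  from has_derivative_compose[OF this D]
  have "((\<lambda>s. f (x + s *\<^sub>R axis i 1)) has_derivative (\<lambda>h. ?D (h *\<^sub>R axis i 1))) (at s)" .
  moreover have "?D (h *\<^sub>R axis i 1) = partial i f (x + s *\<^sub>R axis i 1) * h" for h
    using linear_scale[OF has_derivative_linear[OF D], of h "axis i 1"] by (simp add: partial_def mult.commute)
  ultimately show ?thesis by (simp add: has_field_derivative_def)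
qed

text \<open>Translation invariance of Lebesgue measure makes every difference quotient integrate to zero, and these quotients
  converge boundedly to the derivative.\<close>

lemma integral_partial_eq_0:
  fixes f :: "real^'d::finite \<Rightarrow> real"
  assumes diff: "\<And>x. f differentiable at x" and cont: "continuous_on UNIV (partial i f)"
    and supp: "\<And>x. f x \<noteq> 0 \<Longrightarrow> norm x \<le> R"
  shows "integral\<^sup>L lborel (partial i f) = 0"
proof -
  let ?e = "axis i 1 :: real^'d"
  have ne: "norm ?e = 1" by simp
  have fc: "continuous_on UNIV f"
    using diff by (auto intro!: differentiable_imp_continuous_on simp: differentiable_on_def)
  have fint: "integrable lborel f"
  proof -
    have "integrable lborel (\<lambda>x. indicator (cball 0 R) x *\<^sub>R f x)"
      by (intro borel_integrable_compact continuous_on_subset[OF fc]) auto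
    also have "(\<lambda>x. indicator (cball 0 R) x *\<^sub>R f x) = f"
      using supp by (auto simp: fun_eq_iff split: split_indicator)
    finally show ?thesis .
  qed
  have fm: "f \<in> borel_measurable borel" using fc by (rule borel_measurable_continuous_onI)
  have trans: "integrable lborel (\<lambda>x. f (c + x))" "integral\<^sup>L lborel (\<lambda>x. f (c + x)) = integral\<^sup>L lborel f" for c
  proof -
    have "integrable (distr lborel borel ((+) c)) f" using fint by (simp add: lborel_distr_plus)
    then show "integrable lborel (\<lambda>x. f (c + x))" using fm by (subst (asm) integrable_distr_eq) auto
    have "integral\<^sup>L lborel f = integral\<^sup>L (distr lborel borel ((+) c)) f" by (simp add: lborel_distr_plus)
    also have "\<dots> = integral\<^sup>L lborel (\<lambda>x. f (c + x))" using fm by (subst integral_distr) auto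
    finally show "integral\<^sup>L lborel (\<lambda>x. f (c + x)) = integral\<^sup>L lborel f" by simp
  qed
  define h where "h n = inverse (real (Suc n))" for n
  have h: "0 < h n" "h n \<le> 1" for n by (auto simp: h_def inverse_eq_divide)
  define F where "F n x = (f (h n *\<^sub>R ?e + x) - f x) / h n" for n x
  have F0: "integral\<^sup>L lborel (F n) = 0" for n
    unfolding F_def using fint trans by simp
  have mvt: "\<exists>s. 0 < s \<and> s < 1 \<and> F n x = partial i f (x + s *\<^sub>R ?e)" for n x
  proof -
    have "\<exists>z>0. z < h n \<and> f (x + h n *\<^sub>R ?e) - f (x + 0 *\<^sub>R ?e) = (h n - 0) * partial i f (x + z *\<^sub>R ?e)"
      by (rule MVT2[OF h(1)]) (rule line_derivative[OF diff])
    then obtain z where "0 < z" "z < h n" "f (x + h n *\<^sub>R ?e) - f x = h n * partial i f (x + z *\<^sub>R ?e)" by auto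
    then show ?thesis using h[of n] by (intro exI[of _ z]) (auto simp: F_def add.commute)
  qed
  have "compact (partial i f ` cball 0 (R + 2))"
    by (intro compact_continuous_image continuous_on_subset[OF cont]) auto
  then obtain B where B: "0 < B" "\<And>x. norm x \<le> R + 2 \<Longrightarrow> \<bar>partial i f x\<bar> \<le> B"
    by (auto dest!: compact_imp_bounded simp: bounded_pos)
  have "(\<lambda>n. integral\<^sup>L lborel (F n)) \<longlonglongrightarrow> integral\<^sup>L lborel (partial i f)"
  proof (rule integral_dominated_convergence[where w="\<lambda>x. B * indicator (cball 0 (R + 1)) x"])
    show "partial i f \<in> borel_measurable lborel"
      using borel_measurable_continuous_onI[OF cont] by simp
    show "F n \<in> borel_measurable lborel" for n
      unfolding F_def using borel_measurable_integrable[OF trans(1)] borel_measurable_integrable[OF fint]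
      by (intro borel_measurable_divide borel_measurable_diff borel_measurable_const)
    show "integrable lborel (\<lambda>x. B * indicator (cball 0 (R + 1)) x :: real)"
      by (intro integrable_mult_right integrable_real_indicator) (use emeasure_bounded_finite[OF bounded_cball, of 0 "R + 1"] in auto)
    show "AE x in lborel. norm (F n x) \<le> B * indicator (cball 0 (R + 1)) x" for n
    proof (rule AE_I2)
      fix x
      show "norm (F n x) \<le> B * indicator (cball 0 (R + 1)) x"
      proof (cases "norm x \<le> R + 1")
        case True
        obtain s where s: "0 < s" "s < 1" "F n x = partial i f (x + s *\<^sub>R ?e)" using mvt by blast
        have "norm (x + s *\<^sub>R ?e) \<le> R + 2"
          using norm_triangle_ineq[of x "s *\<^sub>R ?e"] True s by simp
        then show ?thesis using B s True by simp
      next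
        case False
        have "norm x \<le> norm (h n *\<^sub>R ?e + x) + norm (h n *\<^sub>R ?e)"
          using norm_triangle_ineq4[of "h n *\<^sub>R ?e + x" "h n *\<^sub>R ?e"] by simp
        also have "norm (h n *\<^sub>R ?e) \<le> 1" using h[of n] by simp
        finally have "norm (h n *\<^sub>R ?e + x) > R" using False by simp
        then have "f (h n *\<^sub>R ?e + x) = 0" "f x = 0" using supp[of "h n *\<^sub>R ?e + x"] supp[of x] False by fastforce+
        then show ?thesis using False by (simp add: F_def)
      qed
    qed
    show "AE x in lborel. (\<lambda>n. F n x) \<longlonglongrightarrow> partial i f x"
    proof (rule AE_I2)
      fix x
      have "((\<lambda>s. f (x + s *\<^sub>R ?e)) has_real_derivative partial i f x) (at 0)"
        using line_derivative[OF diff, of x i 0] by simp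
      then have "((\<lambda>s. (f (x + (0 + s) *\<^sub>R ?e) - f (x + 0 *\<^sub>R ?e)) / s) \<longlongrightarrow> partial i f x) (at 0)"
        unfolding DERIV_def .
      moreover have "filterlim h (at 0) sequentially"
        unfolding h_def filterlim_at
        by (simp add: LIMSEQ_inverse_real_of_nat del: of_nat_Suc)
      ultimately have "(\<lambda>n. (f (x + (0 + h n) *\<^sub>R ?e) - f (x + 0 *\<^sub>R ?e)) / h n) \<longlonglongrightarrow> partial i f x"
        by (rule filterlim_compose)
      then show "(\<lambda>n. F n x) \<longlonglongrightarrow> partial i f x" by (simp add: F_def add.commute)
    qed
  qed
  then show ?thesis unfolding F0 by (simp add: LIMSEQ_const_iff)
qed

locale bounded_open =
  fixes \<Omega> :: "(real^'d::finite) set"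
  assumes open_domain: "open \<Omega>" and bounded_domain: "bounded \<Omega>"
begin

lemma sets_domain [simp]: "\<Omega> \<in> sets lebesgue"
  using open_domain by auto

lemma finite_measure_domain: "finite_measure (lebesgue_on \<Omega>)"
  by (rule finite_measure_lebesgue_on[OF bounded_domain sets_domain])

sublocale L2r: semi_hilbert_space "L2 \<Omega> :: (real^'d \<Rightarrow> real) set" "L2_norm \<Omega>" "L2_inner \<Omega>"
  by (rule semi_hilbert_space_L2[OF bounded_domain sets_domain])

sublocale L2v: semi_hilbert_space "L2 \<Omega> :: (real^'d \<Rightarrow> real^'d) set" "L2_norm \<Omega>" "L2_inner \<Omega>"
  by (rule semi_hilbert_space_L2[OF bounded_domain sets_domain])

lemma L2_bounded:
  assumes "f \<in> borel_measurable (lebesgue_on \<Omega>)" "\<And>x. norm (f x) \<le> B"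
  shows "f \<in> L2 \<Omega>"
proof -
  interpret finite_measure "lebesgue_on \<Omega>" by (rule finite_measure_domain)
  have "integrable (lebesgue_on \<Omega>) (\<lambda>x. (norm (f x))\<^sup>2)"
    by (rule integrable_const_bound[where B="B\<^sup>2"]) (use assms in \<open>auto intro!: power_mono\<close>)
  then show ?thesis using assms by (simp add: L2_def)
qed

lemma borel_measurable_continuous_domain:
  "continuous_on UNIV f \<Longrightarrow> f \<in> borel_measurable (lebesgue_on \<Omega>)"
  by (intro measurable_restrict_space1 measurable_completion) (simp add: borel_measurable_continuous_onI)

lemma test_function_L2:
  assumes \<phi>: "\<phi> \<in> test_functions \<Omega>"
  shows "\<phi> \<in> L2 \<Omega>"
proof -
  obtain B where B: "\<And>x. \<bar>\<phi> x\<bar> \<le> B" by (rule bounded_test_function[OF \<phi>]) (rule that)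
  show ?thesis
    by (rule L2_bounded[where B=B]) (use B borel_measurable_continuous_domain[OF test_functionsD(4)[OF \<phi>]] in auto)
qed

lemma test_vector_L2:
  fixes \<phi> :: "'d \<Rightarrow> real^'d \<Rightarrow> real"
  assumes \<phi>: "\<And>i. \<phi> i \<in> test_functions \<Omega>"
  shows "(\<lambda>x. \<chi> i. \<phi> i x) \<in> L2 \<Omega>"
proof -
  have "(\<lambda>x. \<chi> i. \<phi> i x) = (\<lambda>x. \<Sum>i\<in>UNIV. \<phi> i x *\<^sub>R (axis i 1 :: real^'d))"
    by (auto simp: fun_eq_iff vec_eq_iff axis_def if_distrib cong: if_cong)
  also have "\<dots> = (\<Sum>i\<in>UNIV. (\<lambda>x. \<phi> i x *\<^sub>R (axis i 1 :: real^'d)))"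
    by (simp add: fun_eq_iff sum_fun_comp) (induction rule: finite_induct[OF finite]; simp)
  also have "\<dots> \<in> L2 \<Omega>"
  proof (rule L2v.sum_mem)
    fix i
    obtain B where B: "\<And>x. \<bar>\<phi> i x\<bar> \<le> B" by (rule bounded_test_function[OF \<phi>]) (rule that)
    show "(\<lambda>x. \<phi> i x *\<^sub>R (axis i 1 :: real^'d)) \<in> L2 \<Omega>"
      by (rule L2_bounded[where B=B])
         (use B test_functionsD(4)[OF \<phi>] in \<open>auto intro!: borel_measurable_continuous_domain continuous_intros\<close>)
  qed
  finally show ?thesis .
qed

lemma test_axis_L2:
  assumes \<phi>: "\<phi> \<in> test_functions \<Omega>"
  shows "(\<lambda>x. \<phi> x *\<^sub>R (axis i 1 :: real^'d)) \<in> L2 \<Omega>"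
proof -
  obtain B where B: "\<And>x. \<bar>\<phi> x\<bar> \<le> B" by (rule bounded_test_function[OF \<phi>]) (rule that)
  show ?thesis
    by (rule L2_bounded[where B=B])
       (use B test_functionsD(4)[OF \<phi>] in \<open>auto intro!: borel_measurable_continuous_domain continuous_intros\<close>)
qed

lemma L2_component:
  assumes g: "g \<in> L2 \<Omega>"
  shows "(\<lambda>x. g x $ i) \<in> L2 \<Omega>"
proof -
  have m: "(\<lambda>x. g x $ i) \<in> borel_measurable (lebesgue_on \<Omega>)"
    by (rule measurable_compose[OF L2D(1)[OF g]])
       (intro borel_measurable_continuous_onI linear_continuous_on bounded_linear_vec_nth)
  have "integrable (lebesgue_on \<Omega>) (\<lambda>x. (norm (g x $ i))\<^sup>2)"
    by (rule Bochner_Integration.integrable_bound[OF L2D(2)[OF g]])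
       (use m in \<open>auto intro!: power_mono AE_I2 Finite_Cartesian_Product.norm_nth_le\<close>)
  then show ?thesis using m by (simp add: L2_def)
qed

lemma L2_integrable:
  assumes g: "g \<in> L2 \<Omega>"
  shows "integrable (lebesgue_on \<Omega>) (g :: real^'d \<Rightarrow> real)"
proof -
  have "(\<lambda>x. 1::real) \<in> L2 \<Omega>" by (rule L2_bounded[where B=1]) auto
  from integrable_L2_inner[OF g this] show ?thesis by simp
qed

subsection \<open>The fundamental lemma of the calculus of variations\<close>

lemma test_orthogonal_open:
  assumes g: "integrable (lebesgue_on \<Omega>) (g :: real^'d \<Rightarrow> real)"
    and orth: "\<And>\<phi>. \<phi> \<in> test_functions \<Omega> \<Longrightarrow> (\<integral>x. g x * \<phi> x \<partial>lebesgue_on \<Omega>) = 0"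
    and U: "open U"
  shows "(\<integral>x. g x * indicator U x \<partial>lebesgue_on \<Omega>) = 0"
proof -
  have "open (U \<inter> \<Omega>)" using U open_domain by auto
  then obtain u where u: "\<And>n. u n \<in> test_functions (U \<inter> \<Omega>)" "\<And>n x. 0 \<le> u n x" "\<And>n x. u n x \<le> 1"
    "\<And>x. (\<lambda>n. u n x) \<longlonglongrightarrow> indicator (U \<inter> \<Omega>) x"
    by (rule test_functions_approx_indicator) (rule that)
  have uT: "u n \<in> test_functions \<Omega>" for n using u(1)[of n] test_functions_mono[of "U \<inter> \<Omega>" \<Omega>] by auto
  have "(\<lambda>n. \<integral>x. g x * u n x \<partial>lebesgue_on \<Omega>) \<longlonglongrightarrow> (\<integral>x. g x * indicator (U \<inter> \<Omega>) x \<partial>lebesgue_on \<Omega>)"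
  proof (rule integral_dominated_convergence[where w="\<lambda>x. norm (g x)"])
    show "(\<lambda>x. g x * indicator (U \<inter> \<Omega>) x) \<in> borel_measurable (lebesgue_on \<Omega>)"
      using borel_measurable_integrable[OF g] U open_domain
      by (intro borel_measurable_times borel_measurable_indicator) (auto simp: sets_restrict_space_iff)
    show "(\<lambda>x. g x * u n x) \<in> borel_measurable (lebesgue_on \<Omega>)" for n
      using borel_measurable_integrable[OF g] borel_measurable_continuous_domain[OF test_functionsD(4)[OF uT]]
      by (intro borel_measurable_times)
    show "AE x in lebesgue_on \<Omega>. norm (g x * u n x) \<le> norm (g x)" for n
      using u(2,3) by (intro AE_I2) (simp add: abs_mult mult_left_le)
    show "AE x in lebesgue_on \<Omega>. (\<lambda>n. g x * u n x) \<longlonglongrightarrow> g x * indicator (U \<inter> \<Omega>) x"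
      by (intro AE_I2 tendsto_intros u)
  qed (use g in auto)
  then have "(\<integral>x. g x * indicator (U \<inter> \<Omega>) x \<partial>lebesgue_on \<Omega>) = 0"
    unfolding orth[OF uT] by (simp add: LIMSEQ_const_iff)
  also have "(\<integral>x. g x * indicator (U \<inter> \<Omega>) x \<partial>lebesgue_on \<Omega>) = (\<integral>x. g x * indicator U x \<partial>lebesgue_on \<Omega>)"
    by (rule Bochner_Integration.integral_cong) (auto split: split_indicator)
  finally show ?thesis .
qed

text \<open>Bounded limits of test functions give all indicators of open sets, and these generate the Borel sets. The
  integral of \<open>g\<close> over \<open>{x. 0 < g x}\<close> then vanishes, which forces this set to be null.\<close>

lemma test_orthogonal_nonpos:
  assumes g: "integrable (lebesgue_on \<Omega>) (g :: real^'d \<Rightarrow> real)"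
    and orth: "\<And>\<phi>. \<phi> \<in> test_functions \<Omega> \<Longrightarrow> (\<integral>x. g x * \<phi> x \<partial>lebesgue_on \<Omega>) = 0"
  shows "AE x in lebesgue_on \<Omega>. g x \<le> 0"
proof -
  \<comment> \<open>extension by zero, so that all Borel sets can be treated as sets of one measure space\<close>
  define G where "G x = indicator \<Omega> x *\<^sub>R g x" for x
  have G: "integrable lebesgue G"
    using g unfolding G_def by (subst (asm) integrable_restrict_space) auto
  have Gint: "set_integrable lebesgue B G" if "B \<in> sets borel" for B
    unfolding set_integrable_def using that by (intro integrable_mult_indicator G) auto
  have op: "set_lebesgue_integral lebesgue U G = 0" if U: "open U" for U
  proof -
    have "set_lebesgue_integral lebesgue U G = (\<integral>x. indicator \<Omega> x *\<^sub>R (g x * indicator U x) \<partial>lebesgue)"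
      unfolding set_lebesgue_integral_def G_def
      by (rule Bochner_Integration.integral_cong) (auto split: split_indicator)
    also have "\<dots> = (\<integral>x. g x * indicator U x \<partial>lebesgue_on \<Omega>)"
      by (subst integral_restrict_space) auto
    also have "\<dots> = 0" by (rule test_orthogonal_open[OF g _ U]) (rule orth)
    finally show ?thesis .
  qed
  have borel: "set_lebesgue_integral lebesgue B G = 0" if B: "B \<in> sets borel" for B
  proof -
    have "Int_stable {S :: (real^'d) set. open S}" "{S :: (real^'d) set. open S} \<subseteq> Pow UNIV"
      "B \<in> sigma_sets UNIV {S. open S}" using B by (auto simp: borel_def Int_stable_def)
    then show ?thesis
    proof (induction rule: sigma_sets_induct_disjoint)
      case (compl A)
      then have A: "A \<in> sets borel" by (simp add: borel_def)
      have "set_lebesgue_integral lebesgue (A \<union> (UNIV - A)) G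
          = set_lebesgue_integral lebesgue A G + set_lebesgue_integral lebesgue (UNIV - A) G"
        using A by (intro set_integral_Un Gint) auto
      then show ?case using op[of UNIV] compl by simp
    next
      case (union A)
      then have A: "A i \<in> sets borel" for i by (auto simp: borel_def)
      have "set_lebesgue_integral lebesgue (\<Union>i. A i) G = (\<Sum>i. set_lebesgue_integral lebesgue (A i) G)"
        using A union(1) by (intro lebesgue_integral_countable_add Gint)
          (auto simp: disjoint_family_on_def)
      then show ?case using union by simp
    next
      case (basic A)
      then show ?case by (simp add: op)
    qed (simp add: set_lebesgue_integral_def)
  qed
  have "{x \<in> space lebesgue. 0 < G x} \<in> sets lebesgue"
    using borel_measurable_integrable[OF G] by measurable
  then obtain B N N' where BN: "{x. 0 < G x} = B \<union> N" "N \<subseteq> N'" "N' \<in> null_sets lborel" "B \<in> sets borel"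
    by (auto elim!: sets_completionE)
  have "AE x in lebesgue. indicator B x *\<^sub>R G x = 0"
  proof (subst integral_nonneg_eq_0_iff_AE[symmetric])
    show "integrable lebesgue (\<lambda>x. indicator B x *\<^sub>R G x)" using Gint[OF BN(4)] by (simp add: set_integrable_def)
    have "0 \<le> indicator B x *\<^sub>R G x" for x
      using BN(1) by (cases "x \<in> B") (auto simp: set_eq_iff less_imp_le)
    then show "AE x in lebesgue. 0 \<le> indicator B x *\<^sub>R G x" by simp
    show "(\<integral>x. indicator B x *\<^sub>R G x \<partial>lebesgue) = 0" using borel[OF BN(4)] by (simp add: set_lebesgue_integral_def)
  qed
  moreover have "AE x in lebesgue. x \<notin> N'" using BN(3) by (intro AE_not_in null_sets_completionI)
  ultimately have "AE x in lebesgue. G x \<le> 0"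
  proof eventually_elim
    case (elim x)
    show ?case
    proof (rule ccontr)
      assume "\<not> G x \<le> 0"
      then have "x \<in> B \<union> N" unfolding BN(1)[symmetric] by simp
      then show False using elim BN(2) \<open>\<not> G x \<le> 0\<close> by auto
    qed
  qed
  then show ?thesis unfolding AE_restrict_space_iff[of \<Omega> lebesgue, simplified] by eventually_elim (auto simp: G_def)
qed

theorem test_orthogonal_AE_0:
  assumes g: "integrable (lebesgue_on \<Omega>) (g :: real^'d \<Rightarrow> real)"
    and orth: "\<And>\<phi>. \<phi> \<in> test_functions \<Omega> \<Longrightarrow> (\<integral>x. g x * \<phi> x \<partial>lebesgue_on \<Omega>) = 0"
  shows "AE x in lebesgue_on \<Omega>. g x = 0"
proof -
  have "AE x in lebesgue_on \<Omega>. - g x \<le> 0"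
    by (rule test_orthogonal_nonpos) (use g orth in auto)
  moreover have "AE x in lebesgue_on \<Omega>. g x \<le> 0"
    by (rule test_orthogonal_nonpos[OF g]) (rule orth)
  ultimately show ?thesis by eventually_elim simp
qed

end

context bounded_open
begin

section \<open>Weak gradients\<close>

lemma L2_norm_AE_eq: "AE x in lebesgue_on \<Omega>. f x = g x \<Longrightarrow> L2_norm \<Omega> (f - g) = 0"
  unfolding L2_norm_def by (subst integral_eq_zero_AE) (auto elim: eventually_mono)

lemma integral_domain_eq:
  assumes f: "f \<in> borel_measurable borel" "\<And>x. x \<notin> \<Omega> \<Longrightarrow> f x = (0::real)"
  shows "(\<integral>x. f x \<partial>lebesgue_on \<Omega>) = integral\<^sup>L lborel f"
proof -
  have "(\<integral>x. f x \<partial>lebesgue_on \<Omega>) = (\<integral>x. indicator \<Omega> x *\<^sub>R f x \<partial>lebesgue)"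
    by (rule integral_restrict_space) simp
  also have "(\<lambda>x. indicator \<Omega> x *\<^sub>R f x) = f"
    using f(2) by (auto simp: fun_eq_iff split: split_indicator)
  also have "(\<integral>x. f x \<partial>lebesgue) = integral\<^sup>L lborel f"
    using f(1) by (intro integral_completion) simp
  finally show ?thesis .
qed

lemma test_integration_by_parts:
  assumes \<phi>: "\<phi> \<in> test_functions \<Omega>" and \<psi>: "\<psi> \<in> test_functions \<Omega>"
  shows "L2_inner \<Omega> \<phi> (partial i \<psi>) = - L2_inner \<Omega> (partial i \<phi>) \<psi>"
proof -
  note d\<phi> = partial_test_functions[OF \<phi>] and d\<psi> = partial_test_functions[OF \<psi>]
  have p: "partial i (\<lambda>x. \<phi> x * \<psi> x) = (\<lambda>x. \<phi> x * partial i \<psi> x + partial i \<phi> x * \<psi> x)"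
    using test_functionsD(5)[OF \<phi>] test_functionsD(5)[OF \<psi>] by (auto simp: partial_mult)
  have cont: "continuous_on UNIV (\<lambda>x. \<phi> x * partial i \<psi> x + partial i \<phi> x * \<psi> x)"
    by (intro continuous_intros test_functionsD(4)[OF \<phi>] test_functionsD(4)[OF \<psi>] test_functionsD(4)[OF d\<phi>] test_functionsD(4)[OF d\<psi>])
  obtain R where R: "\<And>x. x \<in> \<Omega> \<Longrightarrow> norm x \<le> R" using bounded_domain by (auto simp: bounded_iff)
  have "integral\<^sup>L lborel (partial i (\<lambda>x. \<phi> x * \<psi> x)) = 0"
  proof (rule integral_partial_eq_0)
    show "norm x \<le> R" if "\<phi> x * \<psi> x \<noteq> 0" for x using that test_functionsD(6)[OF \<phi>] R by fastforce
  qed (use cont p test_functionsD(5)[OF \<phi>] test_functionsD(5)[OF \<psi>] in \<open>auto intro: differentiable_mult\<close>)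
  then have "(\<integral>x. \<phi> x * partial i \<psi> x + partial i \<phi> x * \<psi> x \<partial>lebesgue_on \<Omega>) = 0"
    unfolding p using test_functionsD(6)[OF \<phi>] test_functionsD(6)[OF \<psi>]
    by (subst integral_domain_eq) (auto intro!: borel_measurable_continuous_onI cont)
  then show ?thesis
    using integrable_L2_inner[OF test_function_L2[OF \<phi>] test_function_L2[OF d\<psi>]]
      integrable_L2_inner[OF test_function_L2[OF d\<phi>] test_function_L2[OF \<psi>]]
    by (simp add: L2_inner_def)
qed

lemma weak_gradient_iff:
  "weak_gradient \<Omega> u g \<longleftrightarrow>
     (\<forall>\<phi>\<in>test_functions \<Omega>. \<forall>i. L2_inner \<Omega> u (partial i \<phi>) = - L2_inner \<Omega> g (\<lambda>x. \<phi> x *\<^sub>R axis i 1))"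
  unfolding weak_gradient_def L2_inner_def by (simp add: inner_axis mult.commute)

lemma weak_gradient_lin:
  assumes "u \<in> L2 \<Omega>" "v \<in> L2 \<Omega>" "g \<in> L2 \<Omega>" "h \<in> L2 \<Omega>" "weak_gradient \<Omega> u g" "weak_gradient \<Omega> v h"
  shows "weak_gradient \<Omega> (a *\<^sub>R u + b *\<^sub>R v) (a *\<^sub>R g + b *\<^sub>R h)"
  using assms unfolding weak_gradient_iff
  by (simp add: L2r.ip_lin L2v.ip_lin test_axis_L2 test_function_L2 partial_test_functions)

text \<open>This makes \<^const>\<open>grad\<close>, a choice among all weak gradients, linear up to null sets.\<close>

lemma weak_gradient_unique:
  assumes g: "g \<in> L2 \<Omega>" "weak_gradient \<Omega> u g" and h: "h \<in> L2 \<Omega>" "weak_gradient \<Omega> u h"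
  shows "AE x in lebesgue_on \<Omega>. g x = h x"
proof -
  have "AE x in lebesgue_on \<Omega>. \<forall>i\<in>UNIV. g x $ i - h x $ i = 0"
  proof (rule AE_finite_allI)
    fix i :: 'd
    note gi = L2_component[OF g(1), of i] and hi = L2_component[OF h(1), of i]
    have "integrable (lebesgue_on \<Omega>) (\<lambda>x. g x $ i - h x $ i)"
      by (intro Bochner_Integration.integrable_diff L2_integrable gi hi)
    then show "AE x in lebesgue_on \<Omega>. g x $ i - h x $ i = 0"
    proof (rule test_orthogonal_AE_0)
      fix \<phi> assume \<phi>: "\<phi> \<in> test_functions \<Omega>"
      have int: "integrable (lebesgue_on \<Omega>) (\<lambda>x. g x $ i * \<phi> x)" "integrable (lebesgue_on \<Omega>) (\<lambda>x. h x $ i * \<phi> x)"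
        using integrable_L2_inner[OF gi test_function_L2[OF \<phi>]] integrable_L2_inner[OF hi test_function_L2[OF \<phi>]] by auto
      have "(\<integral>x. g x $ i * \<phi> x \<partial>lebesgue_on \<Omega>) = (\<integral>x. h x $ i * \<phi> x \<partial>lebesgue_on \<Omega>)"
        using g(2) h(2) \<phi> unfolding weak_gradient_def by fastforce
      then show "(\<integral>x. (g x $ i - h x $ i) * \<phi> x \<partial>lebesgue_on \<Omega>) = 0"
        using int by (simp add: left_diff_distrib)
    qed
  qed simp
  then show ?thesis by eventually_elim (simp add: vec_eq_iff)
qed

lemma H1_L2: "u \<in> H1 \<Omega> \<Longrightarrow> u \<in> L2 \<Omega>"
  by (simp add: H1_def)

lemma grad_L2: "u \<in> H1 \<Omega> \<Longrightarrow> grad \<Omega> u \<in> L2 \<Omega>"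
  and weak_gradient_grad: "u \<in> H1 \<Omega> \<Longrightarrow> weak_gradient \<Omega> u (grad \<Omega> u)"
proof -
  assume "u \<in> H1 \<Omega>"
  then have "\<exists>g. g \<in> L2 \<Omega> \<and> weak_gradient \<Omega> u g" by (auto simp: H1_def)
  from someI_ex[OF this] show "grad \<Omega> u \<in> L2 \<Omega>" "weak_gradient \<Omega> u (grad \<Omega> u)" by (auto simp: grad_def)
qed

lemma H1I: "u \<in> L2 \<Omega> \<Longrightarrow> g \<in> L2 \<Omega> \<Longrightarrow> weak_gradient \<Omega> u g \<Longrightarrow> u \<in> H1 \<Omega>"
  by (auto simp: H1_def)

lemma grad_AE_eq:
  assumes "u \<in> L2 \<Omega>" "g \<in> L2 \<Omega>" "weak_gradient \<Omega> u g"
  shows "AE x in lebesgue_on \<Omega>. grad \<Omega> u x = g x"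
  using assms grad_L2 weak_gradient_grad H1I by (blast intro: weak_gradient_unique)

lemma H1_lin: "u \<in> H1 \<Omega> \<Longrightarrow> v \<in> H1 \<Omega> \<Longrightarrow> a *\<^sub>R u + b *\<^sub>R v \<in> H1 \<Omega>"
  by (rule H1I[OF L2r.lin_mem L2v.lin_mem weak_gradient_lin[of u v "grad \<Omega> u" "grad \<Omega> v"]])
     (simp_all add: H1_L2 grad_L2 weak_gradient_grad)

lemma grad_lin_AE:
  assumes "u \<in> H1 \<Omega>" "v \<in> H1 \<Omega>"
  shows "AE x in lebesgue_on \<Omega>. grad \<Omega> (a *\<^sub>R u + b *\<^sub>R v) x = a *\<^sub>R grad \<Omega> u x + b *\<^sub>R grad \<Omega> v x"
proof -
  have "AE x in lebesgue_on \<Omega>. grad \<Omega> (a *\<^sub>R u + b *\<^sub>R v) x = (a *\<^sub>R grad \<Omega> u + b *\<^sub>R grad \<Omega> v) x"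
    using assms by (intro grad_AE_eq L2r.lin_mem L2v.lin_mem weak_gradient_lin H1_L2 grad_L2 weak_gradient_grad)
  then show ?thesis by simp
qed

lemma grad_lin: "u \<in> H1 \<Omega> \<Longrightarrow> v \<in> H1 \<Omega> \<Longrightarrow>
    L2_norm \<Omega> (grad \<Omega> (a *\<^sub>R u + b *\<^sub>R v) - (a *\<^sub>R grad \<Omega> u + b *\<^sub>R grad \<Omega> v)) = 0"
  by (rule L2_norm_AE_eq) (use grad_lin_AE in simp)

lemma grad_diff: "u \<in> H1 \<Omega> \<Longrightarrow> v \<in> H1 \<Omega> \<Longrightarrow> L2_norm \<Omega> (grad \<Omega> (u - v) - (grad \<Omega> u - grad \<Omega> v)) = 0"
  using grad_lin[of u v 1 "-1"] by simp

lemma test_weak_gradient: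
  assumes \<phi>: "\<phi> \<in> test_functions \<Omega>"
  shows "weak_gradient \<Omega> \<phi> (\<lambda>x. \<chi> i. partial i \<phi> x)"
  unfolding weak_gradient_def using test_integration_by_parts[OF \<phi>] by (simp add: L2_inner_def)

lemma test_H1: "\<phi> \<in> test_functions \<Omega> \<Longrightarrow> \<phi> \<in> H1 \<Omega>"
  using H1I[OF test_function_L2 test_vector_L2 test_weak_gradient] partial_test_functions by blast

lemma test_grad_AE: "\<phi> \<in> test_functions \<Omega> \<Longrightarrow> AE x in lebesgue_on \<Omega>. grad \<Omega> \<phi> x = (\<chi> i. partial i \<phi> x)"
  by (intro grad_AE_eq test_function_L2 test_vector_L2 test_weak_gradient partial_test_functions)

section \<open>The spaces \<open>H\<^sup>1\<close> and \<open>H\<^sup>1\<^sub>0\<close>\<close>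

definition V_inner :: "(real^'d \<Rightarrow> real) \<Rightarrow> (real^'d \<Rightarrow> real) \<Rightarrow> real" where
  "V_inner u v = L2_inner \<Omega> u v + L2_inner \<Omega> (grad \<Omega> u) (grad \<Omega> v)"

lemma H1_norm_bounds:
  assumes "u \<in> H1 \<Omega>"
  shows "L2_norm \<Omega> u \<le> V_norm \<Omega> u" "L2_norm \<Omega> (grad \<Omega> u) \<le> V_norm \<Omega> u"
  unfolding V_norm_def V_seminorm_def by (auto intro!: real_le_rsqrt)

lemma semi_inner_space_H1: "semi_inner_space (H1 \<Omega>) (V_norm \<Omega>) V_inner"
proof
  show "0 \<in> H1 \<Omega>"
    by (rule H1I[OF L2r.zero_mem L2v.zero_mem]) (simp add: weak_gradient_def)
  fix u v w :: "real^'d \<Rightarrow> real" and a b :: real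
  assume u: "u \<in> H1 \<Omega>"
  show "0 \<le> V_inner u u" using L2r.ip_nonneg[OF H1_L2[OF u]] L2v.ip_nonneg[OF grad_L2[OF u]] by (simp add: V_inner_def)
  show "V_norm \<Omega> u = sqrt (V_inner u u)"
    using L2r.N_sq[OF H1_L2[OF u]] L2v.N_sq[OF grad_L2[OF u]] by (simp add: V_norm_def V_seminorm_def V_inner_def)
  assume v: "v \<in> H1 \<Omega>"
  show uv: "a *\<^sub>R u + b *\<^sub>R v \<in> H1 \<Omega>" by (rule H1_lin[OF u v])
  show "V_inner u v = V_inner v u"
    using L2r.ip_sym[OF H1_L2[OF u] H1_L2[OF v]] L2v.ip_sym[OF grad_L2[OF u] grad_L2[OF v]] by (simp add: V_inner_def)
  assume w: "w \<in> H1 \<Omega>"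
  have "L2_inner \<Omega> (grad \<Omega> (a *\<^sub>R u + b *\<^sub>R v)) (grad \<Omega> w) = L2_inner \<Omega> (a *\<^sub>R grad \<Omega> u + b *\<^sub>R grad \<Omega> v) (grad \<Omega> w)"
    by (intro L2v.ip_cong L2v.lin_mem grad_L2 u v w uv grad_lin)
  then show "V_inner (a *\<^sub>R u + b *\<^sub>R v) w = a * V_inner u w + b * V_inner v w"
    using u v w by (simp add: V_inner_def L2r.ip_lin L2v.ip_lin H1_L2 grad_L2 algebra_simps)
qed

text \<open>Weak gradients are stable under convergence in \<open>L\<^sup>2\<close> because their definition only involves inner products with
  fixed functions.\<close>

sublocale H1: semi_hilbert_space "H1 \<Omega>" "V_norm \<Omega>" V_inner
proof -
  interpret H1: semi_inner_space "H1 \<Omega>" "V_norm \<Omega>" V_inner by (rule semi_inner_space_H1)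
  show "semi_hilbert_space (H1 \<Omega>) (V_norm \<Omega>) V_inner"
  proof
    fix s :: "nat \<Rightarrow> real^'d \<Rightarrow> real"
    assume s: "\<And>n. s n \<in> H1 \<Omega>" "\<And>n. V_norm \<Omega> (s (Suc n) - s n) \<le> (1/2)^n"
    have gd: "L2_norm \<Omega> (grad \<Omega> u - grad \<Omega> v) = L2_norm \<Omega> (grad \<Omega> (u - v))" if "u \<in> H1 \<Omega>" "v \<in> H1 \<Omega>" for u v
      using that L2v.N_cong[OF _ _ grad_diff[OF that]] by (simp add: grad_L2 H1.mem L2v.mem)
    have "\<exists>u\<in>L2 \<Omega>. (\<lambda>n. L2_norm \<Omega> (s n - u)) \<longlonglongrightarrow> 0"
      by (rule L2r.complete) (use s H1_norm_bounds(1)[OF H1.diff_mem[OF s(1) s(1)]] order_trans in \<open>blast intro: H1_L2\<close>)+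
    then obtain u where u: "u \<in> L2 \<Omega>" "(\<lambda>n. L2_norm \<Omega> (s n - u)) \<longlonglongrightarrow> 0" by blast
    have "\<exists>g\<in>L2 \<Omega>. (\<lambda>n. L2_norm \<Omega> (grad \<Omega> (s n) - g)) \<longlonglongrightarrow> 0"
    proof (rule L2v.complete)
      show "grad \<Omega> (s n) \<in> L2 \<Omega>" for n by (intro grad_L2 s)
      show "L2_norm \<Omega> (grad \<Omega> (s (Suc n)) - grad \<Omega> (s n)) \<le> (1/2)^n" for n
        using order_trans[OF H1_norm_bounds(2)[OF H1.diff_mem[OF s(1) s(1)]] s(2)] by (simp add: gd s)
    qed
    then obtain g where g: "g \<in> L2 \<Omega>" "(\<lambda>n. L2_norm \<Omega> (grad \<Omega> (s n) - g)) \<longlonglongrightarrow> 0" by blast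
    have wg: "weak_gradient \<Omega> u g"
      unfolding weak_gradient_iff
    proof (intro ballI allI)
      fix \<phi> i assume \<phi>: "\<phi> \<in> test_functions \<Omega>"
      have "(\<lambda>n. L2_inner \<Omega> (s n) (partial i \<phi>)) \<longlonglongrightarrow> L2_inner \<Omega> u (partial i \<phi>)"
        by (rule L2r.ip_tendsto)
           (use s u test_function_L2[OF partial_test_functions[OF \<phi>]] in \<open>auto intro: H1_L2 simp: L2r.N_zero\<close>)
      moreover have "L2_inner \<Omega> (s n) (partial i \<phi>) = - L2_inner \<Omega> (grad \<Omega> (s n)) (\<lambda>x. \<phi> x *\<^sub>R axis i 1)" for n
        using weak_gradient_grad[OF s(1)] \<phi> by (auto simp: weak_gradient_iff)
      moreover have "(\<lambda>n. - L2_inner \<Omega> (grad \<Omega> (s n)) (\<lambda>x. \<phi> x *\<^sub>R axis i 1)) \<longlonglongrightarrow> - L2_inner \<Omega> g (\<lambda>x. \<phi> x *\<^sub>R axis i 1)"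
        by (rule tendsto_minus, rule L2v.ip_tendsto)
           (use s g test_axis_L2[OF \<phi>] in \<open>auto intro: grad_L2 simp: L2v.N_zero\<close>)
      ultimately show "L2_inner \<Omega> u (partial i \<phi>) = - L2_inner \<Omega> g (\<lambda>x. \<phi> x *\<^sub>R axis i 1)"
        using LIMSEQ_unique by fastforce
    qed
    have uH: "u \<in> H1 \<Omega>" by (rule H1I[OF u(1) g(1) wg])
    have ug: "L2_norm \<Omega> (grad \<Omega> u - g) = 0" by (rule L2_norm_AE_eq[OF grad_AE_eq[OF u(1) g(1) wg]])
    have gs: "L2_norm \<Omega> (grad \<Omega> (s n - u)) \<le> L2_norm \<Omega> (grad \<Omega> (s n) - g)" for n
    proof -
      have "L2_norm \<Omega> (grad \<Omega> (s n) - grad \<Omega> u) \<le> L2_norm \<Omega> (grad \<Omega> (s n) - g) + L2_norm \<Omega> (g - grad \<Omega> u)"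
        by (intro L2v.N_diff_triangle grad_L2 s g uH)
      then show ?thesis using ug L2v.N_minus_commute[OF g(1) grad_L2[OF uH]] by (simp add: gd s uH)
    qed
    have "(\<lambda>n. sqrt ((L2_norm \<Omega> (s n - u))\<^sup>2 + (L2_norm \<Omega> (grad \<Omega> (s n) - g))\<^sup>2)) \<longlonglongrightarrow> sqrt (0\<^sup>2 + 0\<^sup>2)"
      by (intro tendsto_intros u g)
    moreover have "norm (V_norm \<Omega> (s n - u)) \<le> sqrt ((L2_norm \<Omega> (s n - u))\<^sup>2 + (L2_norm \<Omega> (grad \<Omega> (s n) - g))\<^sup>2)" for n
      using gs[of n] L2v.N_nonneg[OF grad_L2[OF H1.diff_mem[OF s(1) uH]]]
      by (auto simp: V_norm_def V_seminorm_def intro!: power_mono)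
    ultimately have "(\<lambda>n. V_norm \<Omega> (s n - u)) \<longlonglongrightarrow> 0" by (rule tendsto_zero_le) simp
    with uH show "\<exists>x\<in>H1 \<Omega>. (\<lambda>n. V_norm \<Omega> (s n - x)) \<longlonglongrightarrow> 0" by blast
  qed
qed

lemma V_H1: "v \<in> V_space \<Omega> \<Longrightarrow> v \<in> H1 \<Omega>"
  by (simp add: V_space_def)

lemma V_L2: "v \<in> V_space \<Omega> \<Longrightarrow> v \<in> L2 \<Omega>"
  by (intro H1_L2 V_H1)

lemma V_spaceI:
  assumes "v \<in> H1 \<Omega>" "\<And>e. 0 < e \<Longrightarrow> \<exists>\<phi>\<in>test_functions \<Omega>. V_norm \<Omega> (\<phi> - v) < e"
  shows "v \<in> V_space \<Omega>"
proof -
  have "\<exists>\<phi>\<in>test_functions \<Omega>. V_norm \<Omega> (\<phi> - v) < (1/2)^n" for n :: nat by (rule assms(2)) simp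
  then obtain \<phi> where \<phi>: "\<And>n. \<phi> n \<in> test_functions \<Omega>" "\<And>n::nat. V_norm \<Omega> (\<phi> n - v) < (1/2)^n" by metis
  have "(\<lambda>n. V_norm \<Omega> (\<phi> n - v)) \<longlonglongrightarrow> 0"
  proof (rule tendsto_zero_le)
    show "(\<lambda>n. (1/2)^n :: real) \<longlonglongrightarrow> 0" by (rule LIMSEQ_realpow_zero) auto
    show "norm (V_norm \<Omega> (\<phi> n - v)) \<le> (1/2)^n" for n
      using \<phi>(2)[of n] H1.N_nonneg[OF H1.diff_mem[OF test_H1[OF \<phi>(1)] assms(1)]] by (simp add: less_imp_le)
  qed simp
  then show ?thesis using \<phi>(1) assms(1) by (auto simp: V_space_def)
qed

lemma V_approx:
  assumes "v \<in> V_space \<Omega>" "0 < e"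
  obtains \<phi> where "\<phi> \<in> test_functions \<Omega>" "V_norm \<Omega> (\<phi> - v) < e"
proof -
  obtain \<phi> where \<phi>: "\<And>n. \<phi> n \<in> test_functions \<Omega>" "(\<lambda>n. V_norm \<Omega> (\<phi> n - v)) \<longlonglongrightarrow> 0"
    using assms(1) by (auto simp: V_space_def)
  have "eventually (\<lambda>n. V_norm \<Omega> (\<phi> n - v) < e) sequentially" using \<phi>(2) assms(2) by (rule order_tendstoD)
  then show thesis using that \<phi>(1) by (auto simp: eventually_sequentially)
qed

text \<open>The closure of the test functions inherits completeness from \<open>H\<^sup>1\<close>.\<close>

sublocale V: semi_hilbert_space "V_space \<Omega>" "V_norm \<Omega>" V_inner
proof
  show "0 \<in> V_space \<Omega>"
  proof (rule V_spaceI[OF H1.zero_mem])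
    have "(\<lambda>x::real^'d. 0 :: real) \<in> flat_algebra" by (rule flat_algebra.const)
    then have "(\<lambda>x. 0) \<in> test_functions \<Omega>"
      using flat_algebra_Ck by (auto simp: test_functions_def)
    then have "0 \<in> test_functions \<Omega>" by (simp add: zero_fun_def)
    then show "\<exists>\<phi>\<in>test_functions \<Omega>. V_norm \<Omega> (\<phi> - 0) < e" if "0 < e" for e
      using that by (intro bexI[of _ 0]) (simp_all add: H1.N_zero)
  qed
  fix u v w :: "real^'d \<Rightarrow> real" and a b :: real
  assume u: "u \<in> V_space \<Omega>"
  note uH = V_H1[OF u]
  show "0 \<le> V_inner u u" by (rule H1.ip_nonneg[OF uH])
  show "V_norm \<Omega> u = sqrt (V_inner u u)" by (rule H1.N_eq[OF uH])
  assume v: "v \<in> V_space \<Omega>"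
  note vH = V_H1[OF v]
  show "V_inner u v = V_inner v u" by (rule H1.ip_sym[OF uH vH])
  show "a *\<^sub>R u + b *\<^sub>R v \<in> V_space \<Omega>"
  proof (rule V_spaceI[OF H1_lin[OF uH vH]])
    fix e :: real assume e: "0 < e"
    define c where "c = \<bar>a\<bar> + \<bar>b\<bar> + 1"
    have c: "0 < c" by (simp add: c_def)
    then have ec: "0 < e / c" using e by simp
    obtain \<phi> where \<phi>: "\<phi> \<in> test_functions \<Omega>" "V_norm \<Omega> (\<phi> - u) < e / c" by (rule V_approx[OF u ec])
    obtain \<psi> where \<psi>: "\<psi> \<in> test_functions \<Omega>" "V_norm \<Omega> (\<psi> - v) < e / c" by (rule V_approx[OF v ec])
    have m: "\<phi> - u \<in> H1 \<Omega>" "\<psi> - v \<in> H1 \<Omega>" 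
      by (rule H1.diff_mem[OF test_H1[OF \<phi>(1)] uH], rule H1.diff_mem[OF test_H1[OF \<psi>(1)] vH])
    have "(a *\<^sub>R \<phi> + b *\<^sub>R \<psi>) - (a *\<^sub>R u + b *\<^sub>R v) = a *\<^sub>R (\<phi> - u) + b *\<^sub>R (\<psi> - v)"
      by (simp add: algebra_simps)
    then have "V_norm \<Omega> ((a *\<^sub>R \<phi> + b *\<^sub>R \<psi>) - (a *\<^sub>R u + b *\<^sub>R v)) \<le> \<bar>a\<bar> * V_norm \<Omega> (\<phi> - u) + \<bar>b\<bar> * V_norm \<Omega> (\<psi> - v)"
      using H1.N_triangle[OF H1.scale_mem[OF m(1)] H1.scale_mem[OF m(2)], of a b] m by (simp add: H1.N_scale)
    also have "\<dots> \<le> \<bar>a\<bar> * (e / c) + \<bar>b\<bar> * (e / c)"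
      using \<phi>(2) \<psi>(2) by (intro add_mono mult_left_mono) auto
    also have "\<dots> = (c - 1) * (e / c)" by (simp only: distrib_right[symmetric]) (simp add: c_def)
    also have "\<dots> < c * (e / c)" using ec by (intro mult_strict_right_mono) auto
    also have "\<dots> = e" using c by simp
    finally show "\<exists>\<phi>\<in>test_functions \<Omega>. V_norm \<Omega> (\<phi> - (a *\<^sub>R u + b *\<^sub>R v)) < e"
      using test_functions_lin[OF \<phi>(1) \<psi>(1), of a b] by blast
  qed
  assume w: "w \<in> V_space \<Omega>"
  show "V_inner (a *\<^sub>R u + b *\<^sub>R v) w = a * V_inner u w + b * V_inner v w" by (rule H1.ip_lin[OF uH vH V_H1[OF w]])
next
  fix s :: "nat \<Rightarrow> real^'d \<Rightarrow> real"
  assume s: "\<And>n. s n \<in> V_space \<Omega>" "\<And>n. V_norm \<Omega> (s (Suc n) - s n) \<le> (1/2)^n"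
  obtain u where u: "u \<in> H1 \<Omega>" "(\<lambda>n. V_norm \<Omega> (s n - u)) \<longlonglongrightarrow> 0"
    using H1.complete[of s] s V_H1 by blast
  have "u \<in> V_space \<Omega>"
  proof (rule V_spaceI[OF u(1)])
    fix e :: real assume e: "0 < e"
    then have e2: "0 < e / 2" by simp
    have "eventually (\<lambda>n. V_norm \<Omega> (s n - u) < e / 2) sequentially" using u(2) e2 by (rule order_tendstoD)
    then obtain n where n: "V_norm \<Omega> (s n - u) < e / 2" by (auto simp: eventually_sequentially)
    obtain \<phi> where \<phi>: "\<phi> \<in> test_functions \<Omega>" "V_norm \<Omega> (\<phi> - s n) < e / 2" by (rule V_approx[OF s(1) e2])
    have "V_norm \<Omega> (\<phi> - u) \<le> V_norm \<Omega> (\<phi> - s n) + V_norm \<Omega> (s n - u)"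
      by (intro H1.N_diff_triangle test_H1 \<phi> V_H1 s u)
    then show "\<exists>\<phi>\<in>test_functions \<Omega>. V_norm \<Omega> (\<phi> - u) < e" using \<phi> n by (intro bexI[of _ \<phi>]) auto
  qed
  then show "\<exists>x\<in>V_space \<Omega>. (\<lambda>n. V_norm \<Omega> (s n - x)) \<longlonglongrightarrow> 0" using u(2) by blast
qed

text \<open>Integrating \<open>\<partial>\<^sub>i (x\<^sub>i \<phi>\<^sup>2)\<close> gives \<open>\<parallel>\<phi>\<parallel>\<^sup>2 = - 2 (x\<^sub>i \<phi>, \<partial>\<^sub>i \<phi>)\<close>.\<close>

lemma poincare_test:
  assumes \<phi>: "\<phi> \<in> test_functions \<Omega>" and R: "0 \<le> R" "\<And>x. x \<in> \<Omega> \<Longrightarrow> norm x \<le> R"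
  shows "L2_norm \<Omega> \<phi> \<le> 2 * R * L2_norm \<Omega> (grad \<Omega> \<phi>)"
proof -
  fix i :: 'd
  note d\<phi> = partial_test_functions[OF \<phi>, of i]
  let ?f = "\<lambda>x::real^'d. x $ i * (\<phi> x * \<phi> x)"
  have c: "((\<lambda>x::real^'d. x $ i) has_derivative (\<lambda>h. h $ i)) (at x)" for x
    by (rule bounded_linear_imp_has_derivative[OF bounded_linear_vec_nth])
  have cd: "(\<lambda>x::real^'d. x $ i) differentiable at x" for x using c by (rule differentiableI)
  have cp: "partial i (\<lambda>x::real^'d. x $ i) x = 1" for x using partial_eq[OF c, of i x] by simp
  have pd: "(\<lambda>x. \<phi> x * \<phi> x) differentiable at x" for x by (intro differentiable_mult test_functionsD(5)[OF \<phi>])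
  have p: "partial i ?f = (\<lambda>x. x $ i * (2 * \<phi> x * partial i \<phi> x) + \<phi> x * \<phi> x)"
    using test_functionsD(5)[OF \<phi>] by (auto simp: partial_mult[OF cd pd] partial_mult cp)
  have cont: "continuous_on UNIV (\<lambda>x. x $ i * (2 * \<phi> x * partial i \<phi> x) + \<phi> x * \<phi> x)"
    by (intro continuous_intros test_functionsD(4)[OF \<phi>] test_functionsD(4)[OF d\<phi>])
  have "integral\<^sup>L lborel (partial i ?f) = 0"
  proof (rule integral_partial_eq_0)
    show "norm x \<le> R" if "?f x \<noteq> 0" for x using that test_functionsD(6)[OF \<phi>] R by fastforce
    show "?f differentiable at x" for x by (intro differentiable_mult cd pd)
  qed (use cont p in simp)
  then have z: "(\<integral>x. x $ i * (2 * \<phi> x * partial i \<phi> x) + \<phi> x * \<phi> x \<partial>lebesgue_on \<Omega>) = 0"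
    unfolding p using test_functionsD(6)[OF \<phi>]
    by (subst integral_domain_eq) (auto intro!: borel_measurable_continuous_onI cont)
  note \<phi>2 = test_function_L2[OF \<phi>] and d\<phi>2 = test_function_L2[OF d\<phi>]
  define X where "X x = (if x \<in> \<Omega> then x $ i * \<phi> x else 0)" for x
  have Xeq: "X = (\<lambda>x. x $ i * \<phi> x)" using test_functionsD(6)[OF \<phi>] by (auto simp: X_def)
  obtain B where B: "\<And>x. \<bar>\<phi> x\<bar> \<le> B" by (rule bounded_test_function[OF \<phi>]) (rule that)
  have Xm: "X \<in> borel_measurable (lebesgue_on \<Omega>)"
    unfolding Xeq by (intro borel_measurable_continuous_domain continuous_intros test_functionsD(4)[OF \<phi>])
  have Xb: "\<bar>X x\<bar> \<le> R * \<bar>\<phi> x\<bar>" for x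
    using R component_le_norm_cart[of x i] by (auto simp: X_def abs_mult intro!: mult_right_mono order_trans[OF component_le_norm_cart])
  have X2: "X \<in> L2 \<Omega>"
    by (rule L2_bounded[OF Xm, of "R * B"]) (use order_trans[OF Xb mult_left_mono[OF B R(1)]] in simp)
  have "L2_norm \<Omega> X \<le> R * L2_norm \<Omega> \<phi>"
  proof (rule L2I_nn_integral(2)[OF Xm])
    have "(\<integral>\<^sup>+x. ennreal ((norm (X x))\<^sup>2) \<partial>lebesgue_on \<Omega>) \<le> (\<integral>\<^sup>+x. ennreal ((norm ((R *\<^sub>R \<phi>) x))\<^sup>2) \<partial>lebesgue_on \<Omega>)"
      using Xb R by (intro nn_integral_mono ennreal_leI power_mono) (auto simp: abs_mult)
    also have "\<dots> = ennreal ((R * L2_norm \<Omega> \<phi>)\<^sup>2)"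
      unfolding nn_integral_L2[OF L2r.scale_mem[OF \<phi>2]] using R by (simp add: L2r.N_scale[OF \<phi>2])
    finally show "(\<integral>\<^sup>+x. ennreal ((norm (X x))\<^sup>2) \<partial>lebesgue_on \<Omega>) \<le> ennreal ((R * L2_norm \<Omega> \<phi>)\<^sup>2)" .
  qed (use R L2r.N_nonneg[OF \<phi>2] in simp)
  moreover have "(L2_norm \<Omega> \<phi>)\<^sup>2 = - 2 * L2_inner \<Omega> X (partial i \<phi>)"
  proof -
    have "0 = (\<integral>x. 2 * (X x * partial i \<phi> x) + \<phi> x * \<phi> x \<partial>lebesgue_on \<Omega>)"
      unfolding Xeq using z by (simp add: mult_ac)
    also have "\<dots> = 2 * L2_inner \<Omega> X (partial i \<phi>) + L2_inner \<Omega> \<phi> \<phi>"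
      using integrable_L2_inner[OF X2 d\<phi>2] integrable_L2_inner[OF \<phi>2 \<phi>2] by (simp add: L2_inner_def)
    finally show ?thesis using L2r.N_sq[OF \<phi>2] by simp
  qed
  moreover have "\<bar>L2_inner \<Omega> X (partial i \<phi>)\<bar> \<le> L2_norm \<Omega> X * L2_norm \<Omega> (partial i \<phi>)"
    by (rule L2r.cauchy_schwarz[OF X2 d\<phi>2])
  moreover have "L2_norm \<Omega> (partial i \<phi>) \<le> L2_norm \<Omega> (grad \<Omega> \<phi>)"
  proof (rule L2I_nn_integral(2)[OF L2D(1)[OF d\<phi>2]])
    have "AE x in lebesgue_on \<Omega>. ennreal ((norm (partial i \<phi> x))\<^sup>2) \<le> ennreal ((norm (grad \<Omega> \<phi> x))\<^sup>2)"
      using test_grad_AE[OF \<phi>]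
    proof eventually_elim
      case (elim x)
      have "norm (partial i \<phi> x) = norm (grad \<Omega> \<phi> x $ i)" using elim by simp
      also have "\<dots> \<le> norm (grad \<Omega> \<phi> x)" by (rule Finite_Cartesian_Product.norm_nth_le)
      finally show ?case by (intro ennreal_leI power_mono) auto
    qed
    then have "(\<integral>\<^sup>+x. ennreal ((norm (partial i \<phi> x))\<^sup>2) \<partial>lebesgue_on \<Omega>) \<le> (\<integral>\<^sup>+x. ennreal ((norm (grad \<Omega> \<phi> x))\<^sup>2) \<partial>lebesgue_on \<Omega>)"
      by (rule nn_integral_mono_AE)
    then show "(\<integral>\<^sup>+x. ennreal ((norm (partial i \<phi> x))\<^sup>2) \<partial>lebesgue_on \<Omega>) \<le> ennreal ((L2_norm \<Omega> (grad \<Omega> \<phi>))\<^sup>2)"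
      by (simp only: nn_integral_L2[OF grad_L2[OF test_H1[OF \<phi>]]])
  qed (rule L2v.N_nonneg[OF grad_L2[OF test_H1[OF \<phi>]]])
  ultimately have "L2_norm \<Omega> \<phi> * L2_norm \<Omega> \<phi> \<le> L2_norm \<Omega> \<phi> * (2 * R * L2_norm \<Omega> (grad \<Omega> \<phi>))"
  proof -
    assume a: "L2_norm \<Omega> X \<le> R * L2_norm \<Omega> \<phi>" "(L2_norm \<Omega> \<phi>)\<^sup>2 = - 2 * L2_inner \<Omega> X (partial i \<phi>)"
      "\<bar>L2_inner \<Omega> X (partial i \<phi>)\<bar> \<le> L2_norm \<Omega> X * L2_norm \<Omega> (partial i \<phi>)"
      "L2_norm \<Omega> (partial i \<phi>) \<le> L2_norm \<Omega> (grad \<Omega> \<phi>)"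
    have "L2_norm \<Omega> X * L2_norm \<Omega> (partial i \<phi>) \<le> (R * L2_norm \<Omega> \<phi>) * L2_norm \<Omega> (grad \<Omega> \<phi>)"
      using a(1,4) R L2r.N_nonneg[OF \<phi>2] L2r.N_nonneg[OF d\<phi>2] by (intro mult_mono) auto
    then have "(L2_norm \<Omega> \<phi>)\<^sup>2 \<le> 2 * ((R * L2_norm \<Omega> \<phi>) * L2_norm \<Omega> (grad \<Omega> \<phi>))" using a(2,3) by linarith
    then show ?thesis by (simp only: power2_eq_square mult_ac)
  qed
  then show ?thesis
    using L2r.N_nonneg[OF \<phi>2] L2v.N_nonneg[OF grad_L2[OF test_H1[OF \<phi>]]] R
    by (cases "L2_norm \<Omega> \<phi> = 0") auto
qed

theorem poincare:
  obtains C where "0 \<le> C" "\<And>v. v \<in> V_space \<Omega> \<Longrightarrow> V_norm \<Omega> v \<le> C * V_seminorm \<Omega> v"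
proof -
  obtain R where R: "0 \<le> R" "\<And>x. x \<in> \<Omega> \<Longrightarrow> norm x \<le> R"
    using bounded_domain unfolding bounded_pos by (meson less_imp_le)
  have L2: "L2_norm \<Omega> v \<le> 2 * R * L2_norm \<Omega> (grad \<Omega> v)" if v: "v \<in> V_space \<Omega>" for v
  proof -
    note vH = V_H1[OF v]
    obtain \<phi> where \<phi>: "\<And>n. \<phi> n \<in> test_functions \<Omega>" "(\<lambda>n. V_norm \<Omega> (\<phi> n - v)) \<longlonglongrightarrow> 0"
      using v by (auto simp: V_space_def)
    note \<phi>H = test_H1[OF \<phi>(1)]
    have m: "\<phi> n - v \<in> H1 \<Omega>" for n by (intro H1.diff_mem \<phi>H vH)
    have "(\<lambda>n. L2_norm \<Omega> (\<phi> n - v)) \<longlonglongrightarrow> 0"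
      using \<phi>(2)
      by (rule tendsto_zero_le) (simp_all add: H1_norm_bounds(1)[OF m] L2r.N_nonneg[OF H1_L2[OF m]])
    then have 1: "(\<lambda>n. L2_norm \<Omega> (\<phi> n)) \<longlonglongrightarrow> L2_norm \<Omega> v"
      by (intro L2r.N_tendsto H1_L2 \<phi>H vH)
    have eq: "L2_norm \<Omega> (grad \<Omega> (\<phi> n) - grad \<Omega> v) = L2_norm \<Omega> (grad \<Omega> (\<phi> n - v))" for n
      using L2v.N_cong[OF _ _ grad_diff[OF \<phi>H vH]] by (simp add: grad_L2 m \<phi>H vH L2v.mem)
    have "(\<lambda>n. L2_norm \<Omega> (grad \<Omega> (\<phi> n) - grad \<Omega> v)) \<longlonglongrightarrow> 0"
      unfolding eq using \<phi>(2)
      by (rule tendsto_zero_le) (simp_all add: H1_norm_bounds(2)[OF m] L2v.N_nonneg[OF grad_L2[OF m]])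
    then have 2: "(\<lambda>n. L2_norm \<Omega> (grad \<Omega> (\<phi> n))) \<longlonglongrightarrow> L2_norm \<Omega> (grad \<Omega> v)"
      by (intro L2v.N_tendsto grad_L2 \<phi>H vH)
    show ?thesis
      by (rule LIMSEQ_le[OF 1 tendsto_mult[OF tendsto_const 2]]) (use poincare_test[OF \<phi>(1) R] in auto)
  qed
  show thesis
  proof (rule that[of "2 * R + 1"])
    fix v assume v: "v \<in> V_space \<Omega>"
    let ?g = "L2_norm \<Omega> (grad \<Omega> v)"
    have g: "0 \<le> ?g" by (rule L2v.N_nonneg[OF grad_L2[OF V_H1[OF v]]])
    have "V_norm \<Omega> v \<le> L2_norm \<Omega> v + ?g"
      unfolding V_norm_def V_seminorm_def by (rule sqrt_sum_squares_le_sum[OF L2r.N_nonneg[OF V_L2[OF v]] g])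
    also have "\<dots> \<le> (2 * R + 1) * ?g" using L2[OF v] by (simp add: algebra_simps)
    finally show "V_norm \<Omega> v \<le> (2 * R + 1) * V_seminorm \<Omega> v" by (simp add: V_seminorm_def)
  qed (use R in simp)
qed

end

section \<open>Square integrable functions with values in a Hilbert space\<close>

context semi_hilbert_space
begin

text \<open>A summable sequence of steps is turned into steps of geometric size by passing to a subsequence.\<close>

lemma complete_summable:
  assumes s: "\<And>n. s n \<in> X" and sum: "summable (\<lambda>n. N (s (Suc n) - s n))"
  obtains x where "x \<in> X" "(\<lambda>n. N (s n - x)) \<longlonglongrightarrow> 0"
proof -
  let ?d = "\<lambda>n. N (s (Suc n) - s n)"
  have d0: "0 \<le> ?d n" for n by (intro N_nonneg mem s)
  have dist: "N (s n - s m) \<le> (\<Sum>k. ?d (k + m))" if "m \<le> n" for m n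
  proof -
    have "N (s (m + j) - s m) \<le> (\<Sum>k<j. ?d (k + m))" for j
    proof (induction j)
      case (Suc j)
      have "N (s (m + Suc j) - s m) \<le> N (s (Suc (m + j)) - s (m + j)) + N (s (m + j) - s m)"
        using N_diff_triangle[of "s (Suc (m + j))" "s (m + j)" "s m"] s by simp
      then show ?case using Suc by (simp add: add.commute)
    qed (simp add: N_zero)
    also have "(\<Sum>k<j. ?d (k + m)) \<le> (\<Sum>k. ?d (k + m))" for j
      by (intro sum_le_suminf summable_ignore_initial_segment sum d0) auto
    finally show ?thesis using that le_Suc_ex by blast
  qed
  have tail: "(\<lambda>m. \<Sum>k. ?d (k + m)) \<longlonglongrightarrow> 0"
    by (rule suminf_exist_split2[OF sum])
  have "\<exists>m0. \<forall>m\<ge>m0. (\<Sum>k. ?d (k + m)) < (1/2)^n" for n :: nat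
    using order_tendstoD(2)[OF tail, of "(1/2)^n"] by (auto simp: eventually_sequentially)
  then obtain m0 where m0: "\<And>n::nat. \<And>m. m \<ge> m0 n \<Longrightarrow> (\<Sum>k. ?d (k + m)) < (1/2)^n" by metis
  \<comment> \<open>a nondecreasing majorant of \<open>m0\<close>\<close>
  define m where "m n = (\<Sum>k\<le>n. m0 k)" for n
  have m: "m0 n \<le> m n" "m n \<le> m (Suc n)" for n
    unfolding m_def by (auto intro: member_le_sum)
  have "\<exists>x\<in>X. (\<lambda>n. N (s (m n) - x)) \<longlonglongrightarrow> 0"
  proof (rule complete)
    show "N (s (m (Suc n)) - s (m n)) \<le> (1/2)^n" for n
      using dist[OF m(2)[of n]] m0[OF m(1)[of n]] by simp
  qed (rule s)
  then obtain x where x: "x \<in> X" "(\<lambda>n. N (s (m n) - x)) \<longlonglongrightarrow> 0" by blast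
  have "(\<lambda>n. N (s n - x)) \<longlonglongrightarrow> 0"
  proof (rule LIMSEQ_I)
    fix e :: real assume e: "0 < e"
    have "eventually (\<lambda>n. N (s (m n) - x) < e / 2) sequentially" using x(2) e by (intro order_tendstoD) auto
    moreover have "eventually (\<lambda>n. (1/2)^n < e / 2) sequentially"
      using e by (intro order_tendstoD[OF LIMSEQ_realpow_zero]) auto
    ultimately have "eventually (\<lambda>n. N (s (m n) - x) < e / 2 \<and> (1/2)^n < e / 2) sequentially"
      by eventually_elim auto
    then obtain n where n: "N (s (m n) - x) < e / 2" "(1/2)^n < e / 2" by (auto simp: eventually_sequentially)
    have "norm (N (s k - x) - 0) < e" if "m n \<le> k" for k
      using N_diff_triangle[of "s k" "s (m n)" x] dist[OF that] m0[OF m(1)[of n]] n N_nonneg[of "s k - x"] s x(1)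
      by (simp add: mem)
    then show "\<exists>no. \<forall>k\<ge>no. norm (N (s k - x) - 0) < e" by blast
  qed
  then show thesis using that x(1) by blast
qed

definition bochner_L2 :: "'m measure \<Rightarrow> ('m \<Rightarrow> 'a) set" where
  "bochner_L2 M = {f. strongly_measurable X N M f \<and> (\<integral>\<^sup>+t. ennreal (ip (f t) (f t)) \<partial>M) < \<infinity>}"

definition bochner_L2_inner :: "'m measure \<Rightarrow> ('m \<Rightarrow> 'a) \<Rightarrow> ('m \<Rightarrow> 'a) \<Rightarrow> real" where
  "bochner_L2_inner M f g = (\<integral>t. ip (f t) (g t) \<partial>completion M)"

definition bochner_L2_norm :: "'m measure \<Rightarrow> ('m \<Rightarrow> 'a) \<Rightarrow> real" where
  "bochner_L2_norm M f = sqrt (enn2real (\<integral>\<^sup>+t. ennreal (ip (f t) (f t)) \<partial>M))"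

lemma bochner_L2D:
  assumes "f \<in> bochner_L2 M"
  shows "strongly_measurable X N M f" "t \<in> space M \<Longrightarrow> f t \<in> X"
  using assms strongly_measurable_mem by (auto simp: bochner_L2_def)

lemma bochner_L2_integrable_sq:
  assumes f: "f \<in> bochner_L2 M"
  shows "integrable (completion M) (\<lambda>t. ip (f t) (f t))"
proof (rule integrableI_bounded)
  show "(\<lambda>t. ip (f t) (f t)) \<in> borel_measurable (completion M)"
    by (intro borel_measurable_ip bochner_L2D[OF f])
  have "(\<integral>\<^sup>+t. ennreal (norm (ip (f t) (f t))) \<partial>completion M) = (\<integral>\<^sup>+t. ennreal (ip (f t) (f t)) \<partial>completion M)"
    by (rule nn_integral_cong) (simp add: ip_nonneg bochner_L2D[OF f])
  also have "\<dots> < \<infinity>" using f by (simp add: bochner_L2_def nn_integral_completion)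
  finally show "(\<integral>\<^sup>+t. ennreal (norm (ip (f t) (f t))) \<partial>completion M) < \<infinity>" .
qed

lemma bochner_L2_integrable:
  assumes f: "f \<in> bochner_L2 M" and g: "g \<in> bochner_L2 M"
  shows "integrable (completion M) (\<lambda>t. ip (f t) (g t))"
proof (rule Bochner_Integration.integrable_bound)
  show "integrable (completion M) (\<lambda>t. ip (f t) (f t) + ip (g t) (g t))"
    by (intro Bochner_Integration.integrable_add bochner_L2_integrable_sq f g)
  show "(\<lambda>t. ip (f t) (g t)) \<in> borel_measurable (completion M)"
    by (intro borel_measurable_ip bochner_L2D[OF f] bochner_L2D[OF g])
  show "AE t in completion M. norm (ip (f t) (g t)) \<le> norm (ip (f t) (f t) + ip (g t) (g t))"
  proof (rule AE_I2)
    fix t assume "t \<in> space (completion M)"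
    then have m: "f t \<in> X" "g t \<in> X" using bochner_L2D[OF f] bochner_L2D[OF g] by auto
    have "\<bar>ip (f t) (g t)\<bar> \<le> N (f t) * N (g t)" by (rule cauchy_schwarz[OF m])
    also have "\<dots> \<le> (N (f t))\<^sup>2 + (N (g t))\<^sup>2"
      using sum_squares_bound[of "N (f t)" "N (g t)"] mult_nonneg_nonneg[OF N_nonneg[OF m(1)] N_nonneg[OF m(2)]]
      unfolding mult.assoc by linarith
    finally show "norm (ip (f t) (g t)) \<le> norm (ip (f t) (f t) + ip (g t) (g t))"
      using m by (simp add: N_sq ip_nonneg)
  qed
qed

lemma nn_integral_bochner_L2:
  assumes f: "f \<in> bochner_L2 M"
  shows "(\<integral>\<^sup>+t. ennreal (ip (f t) (f t)) \<partial>M) = ennreal (bochner_L2_inner M f f)"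
proof -
  have "(\<integral>\<^sup>+t. ennreal (ip (f t) (f t)) \<partial>completion M) = ennreal (bochner_L2_inner M f f)"
    unfolding bochner_L2_inner_def
    by (rule nn_integral_eq_integral[OF bochner_L2_integrable_sq[OF f]])
       (use bochner_L2D[OF f] in \<open>auto intro!: AE_I2 ip_nonneg\<close>)
  then show ?thesis by (simp add: nn_integral_completion)
qed

lemma semi_inner_space_bochner_L2:
  "semi_inner_space (bochner_L2 M) (bochner_L2_norm M) (bochner_L2_inner M)"
proof
  show "0 \<in> bochner_L2 M"
    using strongly_measurable_const[OF zero_mem, of M] by (simp add: bochner_L2_def ip_zero zero_mem zero_fun_def)
  fix f g h and a b :: real
  assume f: "f \<in> bochner_L2 M"
  show pos: "0 \<le> bochner_L2_inner M f f"
    unfolding bochner_L2_inner_def using bochner_L2D[OF f] by (intro integral_nonneg_AE AE_I2 ip_nonneg) auto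
  show "bochner_L2_norm M f = sqrt (bochner_L2_inner M f f)"
    unfolding bochner_L2_norm_def nn_integral_bochner_L2[OF f] using pos by simp
  assume g: "g \<in> bochner_L2 M"
  show "bochner_L2_inner M f g = bochner_L2_inner M g f"
    unfolding bochner_L2_inner_def
    by (rule Bochner_Integration.integral_cong) (use bochner_L2D[OF f] bochner_L2D[OF g] ip_sym in auto)
  have sq: "ip (a *\<^sub>R f t + b *\<^sub>R g t) (a *\<^sub>R f t + b *\<^sub>R g t)
      = a\<^sup>2 * ip (f t) (f t) + 2 * a * b * ip (f t) (g t) + b\<^sup>2 * ip (g t) (g t)" if "t \<in> space M" for t
    using bochner_L2D(2)[OF f that] bochner_L2D(2)[OF g that] ip_sym[of "g t" "f t"]
    by (simp add: ip_add ip_add_right ip_scale ip_scale_right mem power2_eq_square distrib_left)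
  have "(\<integral>\<^sup>+t. ennreal (ip ((a *\<^sub>R f + b *\<^sub>R g) t) ((a *\<^sub>R f + b *\<^sub>R g) t)) \<partial>M) < \<infinity>"
  proof -
    have int: "integrable (completion M) (\<lambda>t. a\<^sup>2 * ip (f t) (f t) + 2 * a * b * ip (f t) (g t) + b\<^sup>2 * ip (g t) (g t))"
      by (intro Bochner_Integration.integrable_add integrable_mult_right bochner_L2_integrable f g)
    have "(\<integral>\<^sup>+t. ennreal (a\<^sup>2 * ip (f t) (f t) + 2 * a * b * ip (f t) (g t) + b\<^sup>2 * ip (g t) (g t)) \<partial>completion M) < \<infinity>"
      by (rule le_less_trans[OF nn_integral_mono[OF ennreal_leI[OF abs_ge_self]]])
         (use int in \<open>simp add: integrable_iff_bounded\<close>)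
    then show ?thesis
      unfolding nn_integral_completion
      by (rule le_less_trans[rotated]) (auto intro!: nn_integral_mono simp: sq)
  qed
  moreover have "strongly_measurable X N M (a *\<^sub>R f + b *\<^sub>R g)"
    using strongly_measurable_lin[OF bochner_L2D(1)[OF f] bochner_L2D(1)[OF g], of a b]
    by (simp add: plus_fun_def scaleR_fun_def)
  ultimately show "a *\<^sub>R f + b *\<^sub>R g \<in> bochner_L2 M" by (simp add: bochner_L2_def)
  assume h: "h \<in> bochner_L2 M"
  have "bochner_L2_inner M (a *\<^sub>R f + b *\<^sub>R g) h = (\<integral>t. a * ip (f t) (h t) + b * ip (g t) (h t) \<partial>completion M)"
    unfolding bochner_L2_inner_def
    by (rule Bochner_Integration.integral_cong)
       (use bochner_L2D[OF f] bochner_L2D[OF g] bochner_L2D[OF h] in \<open>auto simp: ip_lin\<close>)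
  also have "\<dots> = a * bochner_L2_inner M f h + b * bochner_L2_inner M g h"
    using bochner_L2_integrable[OF f h] bochner_L2_integrable[OF g h] by (simp add: bochner_L2_inner_def)
  finally show "bochner_L2_inner M (a *\<^sub>R f + b *\<^sub>R g) h = a * bochner_L2_inner M f h + b * bochner_L2_inner M g h" .
qed

lemma bochner_L2_integrable_norm:
  assumes fin: "finite_measure M" and f: "f \<in> bochner_L2 M"
  shows "(\<integral>\<^sup>+t. ennreal (N (f t)) \<partial>M) < \<infinity>"
proof -
  interpret finite_measure M by fact
  have "(\<integral>\<^sup>+t. ennreal (N (f t)) \<partial>M) \<le> (\<integral>\<^sup>+t. ennreal (ip (f t) (f t)) + 1 \<partial>M)"
  proof (rule nn_integral_mono)
    fix t assume "t \<in> space M"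
    then have m: "f t \<in> X" by (rule bochner_L2D(2)[OF f])
    have "N (f t) \<le> ip (f t) (f t) + 1" using AM_GM_weighted[of 1 "N (f t)"] by (simp add: N_sq m)
    then show "ennreal (N (f t)) \<le> ennreal (ip (f t) (f t)) + 1"
      using ip_nonneg[OF m] by (simp flip: ennreal_1 ennreal_plus)
  qed
  also have "\<dots> = (\<integral>\<^sup>+t. ennreal (ip (f t) (f t)) + 1 \<partial>completion M)" by (simp add: nn_integral_completion)
  also have "\<dots> = (\<integral>\<^sup>+t. ennreal (ip (f t) (f t)) \<partial>completion M) + (\<integral>\<^sup>+t. 1 \<partial>completion M)"
    by (intro nn_integral_add measurable_compose[OF _ measurable_ennreal] borel_measurable_ip bochner_L2D[OF f]) auto
  also have "\<dots> < \<infinity>"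
    unfolding nn_integral_completion using f by (simp add: bochner_L2_def less_top[symmetric])
  finally show ?thesis .
qed

text \<open>As for \<open>L\<^sup>2\<close>, the limit is taken pointwise almost everywhere. For its strong measurability each member of the
  sequence is replaced by a simple function; the errors are summable in \<open>L\<^sup>1\<close> and so tend to zero almost everywhere.\<close>

theorem semi_hilbert_space_bochner_L2:
  assumes fin: "finite_measure M"
  shows "semi_hilbert_space (bochner_L2 M) (bochner_L2_norm M) (bochner_L2_inner M)"
proof -
  interpret B: semi_inner_space "bochner_L2 M" "bochner_L2_norm M" "bochner_L2_inner M"
    by (rule semi_inner_space_bochner_L2)
  show ?thesis
  proof
    fix f :: "nat \<Rightarrow> 'b \<Rightarrow> 'a"
    assume f: "\<And>n. f n \<in> bochner_L2 M" "\<And>n. bochner_L2_norm M (f (Suc n) - f n) \<le> (1/2)^n"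
    note fX = bochner_L2D(2)[OF f(1)] and fm = bochner_L2D(1)[OF f(1)]
    have sq: "(\<integral>\<^sup>+t. ennreal (ip (f (n + k) t - f n t) (f (n + k) t - f n t)) \<partial>M) \<le> ennreal ((2 * (1/2)^n)\<^sup>2)" for n k
    proof -
      have "(\<integral>\<^sup>+t. ennreal (ip (f (n + k) t - f n t) (f (n + k) t - f n t)) \<partial>M)
          = ennreal (bochner_L2_inner M (f (n + k) - f n) (f (n + k) - f n))"
        using nn_integral_bochner_L2[OF B.diff_mem[OF f(1) f(1)]] by simp
      also have "\<dots> = ennreal ((bochner_L2_norm M (f (n + k) - f n))\<^sup>2)"
        by (simp add: B.N_sq B.mem f)
      also have "\<dots> \<le> ennreal ((2 * (1/2)^n)\<^sup>2)"
        by (intro ennreal_leI power_mono B.rapid_dist f B.N_nonneg B.mem)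
      finally show ?thesis .
    qed
    have "AE t in M. summable (\<lambda>n. N (f (Suc n) t - f n t))"
    proof (rule AE_summable_of_rapid[OF fin, where C=4])
      fix n
      show "(\<lambda>t. N (f (Suc n) t - f n t)) \<in> borel_measurable (completion M)"
        by (intro borel_measurable_N strongly_measurable_diff fm)
      show "0 \<le> N (f (Suc n) t - f n t)" if "t \<in> space M" for t using that by (intro N_nonneg mem fX)
      have "(\<integral>\<^sup>+t. ennreal ((N (f (Suc n) t - f n t))\<^sup>2) \<partial>M) = (\<integral>\<^sup>+t. ennreal (ip (f (n + 1) t - f n t) (f (n + 1) t - f n t)) \<partial>M)"
        by (rule nn_integral_cong) (simp add: N_sq mem fX)
      also have "\<dots> \<le> ennreal (4 * (1/4)^n)"
        using sq[of n 1] by (simp add: power_mult_distrib power2_eq_square flip: power_mult_distrib)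
      finally show "(\<integral>\<^sup>+t. ennreal ((N (f (Suc n) t - f n t))\<^sup>2) \<partial>M) \<le> ennreal (4 * (1/4)^n)" .
    qed simp
    \<comment> \<open>the value \<open>0\<close> on the exceptional null set keeps \<open>F\<close> in the carrier everywhere\<close>
    define F where "F t = (if \<exists>x\<in>X. (\<lambda>n. N (f n t - x)) \<longlonglongrightarrow> 0 then SOME x. x \<in> X \<and> (\<lambda>n. N (f n t - x)) \<longlonglongrightarrow> 0 else 0)" for t
    have F: "F t \<in> X" "(\<exists>x\<in>X. (\<lambda>n. N (f n t - x)) \<longlonglongrightarrow> 0) \<Longrightarrow> (\<lambda>n. N (f n t - F t)) \<longlonglongrightarrow> 0" for t
    proof -
      have "F t \<in> X \<and> (\<lambda>n. N (f n t - F t)) \<longlonglongrightarrow> 0" if ex: "\<exists>x\<in>X. (\<lambda>n. N (f n t - x)) \<longlonglongrightarrow> 0"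
        unfolding F_def using ex someI_ex[of "\<lambda>x. x \<in> X \<and> (\<lambda>n. N (f n t - x)) \<longlonglongrightarrow> 0"] by auto
      then show "F t \<in> X" "(\<exists>x\<in>X. (\<lambda>n. N (f n t - x)) \<longlonglongrightarrow> 0) \<Longrightarrow> (\<lambda>n. N (f n t - F t)) \<longlonglongrightarrow> 0"
        by (auto simp: F_def zero_mem)
    qed
    have lim: "AE t in M. (\<lambda>n. N (f n t - F t)) \<longlonglongrightarrow> 0"
      using \<open>AE t in M. summable (\<lambda>n. N (f (Suc n) t - f n t))\<close> AE_space[of M]
    proof eventually_elim
      case (elim t)
      obtain x where "x \<in> X" "(\<lambda>n. N (f n t - x)) \<longlonglongrightarrow> 0"
        by (rule complete_summable[of "\<lambda>n. f n t"]) (use elim fX in auto)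
      then show ?case by (intro F) blast
    qed
    have "\<exists>s. simple_function M s \<and> (\<forall>t\<in>space M. s t \<in> X) \<and> (\<integral>\<^sup>+t. ennreal (N (f n t - s t)) \<partial>M) < ennreal ((1/2)^n)" for n
    proof -
      obtain s where s: "\<And>k. simple_function M (s k)" "\<And>k t. t \<in> space M \<Longrightarrow> s k t \<in> X"
        "(\<lambda>k. \<integral>\<^sup>+t. ennreal (N (f n t - s k t)) \<partial>M) \<longlonglongrightarrow> 0"
        by (rule simple_approx[OF fm bochner_L2_integrable_norm[OF fin f(1)]]) (rule that)
      have "eventually (\<lambda>k. (\<integral>\<^sup>+t. ennreal (N (f n t - s k t)) \<partial>M) < ennreal ((1/2)^n)) sequentially"
        using s(3) by (rule order_tendstoD) simp
      then obtain k where "(\<integral>\<^sup>+t. ennreal (N (f n t - s k t)) \<partial>M) < ennreal ((1/2)^n)"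
        by (auto simp: eventually_sequentially)
      then show ?thesis using s(1,2) by (intro exI[of _ "s k"]) auto
    qed
    then obtain s where s: "\<And>n. simple_function M (s n)" "\<And>n t. t \<in> space M \<Longrightarrow> s n t \<in> X"
      "\<And>n. (\<integral>\<^sup>+t. ennreal (N (f n t - s n t)) \<partial>M) < ennreal ((1/2)^n)" by metis
    have "AE t in M. summable (\<lambda>n. N (f n t - s n t))"
    proof (rule AE_summable_of_nn_integral[where b="\<lambda>n. (1/2)^n"])
      show "(\<lambda>t. N (f n t - s n t)) \<in> borel_measurable (completion M)" for n
        by (intro borel_measurable_N strongly_measurable_diff fm strongly_measurable_simple s)
    qed (auto intro!: N_nonneg mem fX s less_imp_le[OF s(3)] summable_geometric)
    then have near: "AE t in M. (\<lambda>n. N (f n t - s n t)) \<longlonglongrightarrow> 0"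
      by eventually_elim (rule summable_LIMSEQ_zero)
    have Fm: "strongly_measurable X N M F"
    proof (rule strongly_measurableI_lim[where s=s])
      show "AE t in M. (\<lambda>n. N (s n t - F t)) \<longlonglongrightarrow> 0"
        using near lim AE_space[of M]
      proof eventually_elim
        case (elim t)
        have "(\<lambda>n. N (f n t - s n t) + N (f n t - F t)) \<longlonglongrightarrow> 0 + 0" by (intro tendsto_add elim)
        moreover have "norm (N (s n t - F t)) \<le> N (f n t - s n t) + N (f n t - F t)" for n
          using N_diff_triangle[of "s n t" "f n t" "F t"] N_minus_commute[of "s n t" "f n t"] N_nonneg[of "s n t - F t"]
            elim(3) by (simp add: s fX F mem)
        ultimately show ?case by (rule tendsto_zero_le) simp
      qed
    qed (use F s in auto)
    have est: "F - f n \<in> bochner_L2 M" "bochner_L2_norm M (F - f n) \<le> 2 * (1/2)^n" for n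
    proof -
      have le: "(\<integral>\<^sup>+t. ennreal (ip ((F - f n) t) ((F - f n) t)) \<partial>M) \<le> ennreal ((2 * (1/2)^n)\<^sup>2)"
      proof (rule nn_integral_AE_limit_le)
        show "(\<lambda>t. ip (f (n + k) t - f n t) (f (n + k) t - f n t)) \<in> borel_measurable (completion M)" for k
          by (intro borel_measurable_ip strongly_measurable_diff fm)
        show "AE t in M. (\<lambda>k. ip (f (n + k) t - f n t) (f (n + k) t - f n t)) \<longlonglongrightarrow> ip ((F - f n) t) ((F - f n) t)"
          using lim AE_space[of M]
        proof eventually_elim
          case (elim t)
          have "(\<lambda>k. N (f (k + n) t - F t)) \<longlonglongrightarrow> 0" using elim(1) by (rule LIMSEQ_ignore_initial_segment)
          then have "(\<lambda>k. N (f (n + k) t - f n t - (F t - f n t))) \<longlonglongrightarrow> 0" by (simp add: add.commute)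
          then show ?case using elim(2) by (auto intro!: ip_tendsto mem fX F)
        qed
      qed (rule sq)
      moreover have "strongly_measurable X N M (F - f n)"
        using strongly_measurable_diff[OF Fm fm[of n]] by (simp add: fun_diff_def)
      ultimately show m: "F - f n \<in> bochner_L2 M" by (auto simp: bochner_L2_def intro: le_less_trans)
      have "(bochner_L2_norm M (F - f n))\<^sup>2 \<le> (2 * (1/2)^n)\<^sup>2"
        using le unfolding nn_integral_bochner_L2[OF m] by (simp add: B.N_sq[OF m] ennreal_le_iff)
      then show "bochner_L2_norm M (F - f n) \<le> 2 * (1/2)^n" by (rule power2_le_imp_le) simp
    qed
    have FL: "F \<in> bochner_L2 M" using B.add_mem[OF est(1)[of 0] f(1)[of 0]] by simp
    have "(\<lambda>n. bochner_L2_norm M (f n - F)) \<longlonglongrightarrow> 0"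
    proof (rule tendsto_zero_le)
      show "(\<lambda>n. 2 * (1/2)^n :: real) \<longlonglongrightarrow> 2 * 0" by (intro tendsto_intros LIMSEQ_realpow_zero) auto
      show "norm (bochner_L2_norm M (f n - F)) \<le> 2 * (1/2)^n" for n
        using est(2)[of n] B.N_minus_commute[OF FL f(1)[of n]] B.N_nonneg[OF B.diff_mem[OF f(1)[of n] FL]] by simp
    qed simp
    with FL show "\<exists>x\<in>bochner_L2 M. (\<lambda>n. bochner_L2_norm M (f n - x)) \<longlonglongrightarrow> 0" by blast
  qed
qed

end

lemma semi_hilbert_space_Times:
  assumes "semi_hilbert_space X N ip" "semi_hilbert_space Y N' ip'"
  shows "semi_hilbert_space (X \<times> Y) (\<lambda>z. sqrt ((N (fst z))\<^sup>2 + (N' (snd z))\<^sup>2))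
    (\<lambda>z w. ip (fst z) (fst w) + ip' (snd z) (snd w))"
proof -
  interpret X: semi_hilbert_space X N ip by fact
  interpret Y: semi_hilbert_space Y N' ip' by fact
  show ?thesis
  proof
    fix s :: "nat \<Rightarrow> 'a \<times> 'b"
    assume s: "\<And>n. s n \<in> X \<times> Y" "\<And>n. sqrt ((N (fst (s (Suc n) - s n)))\<^sup>2 + (N' (snd (s (Suc n) - s n)))\<^sup>2) \<le> (1/2)^n"
    have m: "fst (s n) \<in> X" "snd (s n) \<in> Y" for n using s(1)[of n] by (auto simp: mem_Times_iff)
    have "N (fst (s (Suc n)) - fst (s n)) \<le> (1/2)^n" "N' (snd (s (Suc n)) - snd (s n)) \<le> (1/2)^n" for n
      using order_trans[OF real_sqrt_sum_squares_ge1 s(2)[of n]] order_trans[OF real_sqrt_sum_squares_ge2 s(2)[of n]] by auto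
    then obtain x y where x: "x \<in> X" "(\<lambda>n. N (fst (s n) - x)) \<longlonglongrightarrow> 0" and y: "y \<in> Y" "(\<lambda>n. N' (snd (s n) - y)) \<longlonglongrightarrow> 0"
      using X.complete[of "\<lambda>n. fst (s n)"] Y.complete[of "\<lambda>n. snd (s n)"] m by blast
    have "(\<lambda>n. sqrt ((N (fst (s n) - x))\<^sup>2 + (N' (snd (s n) - y))\<^sup>2)) \<longlonglongrightarrow> sqrt (0\<^sup>2 + 0\<^sup>2)"
      by (intro tendsto_intros x y)
    then show "\<exists>z\<in>X \<times> Y. (\<lambda>n. sqrt ((N (fst (s n - z)))\<^sup>2 + (N' (snd (s n - z)))\<^sup>2)) \<longlonglongrightarrow> 0"
      using x(1) y(1) by (intro bexI[of _ "(x, y)"]) auto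
  next
    show "0 \<in> X \<times> Y" by (simp add: zero_prod_def X.zero_mem Y.zero_mem)
    show "ip (fst z) (fst w) + ip' (snd z) (snd w) = ip (fst w) (fst z) + ip' (snd w) (snd z)"
      if "z \<in> X \<times> Y" "w \<in> X \<times> Y" for z w
      using that X.ip_sym[of "fst z" "fst w"] Y.ip_sym[of "snd z" "snd w"] by auto
  qed (auto simp: X.lin_mem Y.lin_mem X.ip_lin Y.ip_lin X.ip_nonneg Y.ip_nonneg X.N_sq Y.N_sq distrib_left)
qed

section \<open>Dirichlet forms\<close>

context bounded_open
begin

lemma matrix_vector_inner_eq: "(A *v g) \<bullet> h = (\<Sum>i\<in>UNIV. \<Sum>j\<in>UNIV. A $ i $ j * g $ j * h $ i)"
  for A :: "real^'d^'d"
  by (simp add: inner_vec_def matrix_vector_mult_def sum_distrib_right)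

text \<open>Expanding into finitely many real products also provides measurability of the integrand.\<close>

lemma matrix_vector_inner_le:
  fixes A :: "real^'d^'d"
  shows "\<bar>(A *v g) \<bullet> h\<bar> \<le> (real CARD('d))\<^sup>2 * norm A * ((norm g)\<^sup>2 + (norm h)\<^sup>2)"
proof -
  have "\<bar>A $ i $ j * g $ j * h $ i\<bar> \<le> norm A * ((norm g)\<^sup>2 + (norm h)\<^sup>2)" for i j
  proof -
    have a: "\<bar>A $ i $ j\<bar> \<le> norm A"
      using order_trans[OF component_le_norm_cart Finite_Cartesian_Product.norm_nth_le] .
    have "\<bar>g $ j\<bar> * \<bar>h $ i\<bar> \<le> norm g * norm h"
      by (intro mult_mono component_le_norm_cart) auto
    also have "\<dots> \<le> (norm g)\<^sup>2 + (norm h)\<^sup>2"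
      using sum_squares_bound[of "norm g" "norm h"] mult_nonneg_nonneg[OF norm_ge_zero[of g] norm_ge_zero[of h]]
      unfolding mult.assoc by linarith
    finally show ?thesis
      unfolding abs_mult mult.assoc using a by (intro mult_mono) auto
  qed
  then have "\<bar>(A *v g) \<bullet> h\<bar> \<le> (\<Sum>i\<in>(UNIV::'d set). \<Sum>j\<in>(UNIV::'d set). norm A * ((norm g)\<^sup>2 + (norm h)\<^sup>2))"
    unfolding matrix_vector_inner_eq by (intro order_trans[OF sum_abs] sum_mono) auto
  then show ?thesis by (simp add: power2_eq_square mult.assoc)
qed

lemma integrable_dirichlet:
  fixes A :: "real^'d \<Rightarrow> real^'d^'d"
  assumes A: "Linf_symmetric_field \<Omega> A" and g: "g \<in> L2 \<Omega>" and h: "h \<in> L2 \<Omega>"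
  shows "integrable (lebesgue_on \<Omega>) (\<lambda>x. (A x *v g x) \<bullet> h x)"
proof -
  have Am: "A \<in> borel_measurable (lebesgue_on \<Omega>)" using A by (simp add: Linf_symmetric_field_def)
  obtain C where C: "AE x in lebesgue_on \<Omega>. norm (A x) \<le> C" using A by (auto simp: Linf_symmetric_field_def)
  have nth: "(\<lambda>x. f x $ i) \<in> borel_measurable (lebesgue_on \<Omega>)"
    if "f \<in> borel_measurable (lebesgue_on \<Omega>)" for f :: "real^'d \<Rightarrow> 'c::euclidean_space^'d" and i
    by (rule measurable_compose[OF that])
       (intro borel_measurable_continuous_onI linear_continuous_on bounded_linear_vec_nth)
  show ?thesis
  proof (rule Bochner_Integration.integrable_bound)
    show "integrable (lebesgue_on \<Omega>) (\<lambda>x. (real CARD('d))\<^sup>2 * C * ((norm (g x))\<^sup>2 + (norm (h x))\<^sup>2))"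
      by (intro integrable_mult_right Bochner_Integration.integrable_add L2D(2)[OF g] L2D(2)[OF h])
    show "(\<lambda>x. (A x *v g x) \<bullet> h x) \<in> borel_measurable (lebesgue_on \<Omega>)"
      unfolding matrix_vector_inner_eq
      by (intro borel_measurable_sum borel_measurable_times nth Am L2D(1)[OF g] L2D(1)[OF h])
    show "AE x in lebesgue_on \<Omega>. norm ((A x *v g x) \<bullet> h x) \<le> norm ((real CARD('d))\<^sup>2 * C * ((norm (g x))\<^sup>2 + (norm (h x))\<^sup>2))"
      using C
    proof eventually_elim
      case (elim x)
      have "\<bar>(A x *v g x) \<bullet> h x\<bar> \<le> (real CARD('d))\<^sup>2 * norm (A x) * ((norm (g x))\<^sup>2 + (norm (h x))\<^sup>2)"
        by (rule matrix_vector_inner_le)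
      also have "\<dots> \<le> (real CARD('d))\<^sup>2 * C * ((norm (g x))\<^sup>2 + (norm (h x))\<^sup>2)"
        using elim by (intro mult_right_mono mult_left_mono) auto
      finally show ?case by simp
    qed
  qed
qed

lemma symmetric_bilinear_dirichlet_form:
  fixes A :: "real^'d \<Rightarrow> real^'d^'d"
  assumes A: "Linf_symmetric_field \<Omega> A"
  shows "symmetric_bilinear_on_V \<Omega> (dirichlet_form \<Omega> A)"
  unfolding symmetric_bilinear_on_V_def
proof (intro conjI ballI allI)
  fix u v assume u: "u \<in> V_space \<Omega>" and v: "v \<in> V_space \<Omega>"
  note gu = grad_L2[OF V_H1[OF u]] and gv = grad_L2[OF V_H1[OF v]]
  have sym: "AE x in lebesgue_on \<Omega>. transpose (A x) = A x" using A by (simp add: Linf_symmetric_field_def)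
  show "dirichlet_form \<Omega> A u v = dirichlet_form \<Omega> A v u"
    unfolding dirichlet_form_def
  proof (rule integral_cong_AE)
    show "(\<lambda>x. (A x *v grad \<Omega> u x) \<bullet> grad \<Omega> v x) \<in> borel_measurable (lebesgue_on \<Omega>)"
      "(\<lambda>x. (A x *v grad \<Omega> v x) \<bullet> grad \<Omega> u x) \<in> borel_measurable (lebesgue_on \<Omega>)"
      by (intro borel_measurable_integrable integrable_dirichlet A gu gv)+
    show "AE x in lebesgue_on \<Omega>. (A x *v grad \<Omega> u x) \<bullet> grad \<Omega> v x = (A x *v grad \<Omega> v x) \<bullet> grad \<Omega> u x"
      using sym by eventually_elim (metis dot_lmul_matrix inner_commute transpose_matrix_vector)
  qed
  fix w c d assume w: "w \<in> V_space \<Omega>"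
  note gw = grad_L2[OF V_H1[OF w]]
  have "dirichlet_form \<Omega> A (c *\<^sub>R u + d *\<^sub>R v) w
      = (\<integral>x. c * ((A x *v grad \<Omega> u x) \<bullet> grad \<Omega> w x) + d * ((A x *v grad \<Omega> v x) \<bullet> grad \<Omega> w x) \<partial>lebesgue_on \<Omega>)"
    unfolding dirichlet_form_def
  proof (rule integral_cong_AE)
    show "(\<lambda>x. (A x *v grad \<Omega> (c *\<^sub>R u + d *\<^sub>R v) x) \<bullet> grad \<Omega> w x) \<in> borel_measurable (lebesgue_on \<Omega>)"
      by (intro borel_measurable_integrable integrable_dirichlet A grad_L2 H1_lin V_H1 u v w)
    show "(\<lambda>x. c * ((A x *v grad \<Omega> u x) \<bullet> grad \<Omega> w x) + d * ((A x *v grad \<Omega> v x) \<bullet> grad \<Omega> w x)) \<in> borel_measurable (lebesgue_on \<Omega>)"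
      by (intro borel_measurable_add borel_measurable_times borel_measurable_const borel_measurable_integrable integrable_dirichlet A gu gv gw)
    show "AE x in lebesgue_on \<Omega>. (A x *v grad \<Omega> (c *\<^sub>R u + d *\<^sub>R v) x) \<bullet> grad \<Omega> w x
        = c * ((A x *v grad \<Omega> u x) \<bullet> grad \<Omega> w x) + d * ((A x *v grad \<Omega> v x) \<bullet> grad \<Omega> w x)"
      using grad_lin_AE[OF V_H1[OF u] V_H1[OF v], of c d]
      by eventually_elim (simp add: matrix_vector_right_distrib matrix_vector_mult_scaleR inner_add_left)
  qed
  also have "\<dots> = c * dirichlet_form \<Omega> A u w + d * dirichlet_form \<Omega> A v w"
    using integrable_dirichlet[OF A gu gw] integrable_dirichlet[OF A gv gw] by (simp add: dirichlet_form_def)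
  finally show "dirichlet_form \<Omega> A (c *\<^sub>R u + d *\<^sub>R v) w = c * dirichlet_form \<Omega> A u w + d * dirichlet_form \<Omega> A v w" .
qed

text \<open>By Poincare's inequality the seminorm in the definition of coercivity can be replaced by the norm.\<close>

lemma coercive_V_norm:
  assumes "coercive_form_on_V \<Omega> a"
  obtains c where "0 < c" "\<And>v. v \<in> V_space \<Omega> \<Longrightarrow> c * (V_norm \<Omega> v)\<^sup>2 \<le> a v v"
proof -
  obtain \<beta> where \<beta>: "0 < \<beta>" "\<And>v. v \<in> V_space \<Omega> \<Longrightarrow> \<beta> * (V_seminorm \<Omega> v)\<^sup>2 \<le> a v v"
    using assms by (auto simp: coercive_form_on_V_def)
  obtain C where C: "0 \<le> C" "\<And>v. v \<in> V_space \<Omega> \<Longrightarrow> V_norm \<Omega> v \<le> C * V_seminorm \<Omega> v" by (rule poincare) (rule that)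
  have D: "0 < C\<^sup>2 + 1" by (simp add: add_nonneg_pos)
  show thesis
  proof (rule that[of "\<beta> / (C\<^sup>2 + 1)"])
    fix v assume v: "v \<in> V_space \<Omega>"
    have "(V_norm \<Omega> v)\<^sup>2 \<le> (C * V_seminorm \<Omega> v)\<^sup>2"
      by (intro power_mono C v V.N_nonneg)
    also have "\<dots> \<le> (C\<^sup>2 + 1) * (V_seminorm \<Omega> v)\<^sup>2" by (simp add: power_mult_distrib distrib_right)
    finally have "\<beta> / (C\<^sup>2 + 1) * (V_norm \<Omega> v)\<^sup>2 \<le> \<beta> / (C\<^sup>2 + 1) * ((C\<^sup>2 + 1) * (V_seminorm \<Omega> v)\<^sup>2)"
      using \<beta>(1) D by (intro mult_left_mono) auto
    also have "\<dots> = \<beta> * (V_seminorm \<Omega> v)\<^sup>2" using D by simp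
    finally show "\<beta> / (C\<^sup>2 + 1) * (V_norm \<Omega> v)\<^sup>2 \<le> a v v" using \<beta>(2)[OF v] by simp
  qed (use \<beta> D in simp)
qed

end

section \<open>The history space\<close>

lemma (in semi_inner_space) strongly_measurable_dominated:
  assumes f: "strongly_measurable X N M f" and le: "\<And>x. x \<in> X \<Longrightarrow> 0 \<le> N' x \<and> N' x \<le> C * N x"
  shows "strongly_measurable X N' M f"
proof -
  obtain s where s: "\<And>n. simple_function M (s n)" "\<And>n t. t \<in> space M \<Longrightarrow> s n t \<in> X"
    "AE t in M. (\<lambda>n. N (s n t - f t)) \<longlonglongrightarrow> 0" by (rule strongly_measurableE[OF f]) (rule that)
  have "AE t in M. (\<lambda>n. N' (s n t - f t)) \<longlonglongrightarrow> 0"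
    using s(3) AE_space[of M]
  proof eventually_elim
    case (elim t)
    have "(\<lambda>n. C * N (s n t - f t)) \<longlonglongrightarrow> C * 0" by (intro tendsto_intros elim)
    moreover have "norm (N' (s n t - f t)) \<le> C * N (s n t - f t)" for n
      using le[OF diff_mem[OF s(2)[OF elim(2)] strongly_measurable_mem[OF f elim(2)]], of n] by simp
    ultimately show ?case by (rule tendsto_zero_le) simp
  qed
  then show ?thesis
    using s(1,2) strongly_measurable_mem[OF f] unfolding strongly_measurable_def by blast
qed

locale history_problem = bounded_open \<Omega> for \<Omega> :: "(real^'d::finite) set" +
  fixes a1 :: "(real^'d \<Rightarrow> real) \<Rightarrow> (real^'d \<Rightarrow> real) \<Rightarrow> real" and \<nu> :: "real measure"
  assumes a1_bilinear: "symmetric_bilinear_on_V \<Omega> a1"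
    and a1_bounded: "bounded_form_on_V \<Omega> a1"
    and a1_coercive: "coercive_form_on_V \<Omega> a1"
    and sets_nu: "sets \<nu> = sets (restrict_space borel {0..})"
    and nu_mass: "0 < emeasure \<nu> {0..}" "emeasure \<nu> {0..} < \<infinity>"
begin

lemma space_nu: "space \<nu> = {0..}"
  using sets_eq_imp_space_eq[OF sets_nu] by (simp add: space_restrict_space)

lemma finite_nu: "finite_measure \<nu>"
  by (rule finite_measureI) (use nu_mass in \<open>simp add: space_nu\<close>)

lemma a1_lower: obtains c where "0 < c" "\<And>v. v \<in> V_space \<Omega> \<Longrightarrow> c * (V_norm \<Omega> v)\<^sup>2 \<le> a1 v v"
  by (rule coercive_V_norm[OF a1_coercive]) (rule that)

lemma a1_nonneg: "v \<in> V_space \<Omega> \<Longrightarrow> 0 \<le> a1 v v"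
  using a1_lower by (metis mult_nonneg_nonneg less_imp_le zero_le_power2 order_trans)

lemma a1_upper: obtains C where "0 \<le> C" "\<And>v w. v \<in> V_space \<Omega> \<Longrightarrow> w \<in> V_space \<Omega> \<Longrightarrow> \<bar>a1 v w\<bar> \<le> C * V_norm \<Omega> v * V_norm \<Omega> w"
  using a1_bounded unfolding bounded_form_on_V_def using less_imp_le by blast

lemma energy_norm_upper:
  obtains C where "0 \<le> C" "\<And>v. v \<in> V_space \<Omega> \<Longrightarrow> sqrt (a1 v v) \<le> C * V_norm \<Omega> v"
proof -
  obtain C where C: "0 \<le> C" "\<And>v w. v \<in> V_space \<Omega> \<Longrightarrow> w \<in> V_space \<Omega> \<Longrightarrow> \<bar>a1 v w\<bar> \<le> C * V_norm \<Omega> v * V_norm \<Omega> w"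
    by (rule a1_upper) (rule that)
  show thesis
  proof (rule that[of "sqrt C"])
    fix v assume v: "v \<in> V_space \<Omega>"
    have "sqrt (a1 v v) \<le> sqrt (C * (V_norm \<Omega> v)\<^sup>2)"
      using C(2)[OF v v] by (simp add: power2_eq_square mult.assoc)
    then show "sqrt (a1 v v) \<le> sqrt C * V_norm \<Omega> v" using V.N_nonneg[OF v] by (simp add: real_sqrt_mult)
  qed (use C in simp)
qed

lemma energy_norm_lower:
  obtains C where "0 \<le> C" "\<And>v. v \<in> V_space \<Omega> \<Longrightarrow> V_norm \<Omega> v \<le> C * sqrt (a1 v v)"
proof -
  obtain c where c: "0 < c" "\<And>v. v \<in> V_space \<Omega> \<Longrightarrow> c * (V_norm \<Omega> v)\<^sup>2 \<le> a1 v v" by (rule a1_lower) (rule that)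
  show thesis
  proof (rule that[of "1 / sqrt c"])
    fix v assume v: "v \<in> V_space \<Omega>"
    have "sqrt (c * (V_norm \<Omega> v)\<^sup>2) \<le> sqrt (a1 v v)" using c(2)[OF v] by simp
    then have "sqrt c * V_norm \<Omega> v \<le> sqrt (a1 v v)" using V.N_nonneg[OF v] by (simp add: real_sqrt_mult)
    then show "V_norm \<Omega> v \<le> 1 / sqrt c * sqrt (a1 v v)" using c(1) by (simp add: field_simps)
  qed (use c in simp)
qed

text \<open>On \<open>V\<close> the norm of \<open>a\<^sub>1\<close> is equivalent to the norm of \<open>V\<close>, by coercivity and Poincare's inequality.\<close>

sublocale E: semi_hilbert_space "V_space \<Omega>" "\<lambda>v. sqrt (a1 v v)" a1
proof
  obtain C where C: "0 \<le> C" "\<And>v. v \<in> V_space \<Omega> \<Longrightarrow> V_norm \<Omega> v \<le> C * sqrt (a1 v v)" by (rule energy_norm_lower) (rule that)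
  obtain C' where C': "0 \<le> C'" "\<And>v. v \<in> V_space \<Omega> \<Longrightarrow> sqrt (a1 v v) \<le> C' * V_norm \<Omega> v" by (rule energy_norm_upper) (rule that)
  fix s :: "nat \<Rightarrow> real^'d \<Rightarrow> real"
  assume s: "\<And>n. s n \<in> V_space \<Omega>" "\<And>n. sqrt (a1 (s (Suc n) - s n) (s (Suc n) - s n)) \<le> (1/2)^n"
  have "summable (\<lambda>n. V_norm \<Omega> (s (Suc n) - s n))"
  proof (rule summable_comparison_test')
    show "summable (\<lambda>n. C * (1/2)^n :: real)" by (intro summable_mult summable_geometric) simp
    show "norm (V_norm \<Omega> (s (Suc n) - s n)) \<le> C * (1/2)^n" if "0 \<le> n" for n
      using order_trans[OF C(2)[OF V.diff_mem[OF s(1) s(1)]] mult_left_mono[OF s(2)[of n] C(1)]]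
        V.N_nonneg[OF V.diff_mem[OF s(1)[of "Suc n"] s(1)[of n]]] by simp
  qed
  then obtain x where x: "x \<in> V_space \<Omega>" "(\<lambda>n. V_norm \<Omega> (s n - x)) \<longlonglongrightarrow> 0"
    by (rule V.complete_summable[of s, OF s(1)]) (rule that)
  have "(\<lambda>n. C' * V_norm \<Omega> (s n - x)) \<longlonglongrightarrow> C' * 0" by (intro tendsto_intros x)
  then have "(\<lambda>n. sqrt (a1 (s n - x) (s n - x))) \<longlonglongrightarrow> 0"
    by (rule tendsto_zero_le) (use C'(2)[OF V.diff_mem[OF s(1) x(1)]] a1_nonneg[OF V.diff_mem[OF s(1) x(1)]] in auto)
  then show "\<exists>x\<in>V_space \<Omega>. (\<lambda>n. sqrt (a1 (s n - x) (s n - x))) \<longlonglongrightarrow> 0" using x(1) by blast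
qed (use a1_bilinear a1_nonneg V.zero_mem V.lin_mem in \<open>auto simp: symmetric_bilinear_on_V_def\<close>)

lemma strongly_measurable_energy_iff:
  "strongly_measurable (V_space \<Omega>) (V_norm \<Omega>) M f \<longleftrightarrow> strongly_measurable (V_space \<Omega>) (\<lambda>v. sqrt (a1 v v)) M f"
proof
  obtain C where C: "0 \<le> C" "\<And>v. v \<in> V_space \<Omega> \<Longrightarrow> V_norm \<Omega> v \<le> C * sqrt (a1 v v)" by (rule energy_norm_lower) (rule that)
  show "strongly_measurable (V_space \<Omega>) (V_norm \<Omega>) M f" if "strongly_measurable (V_space \<Omega>) (\<lambda>v. sqrt (a1 v v)) M f"
    by (rule E.strongly_measurable_dominated[OF that]) (use C V.N_nonneg in blast)
  obtain C' where C': "0 \<le> C'" "\<And>v. v \<in> V_space \<Omega> \<Longrightarrow> sqrt (a1 v v) \<le> C' * V_norm \<Omega> v" by (rule energy_norm_upper) (rule that)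
  show "strongly_measurable (V_space \<Omega>) (\<lambda>v. sqrt (a1 v v)) M f" if "strongly_measurable (V_space \<Omega>) (V_norm \<Omega>) M f"
    by (rule V.strongly_measurable_dominated[OF that]) (use C' a1_nonneg in auto)
qed

lemma K_space_eq: "K_space \<Omega> a1 \<nu> = E.bochner_L2 \<nu>"
  by (simp add: K_space_def E.bochner_L2_def strongly_measurable_energy_iff)

lemma K_norm_eq: "K_norm a1 \<nu> = E.bochner_L2_norm \<nu>"
  by (simp add: fun_eq_iff K_norm_def E.bochner_L2_norm_def)

abbreviation "K_inner \<equiv> E.bochner_L2_inner \<nu>"

sublocale K: semi_hilbert_space "K_space \<Omega> a1 \<nu>" "K_norm a1 \<nu>" K_inner
  unfolding K_space_eq K_norm_eq by (rule E.semi_hilbert_space_bochner_L2[OF finite_nu])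

definition W_inner :: "(real^'d \<Rightarrow> real) \<times> (real \<Rightarrow> real^'d \<Rightarrow> real) \<Rightarrow> (real^'d \<Rightarrow> real) \<times> (real \<Rightarrow> real^'d \<Rightarrow> real) \<Rightarrow> real" where
  "W_inner x y = L2_inner \<Omega> (fst x) (fst y) + K_inner (snd x) (snd y)"

sublocale W: semi_hilbert_space "W_space \<Omega> a1 \<nu>" "W_norm \<Omega> a1 \<nu>" W_inner
proof -
  have eq: "W_norm \<Omega> a1 \<nu> = (\<lambda>z. sqrt ((L2_norm \<Omega> (fst z))\<^sup>2 + (K_norm a1 \<nu> (snd z))\<^sup>2))"
    "W_inner = (\<lambda>z w. L2_inner \<Omega> (fst z) (fst w) + K_inner (snd z) (snd w))"
    by (simp_all add: fun_eq_iff W_norm_def W_inner_def)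
  show "semi_hilbert_space (W_space \<Omega> a1 \<nu>) (W_norm \<Omega> a1 \<nu>) W_inner"
    unfolding W_space_def eq
    by (rule semi_hilbert_space_Times[OF L2r.semi_hilbert_space_axioms K.semi_hilbert_space_axioms])
qed

lemma W_norm_bounds:
  assumes "x \<in> W_space \<Omega> a1 \<nu>"
  shows "L2_norm \<Omega> (fst x) \<le> W_norm \<Omega> a1 \<nu> x" "K_norm a1 \<nu> (snd x) \<le> W_norm \<Omega> a1 \<nu> x"
  unfolding W_norm_def by (auto intro!: real_le_rsqrt)

lemma K_mem_V: "\<zeta> \<in> K_space \<Omega> a1 \<nu> \<Longrightarrow> l \<in> {0..} \<Longrightarrow> \<zeta> l \<in> V_space \<Omega>"
  unfolding K_space_eq using E.bochner_L2D(2)[of \<zeta> \<nu> l] by (simp add: space_nu)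

lemma E_op_mem: "v \<in> V_space \<Omega> \<Longrightarrow> E_op v \<in> K_space \<Omega> a1 \<nu>"
  unfolding K_space_def E_op_def
  using V.strongly_measurable_const nu_mass(2) by (auto simp: space_nu ennreal_mult_less_top)

text \<open>Integrability in the norm of \<open>V\<close> comes from the equivalence of norms and the finite mass of \<open>\<nu>\<close>. The second claim
  is the adjointness of \<open>J\<close> and \<open>E\<close> with respect to \<open>a\<^sub>1\<close>.\<close>

lemma J_op_integral:
  assumes \<zeta>: "\<zeta> \<in> K_space \<Omega> a1 \<nu>" and w: "w \<in> V_space \<Omega>"
  shows "J_op \<Omega> \<nu> \<zeta> \<in> V_space \<Omega>" "a1 (J_op \<Omega> \<nu> \<zeta>) w = K_inner \<zeta> (E_op w)"
proof -
  obtain C where C: "0 \<le> C" "\<And>v. v \<in> V_space \<Omega> \<Longrightarrow> V_norm \<Omega> v \<le> C * sqrt (a1 v v)" by (rule energy_norm_lower) (rule that)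
  have sm: "strongly_measurable (V_space \<Omega>) (V_norm \<Omega>) \<nu> \<zeta>" using \<zeta> by (simp add: K_space_def)
  have \<zeta>B: "\<zeta> \<in> E.bochner_L2 \<nu>" using \<zeta> by (simp add: K_space_eq)
  have "(\<integral>\<^sup>+l. ennreal (V_norm \<Omega> (\<zeta> l)) \<partial>\<nu>) \<le> (\<integral>\<^sup>+l. ennreal C * ennreal (sqrt (a1 (\<zeta> l) (\<zeta> l))) \<partial>completion \<nu>)"
    unfolding nn_integral_completion
    using C a1_nonneg V.strongly_measurable_mem[OF sm]
    by (intro nn_integral_mono) (simp flip: ennreal_mult)
  also have "\<dots> = ennreal C * (\<integral>\<^sup>+l. ennreal (sqrt (a1 (\<zeta> l) (\<zeta> l))) \<partial>completion \<nu>)"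
    by (intro nn_integral_cmult measurable_compose[OF _ measurable_ennreal] E.borel_measurable_N E.bochner_L2D[OF \<zeta>B])
  also have "\<dots> < \<infinity>"
    unfolding nn_integral_completion using E.bochner_L2_integrable_norm[OF finite_nu \<zeta>B] by (simp add: ennreal_mult_less_top)
  finally have "has_bochner_int (V_space \<Omega>) (V_norm \<Omega>) \<nu> \<zeta> (J_op \<Omega> \<nu> \<zeta>)"
    unfolding J_op_def by (rule V.bochner_int_exists[OF finite_nu sm])
  then have wi: "V.weak_int \<nu> \<zeta> (J_op \<Omega> \<nu> \<zeta>)" by (rule V.weak_int_has_bochner_int[OF finite_nu])
  then show "J_op \<Omega> \<nu> \<zeta> \<in> V_space \<Omega>" by (rule V.weak_intD)
  obtain C' where C': "0 \<le> C'" "\<And>v w. v \<in> V_space \<Omega> \<Longrightarrow> w \<in> V_space \<Omega> \<Longrightarrow> \<bar>a1 v w\<bar> \<le> C' * V_norm \<Omega> v * V_norm \<Omega> w"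
    by (rule a1_upper) (rule that)
  have "V.bounded_functional (\<lambda>v. a1 v w)"
    unfolding V.bounded_functional_def
  proof (intro conjI ballI allI exI[of _ "C' * V_norm \<Omega> w"])
    show "\<bar>a1 v w\<bar> \<le> C' * V_norm \<Omega> w * V_norm \<Omega> v" if "v \<in> V_space \<Omega>" for v
      using C'(2)[OF that w] by (simp add: mult_ac)
  qed (use w C'(1) V.N_nonneg[OF w] in \<open>auto simp: E.ip_lin\<close>)
  from V.weak_intD(3)[OF wi this]
  show "a1 (J_op \<Omega> \<nu> \<zeta>) w = K_inner \<zeta> (E_op w)"
    by (simp add: E.bochner_L2_inner_def E_op_def has_bochner_integral_iff)
qed

lemma positive_mass_interval: obtains r where "0 \<le> r" "0 < emeasure \<nu> {0..r}"
proof -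
  have m: "{0..real n} \<in> sets \<nu>" for n unfolding sets_nu by (subst sets_restrict_space_iff) auto
  have "(\<lambda>n. emeasure \<nu> {0..real n}) \<longlonglongrightarrow> emeasure \<nu> (\<Union>n. {0..real n})"
    by (rule Lim_emeasure_incseq) (use m in \<open>auto simp: incseq_def\<close>)
  also have "(\<Union>n. {0..real n}) = {0..}" using real_arch_simple by auto
  finally have "eventually (\<lambda>n. 0 < emeasure \<nu> {0..real n}) sequentially"
    using nu_mass(1) by (rule order_tendstoD)
  then obtain n where "0 < emeasure \<nu> {0..real n}" by (auto simp: eventually_sequentially)
  then show thesis by (rule that[rotated]) simp
qed

text \<open>The first component is recovered from \<open>u = y + \<lambda> \<zeta>(\<lambda>)\<close> with \<open>y = E u - \<Lambda> \<zeta>\<close> by averaging over an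
  interval of positive mass, on which \<open>\<lambda>\<close> is bounded.\<close>

lemma first_component_bound:
  obtains C where "\<And>u \<zeta>. u \<in> V_space \<Omega> \<Longrightarrow> \<zeta> \<in> K_space \<Omega> a1 \<nu> \<Longrightarrow> E_op u - Lambda_op \<zeta> \<in> K_space \<Omega> a1 \<nu> \<Longrightarrow>
    K_norm a1 \<nu> \<zeta> \<le> R \<Longrightarrow> K_norm a1 \<nu> (E_op u - Lambda_op \<zeta>) \<le> R \<Longrightarrow> (V_norm \<Omega> u)\<^sup>2 \<le> C"
proof -
  obtain r where r: "0 \<le> r" "0 < emeasure \<nu> {0..r}" by (rule positive_mass_interval)
  interpret finite_measure \<nu> by (rule finite_nu)
  define m where "m = measure \<nu> {0..r}"
  have m: "0 < m" using r(2) by (simp add: m_def emeasure_eq_measure)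
  obtain c where c: "0 < c" "\<And>v. v \<in> V_space \<Omega> \<Longrightarrow> c * (V_norm \<Omega> v)\<^sup>2 \<le> a1 v v" by (rule a1_lower) (rule that)
  show thesis
  proof (rule that[of "(2 * R\<^sup>2 + 2 * r\<^sup>2 * R\<^sup>2) / (m * c)"])
    fix u :: "real^'d \<Rightarrow> real" and \<zeta> :: "real \<Rightarrow> real^'d \<Rightarrow> real"
    define y where "y = E_op u - Lambda_op \<zeta>"
    assume u: "u \<in> V_space \<Omega>" and \<zeta>: "\<zeta> \<in> K_space \<Omega> a1 \<nu>" and "E_op u - Lambda_op \<zeta> \<in> K_space \<Omega> a1 \<nu>"
      and \<zeta>R: "K_norm a1 \<nu> \<zeta> \<le> R" and "K_norm a1 \<nu> (E_op u - Lambda_op \<zeta>) \<le> R"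
    then have y: "y \<in> K_space \<Omega> a1 \<nu>" and yR: "K_norm a1 \<nu> y \<le> R" by (auto simp: y_def)
    have rm: "{0..r} \<in> sets \<nu>" unfolding sets_nu by (subst sets_restrict_space_iff) auto
    let ?I = "\<lambda>\<zeta>. \<integral>\<^sup>+l. ennreal (a1 (\<zeta> l) (\<zeta> l)) \<partial>\<nu>"
    have I: "?I z \<le> ennreal (R\<^sup>2)" if "z \<in> K_space \<Omega> a1 \<nu>" "K_norm a1 \<nu> z \<le> R" for z
    proof -
      have "?I z = ennreal ((K_norm a1 \<nu> z)\<^sup>2)"
        using E.nn_integral_bochner_L2[of z \<nu>] K.N_sq[OF that(1)] that(1) by (simp add: K_space_eq)
      also have "\<dots> \<le> ennreal (R\<^sup>2)" using that K.N_nonneg by (intro ennreal_leI power_mono) auto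
      finally show ?thesis .
    qed
    have pt: "a1 u u \<le> 2 * a1 (y l) (y l) + 2 * r\<^sup>2 * a1 (\<zeta> l) (\<zeta> l)" if l: "0 \<le> l" "l \<le> r" for l
    proof -
      have yl: "y l \<in> V_space \<Omega>" "\<zeta> l \<in> V_space \<Omega>" using K_mem_V[OF y] K_mem_V[OF \<zeta>] l by auto
      have "u = y l + l *\<^sub>R \<zeta> l" by (simp add: y_def E_op_def Lambda_op_def)
      then have "sqrt (a1 u u) \<le> sqrt (a1 (y l) (y l)) + l * sqrt (a1 (\<zeta> l) (\<zeta> l))"
        using E.N_triangle[OF yl(1) E.scale_mem[OF yl(2)], of l] E.N_scale[OF yl(2), of l] l by simp
      then have "(sqrt (a1 u u))\<^sup>2 \<le> (sqrt (a1 (y l) (y l)) + l * sqrt (a1 (\<zeta> l) (\<zeta> l)))\<^sup>2"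
        using a1_nonneg[OF u] by (intro power_mono) auto
      also have "\<dots> \<le> 2 * (sqrt (a1 (y l) (y l)))\<^sup>2 + 2 * (l * sqrt (a1 (\<zeta> l) (\<zeta> l)))\<^sup>2"
        using sum_squares_bound[of "sqrt (a1 (y l) (y l))" "l * sqrt (a1 (\<zeta> l) (\<zeta> l))"]
        by (simp add: power2_sum)
      also have "\<dots> = 2 * a1 (y l) (y l) + 2 * (l\<^sup>2 * a1 (\<zeta> l) (\<zeta> l))"
        using a1_nonneg yl by (simp add: power_mult_distrib)
      also have "\<dots> \<le> 2 * a1 (y l) (y l) + 2 * (r\<^sup>2 * a1 (\<zeta> l) (\<zeta> l))"
        using l a1_nonneg[OF yl(2)] by (intro add_left_mono mult_left_mono mult_right_mono power_mono) auto
      finally show ?thesis using a1_nonneg[OF u] by simp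
    qed
    have "ennreal (a1 u u * m) = (\<integral>\<^sup>+l. ennreal (a1 u u) * indicator {0..r} l \<partial>\<nu>)"
      using rm a1_nonneg[OF u] by (simp add: nn_integral_cmult_indicator m_def emeasure_eq_measure ennreal_mult)
    also have "\<dots> \<le> (\<integral>\<^sup>+l. 2 * ennreal (a1 (y l) (y l)) + ennreal (2 * r\<^sup>2) * ennreal (a1 (\<zeta> l) (\<zeta> l)) \<partial>completion \<nu>)"
      unfolding nn_integral_completion
    proof (rule nn_integral_mono)
      fix l assume "l \<in> space \<nu>"
      then have l: "0 \<le> l" by (simp add: space_nu)
      have nn: "0 \<le> a1 (y l) (y l)" "0 \<le> a1 (\<zeta> l) (\<zeta> l)" using l K_mem_V[OF y] K_mem_V[OF \<zeta>] a1_nonneg by auto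
      then have e: "2 * ennreal (a1 (y l) (y l)) + ennreal (2 * r\<^sup>2) * ennreal (a1 (\<zeta> l) (\<zeta> l))
          = ennreal (2 * a1 (y l) (y l) + 2 * r\<^sup>2 * a1 (\<zeta> l) (\<zeta> l))"
        by (simp add: ennreal_plus ennreal_mult)
      show "ennreal (a1 u u) * indicator {0..r} l \<le> 2 * ennreal (a1 (y l) (y l)) + ennreal (2 * r\<^sup>2) * ennreal (a1 (\<zeta> l) (\<zeta> l))"
        unfolding e using pt[OF l] by (auto split: split_indicator intro!: ennreal_leI)
    qed
    also have "\<dots> = 2 * ?I y + ennreal (2 * r\<^sup>2) * ?I \<zeta>"
    proof -
      have sm: "(\<lambda>l. ennreal (a1 (z l) (z l))) \<in> borel_measurable (completion \<nu>)" if "z \<in> K_space \<Omega> a1 \<nu>" for z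
        using that by (intro measurable_compose[OF _ measurable_ennreal] E.borel_measurable_ip E.bochner_L2D) (auto simp: K_space_eq)
      have "(\<integral>\<^sup>+l. 2 * ennreal (a1 (y l) (y l)) + ennreal (2 * r\<^sup>2) * ennreal (a1 (\<zeta> l) (\<zeta> l)) \<partial>completion \<nu>)
          = (\<integral>\<^sup>+l. 2 * ennreal (a1 (y l) (y l)) \<partial>completion \<nu>)
            + (\<integral>\<^sup>+l. ennreal (2 * r\<^sup>2) * ennreal (a1 (\<zeta> l) (\<zeta> l)) \<partial>completion \<nu>)"
        by (intro nn_integral_add borel_measurable_times_ennreal borel_measurable_const sm y \<zeta>)
      from this[unfolded nn_integral_cmult[OF sm[OF y]] nn_integral_cmult[OF sm[OF \<zeta>]]]
      show ?thesis unfolding nn_integral_completion .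
    qed
    also have "\<dots> \<le> 2 * ennreal (R\<^sup>2) + ennreal (2 * r\<^sup>2) * ennreal (R\<^sup>2)"
      by (intro add_mono mult_left_mono I y yR \<zeta> \<zeta>R) auto
    also have "\<dots> = ennreal (2 * R\<^sup>2 + 2 * r\<^sup>2 * R\<^sup>2)" by (simp add: ennreal_plus ennreal_mult)
    finally have "a1 u u * m \<le> 2 * R\<^sup>2 + 2 * r\<^sup>2 * R\<^sup>2" by (subst (asm) ennreal_le_iff) auto
    moreover have "c * (V_norm \<Omega> u)\<^sup>2 * m \<le> a1 u u * m" using c(2)[OF u] m by (intro mult_right_mono) auto
    ultimately have "c * (V_norm \<Omega> u)\<^sup>2 * m \<le> 2 * R\<^sup>2 + 2 * r\<^sup>2 * R\<^sup>2" by linarith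
    also have "c * (V_norm \<Omega> u)\<^sup>2 * m = (V_norm \<Omega> u)\<^sup>2 * (m * c)" by (simp only: mult_ac)
    finally show "(V_norm \<Omega> u)\<^sup>2 \<le> (2 * R\<^sup>2 + 2 * r\<^sup>2 * R\<^sup>2) / (m * c)"
      using m c(1) by (simp add: pos_le_divide_eq)
  qed
qed

end

section \<open>The energy estimate\<close>

lemma symmetric_bilinear_on_VD:
  assumes "symmetric_bilinear_on_V \<Omega> a" "u \<in> V_space \<Omega>" "v \<in> V_space \<Omega>"
  shows "a u v = a v u" "w \<in> V_space \<Omega> \<Longrightarrow> a (u - v) w = a u w - a v w"
proof -
  show "a u v = a v u" using assms by (auto simp: symmetric_bilinear_on_V_def)
  assume w: "w \<in> V_space \<Omega>"
  have "a (1 *\<^sub>R u + (-1) *\<^sub>R v) w = 1 * a u w + (-1) * a v w"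
    using assms w unfolding symmetric_bilinear_on_V_def by blast
  then show "a (u - v) w = a u w - a v w" by simp
qed

lemma young_absorb: "0 < c \<Longrightarrow> b * x - c * x\<^sup>2 \<le> b\<^sup>2 / (4 * c)" for b c x :: real
proof -
  assume c: "0 < c"
  have "0 \<le> (b - 2 * c * x)\<^sup>2" by simp
  then have "(b * x - c * x\<^sup>2) * (4 * c) \<le> b\<^sup>2" by (simp add: power2_eq_square algebra_simps)
  then show ?thesis using c by (simp add: pos_le_divide_eq)
qed

context history_problem
begin

lemma gen_op_spec:
  assumes "x \<in> gen_domain \<Omega> a a1 \<nu>"
  obtains h where "h \<in> L2 \<Omega>" "\<And>v. v \<in> V_space \<Omega> \<Longrightarrow> a (fst x) v + a1 (J_op \<Omega> \<nu> (snd x)) v = L2_inner \<Omega> v h"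
    "gen_op \<Omega> a a1 \<nu> x = (- h, E_op (fst x) - Lambda_op (snd x))"
    "fst x \<in> V_space \<Omega>" "snd x \<in> K_space \<Omega> a1 \<nu>" "E_op (fst x) - Lambda_op (snd x) \<in> K_space \<Omega> a1 \<nu>"
proof -
  obtain u \<zeta> where x: "x = (u, \<zeta>)" by (cases x)
  have "\<exists>h. represents_in_H \<Omega> (stress_functional \<Omega> a a1 \<nu> (u, \<zeta>)) h" using assms x by (auto simp: gen_domain_def)
  from someI_ex[OF this] have "represents_in_H \<Omega> (stress_functional \<Omega> a a1 \<nu> x) (SOME h. represents_in_H \<Omega> (stress_functional \<Omega> a a1 \<nu> x) h)"
    by (simp add: x)
  then show thesis
    using assms x
    by (intro that[of "SOME h. represents_in_H \<Omega> (stress_functional \<Omega> a a1 \<nu> x) h"])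
       (auto simp: represents_in_H_def stress_functional_def gen_op_def gen_domain_def L2_inner_def mult.commute)
qed

lemma gen_domain_subset: "gen_domain \<Omega> a a1 \<nu> \<subseteq> W_space \<Omega> a1 \<nu>"
  by (auto simp: gen_domain_def W_space_def intro: V_L2)

lemma gen_op_mem: "x \<in> gen_domain \<Omega> a a1 \<nu> \<Longrightarrow> gen_op \<Omega> a a1 \<nu> x \<in> W_space \<Omega> a1 \<nu>"
  by (elim gen_op_spec) (use L2r.scale_mem[of _ "-1"] in \<open>simp add: W_space_def\<close>)

text \<open>The coupling terms \<open>a\<^sub>1(J \<eta>, w)\<close> and \<open>(\<eta>, E w)\<close> cancel, the relaxation term \<open>(\<eta>, \<Lambda> \<eta>)\<close> is nonnegative, and
  only the perturbation survives; its own coercivity absorbs the factor \<open>w\<close> of the cross term.\<close>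

lemma energy_defect:
  assumes a0: "symmetric_bilinear_on_V \<Omega> a0" "\<And>v. v \<in> V_space \<Omega> \<Longrightarrow> 0 \<le> a0 v v"
    and av: "symmetric_bilinear_on_V \<Omega> av" "bounded_form_on_V \<Omega> av" "coercive_form_on_V \<Omega> av"
  shows "\<exists>C\<ge>0. \<forall>\<epsilon>\<in>{0<..1}. \<forall>Z\<in>gen_domain \<Omega> (perturbed_form a0 av \<epsilon>) a1 \<nu>. \<forall>Y\<in>gen_domain \<Omega> (perturbed_form a0 av 0) a1 \<nu>.
    W_norm \<Omega> a1 \<nu> Y \<le> R \<longrightarrow> W_norm \<Omega> a1 \<nu> (gen_op \<Omega> (perturbed_form a0 av 0) a1 \<nu> Y) \<le> R \<longrightarrow>
    W_inner (Z - Y) (gen_op \<Omega> (perturbed_form a0 av \<epsilon>) a1 \<nu> Z - gen_op \<Omega> (perturbed_form a0 av 0) a1 \<nu> Y) \<le> \<epsilon> * C"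
proof -
  obtain P where P: "\<And>u \<zeta>. u \<in> V_space \<Omega> \<Longrightarrow> \<zeta> \<in> K_space \<Omega> a1 \<nu> \<Longrightarrow> E_op u - Lambda_op \<zeta> \<in> K_space \<Omega> a1 \<nu> \<Longrightarrow>
    K_norm a1 \<nu> \<zeta> \<le> R \<Longrightarrow> K_norm a1 \<nu> (E_op u - Lambda_op \<zeta>) \<le> R \<Longrightarrow> (V_norm \<Omega> u)\<^sup>2 \<le> P"
    by (rule first_component_bound[of R]) (rule that)
  obtain B where B: "0 < B" "\<And>v w. v \<in> V_space \<Omega> \<Longrightarrow> w \<in> V_space \<Omega> \<Longrightarrow> \<bar>av v w\<bar> \<le> B * V_norm \<Omega> v * V_norm \<Omega> w"
    using av(2) by (auto simp: bounded_form_on_V_def)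
  obtain c where c: "0 < c" "\<And>v. v \<in> V_space \<Omega> \<Longrightarrow> c * (V_norm \<Omega> v)\<^sup>2 \<le> av v v"
    by (rule coercive_V_norm[OF av(3)]) (rule that)
  show ?thesis
  proof (intro exI[of _ "B\<^sup>2 * \<bar>P\<bar> / (4 * c)"] conjI ballI impI)
    show "0 \<le> B\<^sup>2 * \<bar>P\<bar> / (4 * c)" using c(1) by simp
    fix \<epsilon> :: real and Z Y
    assume eps: "\<epsilon> \<in> {0<..1}" and Z: "Z \<in> gen_domain \<Omega> (perturbed_form a0 av \<epsilon>) a1 \<nu>"
      and Y: "Y \<in> gen_domain \<Omega> (perturbed_form a0 av 0) a1 \<nu>"
      and YR: "W_norm \<Omega> a1 \<nu> Y \<le> R" "W_norm \<Omega> a1 \<nu> (gen_op \<Omega> (perturbed_form a0 av 0) a1 \<nu> Y) \<le> R"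
    obtain h where h: "h \<in> L2 \<Omega>" "\<And>v. v \<in> V_space \<Omega> \<Longrightarrow> perturbed_form a0 av \<epsilon> (fst Z) v + a1 (J_op \<Omega> \<nu> (snd Z)) v = L2_inner \<Omega> v h"
      "gen_op \<Omega> (perturbed_form a0 av \<epsilon>) a1 \<nu> Z = (- h, E_op (fst Z) - Lambda_op (snd Z))"
      "fst Z \<in> V_space \<Omega>" "snd Z \<in> K_space \<Omega> a1 \<nu>" "E_op (fst Z) - Lambda_op (snd Z) \<in> K_space \<Omega> a1 \<nu>"
      by (rule gen_op_spec[OF Z]) (rule that)
    obtain k where k: "k \<in> L2 \<Omega>" "\<And>v. v \<in> V_space \<Omega> \<Longrightarrow> perturbed_form a0 av 0 (fst Y) v + a1 (J_op \<Omega> \<nu> (snd Y)) v = L2_inner \<Omega> v k"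
      "gen_op \<Omega> (perturbed_form a0 av 0) a1 \<nu> Y = (- k, E_op (fst Y) - Lambda_op (snd Y))"
      "fst Y \<in> V_space \<Omega>" "snd Y \<in> K_space \<Omega> a1 \<nu>" "E_op (fst Y) - Lambda_op (snd Y) \<in> K_space \<Omega> a1 \<nu>"
      by (rule gen_op_spec[OF Y]) (rule that)
    define w where "w = fst Z - fst Y"
    define \<eta> where "\<eta> = snd Z - snd Y"
    define y where "y = (E_op (fst Z) - Lambda_op (snd Z)) - (E_op (fst Y) - Lambda_op (snd Y))"
    have w: "w \<in> V_space \<Omega>" unfolding w_def by (intro V.diff_mem h k)
    have \<eta>: "\<eta> \<in> K_space \<Omega> a1 \<nu>" unfolding \<eta>_def by (intro K.diff_mem h k)
    have y: "y \<in> K_space \<Omega> a1 \<nu>" unfolding y_def by (intro K.diff_mem h k)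
    have Ew: "E_op w \<in> K_space \<Omega> a1 \<nu>" by (rule E_op_mem[OF w])
    define p where "p = V_norm \<Omega> (fst Y)"
    define q where "q = V_norm \<Omega> w"
    have p: "0 \<le> p" "p\<^sup>2 \<le> P"
    proof -
      show "0 \<le> p" unfolding p_def by (intro V.N_nonneg k)
      have "K_norm a1 \<nu> (snd Y) \<le> R"
        using W_norm_bounds(2)[of Y] gen_domain_subset Y YR(1) by force
      moreover have "K_norm a1 \<nu> (E_op (fst Y) - Lambda_op (snd Y)) \<le> R"
        using W_norm_bounds(2)[OF gen_op_mem[OF Y]] YR(2) by (simp add: k(3))
      ultimately show "p\<^sup>2 \<le> P" unfolding p_def by (rule P[OF k(4,5,6)])
    qed
    have q: "0 \<le> q" unfolding q_def by (intro V.N_nonneg w)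
    have first: "L2_inner \<Omega> w (- h - (- k)) = - (a0 w w + \<epsilon> * (av w w + av (fst Y) w) + K_inner \<eta> (E_op w))"
    proof -
      have "L2_inner \<Omega> w (- h - (- k)) = L2_inner \<Omega> w (k - h)" by simp
      also have "\<dots> = L2_inner \<Omega> w k - L2_inner \<Omega> w h" by (rule L2r.ip_diff_right[OF k(1) h(1) V_L2[OF w]])
      also have "\<dots> = (a0 (fst Y) w + K_inner (snd Y) (E_op w)) - (a0 (fst Z) w + \<epsilon> * av (fst Z) w + K_inner (snd Z) (E_op w))"
        unfolding h(2)[OF w, symmetric] k(2)[OF w, symmetric]
        by (simp add: perturbed_form_def J_op_integral[OF h(5) w] J_op_integral[OF k(5) w])
      also have "\<dots> = - (a0 w w + \<epsilon> * (av w w + av (fst Y) w) + K_inner \<eta> (E_op w))"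
        using symmetric_bilinear_on_VD(2)[OF a0(1) h(4) k(4) w] symmetric_bilinear_on_VD(2)[OF av(1) h(4) k(4) w]
          K.ip_diff[OF h(5) k(5) Ew]
        by (simp add: algebra_simps flip: w_def \<eta>_def)
      finally show ?thesis .
    qed
    have second: "K_inner \<eta> y \<le> K_inner \<eta> (E_op w)"
    proof -
      \<comment> \<open>\<open>\<Lambda> \<eta>\<close> is in \<open>K\<close> as a difference of two elements of \<open>K\<close>, although \<open>\<Lambda>\<close> is unbounded\<close>
      have relax: "E_op w - y = Lambda_op \<eta>"
        by (auto simp: fun_eq_iff w_def y_def \<eta>_def E_op_def Lambda_op_def algebra_simps)
      have "0 \<le> K_inner \<eta> (Lambda_op \<eta>)"
        unfolding E.bochner_L2_inner_def Lambda_op_def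
      proof (intro integral_nonneg_AE AE_I2)
        fix l assume "l \<in> space (completion \<nu>)"
        then have l: "0 \<le> l" and m: "\<eta> l \<in> V_space \<Omega>" using K_mem_V[OF \<eta>] by (auto simp: space_nu)
        show "0 \<le> a1 (\<eta> l) (l *\<^sub>R \<eta> l)"
          using l a1_nonneg[OF m] by (simp add: E.ip_scale_right m)
      qed
      also have "\<dots> = K_inner \<eta> (E_op w) - K_inner \<eta> y"
        unfolding relax[symmetric] by (rule K.ip_diff_right[OF Ew y \<eta>])
      finally show ?thesis by simp
    qed
    have "W_inner (Z - Y) (gen_op \<Omega> (perturbed_form a0 av \<epsilon>) a1 \<nu> Z - gen_op \<Omega> (perturbed_form a0 av 0) a1 \<nu> Y)
        = L2_inner \<Omega> w (- h - (- k)) + K_inner \<eta> y"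
      by (simp only: W_inner_def h(3) k(3) fst_diff snd_diff fst_conv snd_conv w_def \<eta>_def y_def)
    also have "\<dots> \<le> - (\<epsilon> * (av w w + av (fst Y) w))"
      using first second a0(2)[OF w] by simp
    also have "\<dots> \<le> \<epsilon> * (B\<^sup>2 * \<bar>P\<bar> / (4 * c))"
    proof -
      have "- av (fst Y) w \<le> B * p * q" using B(2)[OF k(4) w] by (simp add: p_def q_def abs_le_iff)
      moreover have "c * q\<^sup>2 \<le> av w w" using c(2)[OF w] by (simp add: q_def)
      ultimately have "- (av w w + av (fst Y) w) \<le> (B * p) * q - c * q\<^sup>2" by simp
      also have "\<dots> \<le> (B * p)\<^sup>2 / (4 * c)" by (rule young_absorb[OF c(1)])
      also have "\<dots> \<le> B\<^sup>2 * \<bar>P\<bar> / (4 * c)"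
        using p c(1) by (auto simp: power_mult_distrib intro!: divide_right_mono mult_left_mono)
      finally have "\<epsilon> * - (av w w + av (fst Y) w) \<le> \<epsilon> * (B\<^sup>2 * \<bar>P\<bar> / (4 * c))"
        using eps by (intro mult_left_mono) auto
      then show ?thesis by (simp only: mult_minus_right)
    qed
    finally show "W_inner (Z - Y) (gen_op \<Omega> (perturbed_form a0 av \<epsilon>) a1 \<nu> Z - gen_op \<Omega> (perturbed_form a0 av 0) a1 \<nu> Y)
      \<le> \<epsilon> * (B\<^sup>2 * \<bar>P\<bar> / (4 * c))" .
  qed
qed

lemma W_norm_Pair_zero: "W_norm \<Omega> a1 \<nu> (f, 0) = L2_norm \<Omega> f" if "f \<in> L2 \<Omega>"
  using L2r.N_nonneg[OF that] by (simp add: W_norm_def K.N_zero)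

lemma strongly_measurable_forcing:
  assumes "strongly_measurable (L2 \<Omega>) (L2_norm \<Omega>) M f"
  shows "strongly_measurable (W_space \<Omega> a1 \<nu>) (W_norm \<Omega> a1 \<nu>) M (\<lambda>s. (f s, 0))"
proof -
  obtain r where r: "\<And>n. simple_function M (r n)" "\<And>n t. t \<in> space M \<Longrightarrow> r n t \<in> L2 \<Omega>"
    "AE t in M. (\<lambda>n. L2_norm \<Omega> (r n t - f t)) \<longlonglongrightarrow> 0" by (rule L2r.strongly_measurableE[OF assms]) (rule that)
  note fm = L2r.strongly_measurable_mem[OF assms]
  show ?thesis
  proof (rule W.strongly_measurableI_lim[where s="\<lambda>n t. (r n t, 0)"])
    show "simple_function M (\<lambda>t. (r n t, 0 :: real \<Rightarrow> real^'d \<Rightarrow> real))" for n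
      by (rule simple_function_compose1[OF r(1)])
    show "AE t in M. (\<lambda>n. W_norm \<Omega> a1 \<nu> ((r n t, 0) - (f t, 0))) \<longlonglongrightarrow> 0"
      using r(3) AE_space[of M]
      by eventually_elim (simp add: W_norm_Pair_zero L2r.diff_mem r(2) fm)
  qed (use r(2) fm K.zero_mem in \<open>auto simp: W_space_def\<close>)
qed

end

theorem theorem6p3:
  fixes \<Omega> :: "(real^'d) set"
    and A0 A1 :: "real^'d \<Rightarrow> real^'d^'d"
    and a0 a1 av :: "(real^'d \<Rightarrow> real) \<Rightarrow> (real^'d \<Rightarrow> real) \<Rightarrow> real"
    and \<nu> :: "real measure"
    and S :: "real \<Rightarrow> real \<Rightarrow> (real^'d \<Rightarrow> real) \<times> (real \<Rightarrow> real^'d \<Rightarrow> real)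
                \<Rightarrow> (real^'d \<Rightarrow> real) \<times> (real \<Rightarrow> real^'d \<Rightarrow> real)"
    and W :: "((real^'d \<Rightarrow> real) \<times> (real \<Rightarrow> real^'d \<Rightarrow> real)) set"
    and nW :: "(real^'d \<Rightarrow> real) \<times> (real \<Rightarrow> real^'d \<Rightarrow> real) \<Rightarrow> real"
  assumes dim: "CARD('d) \<in> {1, 2, 3}"
    and dom: "bounded_lipschitz_domain \<Omega>"
    and A0: "Linf_symmetric_field \<Omega> A0"
    and A1: "Linf_symmetric_field \<Omega> A1" "psd_field \<Omega> A1"
    and a0_def: "a0 = dirichlet_form \<Omega> A0"
    and a1_def: "a1 = dirichlet_form \<Omega> A1"
    and bounded: "bounded_form_on_V \<Omega> a0" "bounded_form_on_V \<Omega> a1"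
    and a0_nonneg: "\<And>v. v \<in> V_space \<Omega> \<Longrightarrow> a0 v v \<ge> 0"
    and a1_coercive: "coercive_form_on_V \<Omega> a1"
    and av: "symmetric_bilinear_on_V \<Omega> av" "bounded_form_on_V \<Omega> av" "coercive_form_on_V \<Omega> av"
    and nu_borel: "sets \<nu> = sets (restrict_space borel {0..})"
    and nu_mass: "0 < emeasure \<nu> {0..}" "emeasure \<nu> {0..} < \<infinity>"
    and W_def: "W = W_space \<Omega> a1 \<nu>"
    and nW_def: "nW = W_norm \<Omega> a1 \<nu>"
    and semigroup: "\<And>\<epsilon>. \<epsilon> \<in> {0..1} \<Longrightarrow> c0_contraction_semigroup W nW (S \<epsilon>)"
    and generator: "\<And>\<epsilon>. \<epsilon> \<in> {0..1} \<Longrightarrow>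
          has_generator W nW (S \<epsilon>)
            (gen_domain \<Omega> (perturbed_form a0 av \<epsilon>) a1 \<nu>)
            (gen_op \<Omega> (perturbed_form a0 av \<epsilon>) a1 \<nu>)"
  shows "(\<forall>X0\<in>W. \<forall>T>0.
            ((\<lambda>\<epsilon>. SUP t\<in>{0..T}. ennreal (nW (S \<epsilon> t X0 - S 0 t X0))) \<longlongrightarrow> 0) (at_right 0))
       \<and> (\<forall>T>0. \<forall>X0 :: real \<Rightarrow> (real^'d \<Rightarrow> real) \<times> (real \<Rightarrow> real^'d \<Rightarrow> real).
          \<forall>f :: real \<Rightarrow> real \<Rightarrow> real^'d \<Rightarrow> real.
          \<forall>X :: real \<Rightarrow> real \<Rightarrow> (real^'d \<Rightarrow> real) \<times> (real \<Rightarrow> real^'d \<Rightarrow> real).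
            (\<forall>\<epsilon>\<in>{0..1}. X0 \<epsilon> \<in> W) \<longrightarrow>
            ((\<lambda>\<epsilon>. nW (X0 \<epsilon> - X0 0)) \<longlongrightarrow> 0) (at_right 0) \<longrightarrow>
            (\<forall>\<epsilon>\<in>{0..1}. f \<epsilon> \<in> L1_time \<Omega> T) \<longrightarrow>
            ((\<lambda>\<epsilon>. \<integral>\<^sup>+ s. ennreal (L2_norm \<Omega> (f \<epsilon> s - f 0 s)) \<partial>lebesgue_on {0<..<T}) \<longlongrightarrow> 0)
              (at_right 0) \<longrightarrow>
            (\<forall>\<epsilon>\<in>{0..1}. \<forall>t\<in>{0..T}.
               X \<epsilon> t = mild_solution W nW (S \<epsilon>) (X0 \<epsilon>) (\<lambda>s. (f \<epsilon> s, 0)) t) \<longrightarrow>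
            (\<forall>\<epsilon>\<in>{0..1}. \<forall>t\<in>{0..T}. X \<epsilon> t \<in> W \<and>
               ((\<lambda>s. nW (X \<epsilon> s - X \<epsilon> t)) \<longlongrightarrow> 0) (at t within {0..T})) \<and>
            ((\<lambda>\<epsilon>. SUP t\<in>{0..T}. ennreal (nW (X \<epsilon> t - X 0 t))) \<longlongrightarrow> 0) (at_right 0))"
proof -
  interpret bounded_open \<Omega>
    using dom by unfold_locales (auto simp: bounded_lipschitz_domain_def)
  interpret history_problem \<Omega> a1 \<nu>
    by unfold_locales
       (use a1_def symmetric_bilinear_dirichlet_form[OF A1(1)] bounded(2) a1_coercive nu_borel nu_mass in auto)
  have a0_bilinear: "symmetric_bilinear_on_V \<Omega> a0"
    unfolding a0_def by (rule symmetric_bilinear_dirichlet_form[OF A0])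
  let ?D = "\<lambda>\<epsilon>. gen_domain \<Omega> (perturbed_form a0 av \<epsilon>) a1 \<nu>"
  let ?A = "\<lambda>\<epsilon>. gen_op \<Omega> (perturbed_form a0 av \<epsilon>) a1 \<nu>"
  have WW: "semi_hilbert_space W nW W_inner"
    unfolding W_def nW_def by (rule W.semi_hilbert_space_axioms)
  interpret F: contraction_semigroup_family W nW W_inner S ?D ?A
  proof (intro contraction_semigroup_family.intro contraction_semigroup_family_axioms.intro WW)
    fix \<epsilon> :: real assume eps: "\<epsilon> \<in> {0..1}"
    show "contraction_semigroup W nW W_inner (S \<epsilon>) (?D \<epsilon>) (?A \<epsilon>)"
    proof (intro contraction_semigroup.intro contraction_semigroup_axioms.intro WW)
      show "c0_contraction_semigroup W nW (S \<epsilon>)" by (rule semigroup[OF eps])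
      show "has_generator W nW (S \<epsilon>) (?D \<epsilon>) (?A \<epsilon>)" by (rule generator[OF eps])
    qed (auto simp: W_def gen_op_mem intro: subsetD[OF gen_domain_subset])
  next
    fix R
    show "\<exists>C\<ge>0. \<forall>\<epsilon>\<in>{0<..1}. \<forall>Z\<in>?D \<epsilon>. \<forall>Y\<in>?D 0. nW Y \<le> R \<longrightarrow> nW (?A 0 Y) \<le> R \<longrightarrow>
        W_inner (Z - Y) (?A \<epsilon> Z - ?A 0 Y) \<le> \<epsilon> * C"
      unfolding nW_def by (rule energy_defect[OF a0_bilinear a0_nonneg av])
  qed
  show ?thesis
  proof (intro conjI ballI allI impI)
    fix X0 T assume X0: "X0 \<in> W" and T: "(0::real) < T"
    show "((\<lambda>\<epsilon>. SUP t\<in>{0..T}. ennreal (nW (S \<epsilon> t X0 - S 0 t X0))) \<longlongrightarrow> 0) (at_right 0)"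
      by (rule tendsto_SUP_ennreal_zero) (rule F.strong_convergence[OF X0 less_imp_le[OF T]])
  next
    fix T :: real and X0 :: "real \<Rightarrow> (real^'d \<Rightarrow> real) \<times> (real \<Rightarrow> real^'d \<Rightarrow> real)"
      and f :: "real \<Rightarrow> real \<Rightarrow> real^'d \<Rightarrow> real"
      and X :: "real \<Rightarrow> real \<Rightarrow> (real^'d \<Rightarrow> real) \<times> (real \<Rightarrow> real^'d \<Rightarrow> real)"
    assume T: "0 < T" and X0: "\<forall>\<epsilon>\<in>{0..1}. X0 \<epsilon> \<in> W" "((\<lambda>\<epsilon>. nW (X0 \<epsilon> - X0 0)) \<longlongrightarrow> 0) (at_right 0)"
      and f: "\<forall>\<epsilon>\<in>{0..1}. f \<epsilon> \<in> L1_time \<Omega> T"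
      and flim: "((\<lambda>\<epsilon>. \<integral>\<^sup>+ s. ennreal (L2_norm \<Omega> (f \<epsilon> s - f 0 s)) \<partial>lebesgue_on {0<..<T}) \<longlongrightarrow> 0) (at_right 0)"
      and X: "\<forall>\<epsilon>\<in>{0..1}. \<forall>t\<in>{0..T}. X \<epsilon> t = mild_solution W nW (S \<epsilon>) (X0 \<epsilon>) (\<lambda>s. (f \<epsilon> s, 0)) t"
    have fL2: "f \<epsilon> s \<in> L2 \<Omega>" if "\<epsilon> \<in> {0..1}" "s \<in> {0<..<T}" for \<epsilon> s
      using f that L2r.strongly_measurable_mem[of "lebesgue_on {0<..<T}" "f \<epsilon>" s] by (auto simp: L1_time_def)
    have forcing: "F.S0.forcing T (\<lambda>s. (f \<epsilon> s, 0))" if eps: "\<epsilon> \<in> {0..1}" for \<epsilon>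
    proof -
      have "(\<integral>\<^sup>+s. ennreal (nW (f \<epsilon> s, 0)) \<partial>lebesgue_on {0<..<T}) = (\<integral>\<^sup>+s. ennreal (L2_norm \<Omega> (f \<epsilon> s)) \<partial>lebesgue_on {0<..<T})"
        by (rule nn_integral_cong) (simp add: nW_def W_norm_Pair_zero fL2[OF eps])
      then show ?thesis
        using f eps strongly_measurable_forcing[of "lebesgue_on {0<..<T}" "f \<epsilon>"]
        unfolding F.S0.forcing_def unfolding L1_time_def W_def nW_def by auto
    qed
    have glim: "((\<lambda>\<epsilon>. \<integral>\<^sup>+s. ennreal (nW ((f \<epsilon> s, 0) - (f 0 s, 0))) \<partial>lebesgue_on {0<..<T}) \<longlongrightarrow> 0) (at_right 0)"
    proof (rule Lim_transform_eventually[OF flim])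
      have "eventually (\<lambda>\<epsilon>::real. 0 < \<epsilon> \<and> \<epsilon> < 1) (at_right 0)"
        by (auto simp: eventually_at_right_field intro!: exI[of _ 1])
      then show "eventually (\<lambda>\<epsilon>. (\<integral>\<^sup>+ s. ennreal (L2_norm \<Omega> (f \<epsilon> s - f 0 s)) \<partial>lebesgue_on {0<..<T})
          = (\<integral>\<^sup>+s. ennreal (nW ((f \<epsilon> s, 0) - (f 0 s, 0))) \<partial>lebesgue_on {0<..<T})) (at_right 0)"
      proof eventually_elim
        case (elim \<epsilon>)
        show ?case
          by (rule nn_integral_cong) (use elim in \<open>simp add: nW_def W_norm_Pair_zero L2r.diff_mem fL2\<close>)
      qed
    qed
    have X0W: "X0 \<epsilon> \<in> W" if "\<epsilon> \<in> {0..1}" for \<epsilon> using X0(1) that by blast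
    show "((\<lambda>\<epsilon>. SUP t\<in>{0..T}. ennreal (nW (X \<epsilon> t - X 0 t))) \<longlongrightarrow> 0) (at_right 0)"
    proof (rule tendsto_SUP_ennreal_zero)
      fix e :: real assume e: "0 < e"
      have "eventually (\<lambda>\<epsilon>. \<forall>t\<in>{0..T}. nW (mild_solution W nW (S \<epsilon>) (X0 \<epsilon>) (\<lambda>s. (f \<epsilon> s, 0)) t
          - mild_solution W nW (S 0) (X0 0) (\<lambda>s. (f 0 s, 0)) t) \<le> e) (at_right 0)"
        by (rule F.mild_convergence[OF X0W X0(2) forcing glim less_imp_le[OF T] e])
      moreover have "eventually (\<lambda>\<epsilon>::real. 0 < \<epsilon> \<and> \<epsilon> < 1) (at_right 0)"
        by (auto simp: eventually_at_right_field intro!: exI[of _ 1])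
      ultimately show "eventually (\<lambda>\<epsilon>. \<forall>t\<in>{0..T}. nW (X \<epsilon> t - X 0 t) \<le> e) (at_right 0)"
        by eventually_elim (use X in auto)
    qed
    fix \<epsilon> t assume eps: "\<epsilon> \<in> {0..1::real}" and t: "t \<in> {0..T}"
    interpret Se: contraction_semigroup W nW W_inner "S \<epsilon>" "?D \<epsilon>" "?A \<epsilon>" by (rule F.semigroups[OF eps])
    have Xt: "X \<epsilon> s = mild_solution W nW (S \<epsilon>) (X0 \<epsilon>) (\<lambda>s. (f \<epsilon> s, 0)) s" if "s \<in> {0..T}" for s
      using X eps that by blast
    show "X \<epsilon> t \<in> W"
      unfolding Xt[OF t] by (rule Se.mild_solution_mem[OF X0W[OF eps] forcing[OF eps] t])
    have "eventually (\<lambda>s. s \<in> {0..T}) (at t within {0..T})" by (simp add: eventually_at_topological) blast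
    then have "eventually (\<lambda>s. nW (mild_solution W nW (S \<epsilon>) (X0 \<epsilon>) (\<lambda>s. (f \<epsilon> s, 0)) s
        - mild_solution W nW (S \<epsilon>) (X0 \<epsilon>) (\<lambda>s. (f \<epsilon> s, 0)) t) = nW (X \<epsilon> s - X \<epsilon> t)) (at t within {0..T})"
    proof eventually_elim
      case (elim s)
      show ?case unfolding Xt[OF elim] Xt[OF t] ..
    qed
    with Se.mild_solution_continuous[OF X0W[OF eps] forcing[OF eps] t]
    show "((\<lambda>s. nW (X \<epsilon> s - X \<epsilon> t)) \<longlongrightarrow> 0) (at t within {0..T})"
      by (rule Lim_transform_eventually)
  qed
qed

end
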